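(* Let $Z=(Z_t)_{t\in[0,T]}$ be a square integrable process on $(\Omega,\mathscr{F},\mathbf{P})$ which, under an equivalent probability $\mathbf{Q}\sim\mathbf{P}$, is a centered Gaussian process (so that $Z_t\in\mathrm{L}^2(\mathbf{P})\cap\mathrm{L}^2(\mathbf{Q})$ for every $t$). Let $\{Z(h),h\in\mathfrak{H}\}$ be the first Wiener chaos of $Z$ under $\mathbf{Q}$ represented as an isonormal Gaussian process over the Hilbert space $\mathfrak{H}$, and let $D$ be the Malliavin derivative associated with $Z$ under $\mathbf{Q}$. Fix $t\in(0,T)$ and $g\in\mathfrak{H}$ such that $\langle\mathbf{1}_{[0,t]},g\rangle_{\mathfrak{H}}\ne0$. Let $\eta$ be the Radon–Nikodym derivative of $\mathbf{Q}$ with respect to $\mathbf{P}$ ($d\mathbf{Q}=\eta\,d\mathbf{P}$), and assume that $\eta=\exp(-\zeta)$ for some random variable $\zeta$ for which $D\zeta$ exists. Suppose that $$\mu_t:=\lim_{h\to0}h^{-1}\langle\mathbf{1}_{[t,t+h]},D\zeta\rangle_{\mathfrak{H}}\quad\text{exists in the }\mathrm{L}^2\text{ topology}.$$ Then $Z(g)$ $\mathrm{L}^2$-differentiates $Z$ at $t$ under $\mathbf{P}$ if, and only if, $Z(g)$ $\mathrm{L}^2$-differentiates $Z$ at $t$ under $\mathbf{Q}$, that is, if, and only if, $$\frac{d}{du}\langle g,\mathbf{1}_{[0,u]}\rangle_{\mathfrak{H}}\Big|_{u=t}=\frac{d}{du}\mathrm{Cov}^{\mathbf{Q}}(Z(g),Z_u)\Big|_{u=t}\quad\text{exists}.$$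 Moreover: 1. If $Z(g)$ $\mathrm{L}^2$-differentiates $Z$ at $t$ under $\mathbf{Q}$, then $$D^{Z(g)}_{\mathbf{P}}Z_t=\frac{|g|^2_{\mathfrak{H}}\ \mathrm{E}^{\mathbf{P}}[Z_t-\langle\mathbf{1}_{[0,t]},D\zeta\rangle_{\mathfrak{H}}\mid Z(g)]}{Z(g)\,\langle g,\mathbf{1}_{[0,t]}\rangle_{\mathfrak{H}}}\,D^{Z(g)}_{\mathbf{Q}}Z_t+\mathrm{E}^{\mathbf{P}}[\mu_t\mid Z(g)].$$ 2. If $Z(g)$ does not $\mathrm{L}^2$-differentiate $Z$ at $t$ under $\mathbf{Q}$, then a $\sigma$-field $\mathscr{H}\subset\sigma\{Z(g)\}$ $\mathrm{L}^2$-differentiates $Z$ at $t$ under $\mathbf{P}$ if, and only if, $$\mathrm{E}^{\mathbf{P}}[Z_t-\langle\mathbf{1}_{[0,t]},D\zeta\rangle_{\mathfrak{H}}\mid\mathscr{H}]=0.$$ In this case, $D^{\mathscr{H}}_{\mathbf{P}}Z_t=\mathrm{E}^{\mathbf{P}}[\mu_t\mid\mathscr{H}]$.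
   Context: Isonormal representation: $\mathcal{H}_1(Z,\mathbf{Q})=\{Z(h),h\in\mathfrak{H}\}$ is the closed linear span in $\mathrm{L}^2(\mathbf{Q})$ of $\{Z_t:t\in[0,T]\}$, where $(\mathfrak{H},\langle\cdot,\cdot\rangle_{\mathfrak{H}})$ is the separable Hilbert space obtained as the closure of the set $\mathcal{E}$ of step functions on $[0,T]$ for the scalar product determined by $\langle\mathbf{1}_{[0,s]},\mathbf{1}_{[0,t]}\rangle_{\mathfrak{H}}=\mathrm{E}^{\mathbf{Q}}[Z_sZ_t]$; $h\mapsto Z(h)$ is the linear isometry extending $\mathbf{1}_{[0,t]}\mapsto Z_t$, so $\langle h,h'\rangle_{\mathfrak{H}}=\mathrm{E}^{\mathbf{Q}}[Z(h)Z(h')]$, and $|\cdot|_{\mathfrak{H}}$ is the norm. $D$ is the usual ($\mathfrak{H}$-valued) Malliavin derivative for this isonormal process under $\mathbf{Q}$. For $h<0$, $\mathbf{1}_{[t,t+h]}$ is understood as $\mathbf{1}_{[0,t+h]}-\mathbf{1}_{[0,t]}$. Convergences are with respect to the reference measure $\mathbf{P}$ unless otherwise specified. Stochastic derivative: for $t\in(0,T)$ and $h\neq0$ with $t+h\in(0,T)$, set $\Delta_hZ_t=(Z_{t+h}-Z_t)/h$. A sub-$\sigma$-field $\mathscr{G}$ of $\mathscr{F}$ $\mathrm{L}^2$-differentiates $Z$ at $t$ under a probability $\mathbf{R}\in\{\mathbf{P},\mathbf{Q}\}$ if $\mathrm{E}^{\mathbf{R}}[\Delta_hZ_t\mid\mathscr{G}]$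 converges in $\mathrm{L}^2(\mathbf{R})$ as $h\to0$; the limit is denoted $D^{\mathscr{G}}_{\mathbf{R}}Z_t$. A random variable $Y$ $\mathrm{L}^2$-differentiates $Z$ at $t$ if $\sigma\{Y\}$ does, and $D^{Y}_{\mathbf{R}}Z_t:=D^{\sigma\{Y\}}_{\mathbf{R}}Z_t$.
   Formalization: The formal statement additionally assumes that ⟨1_[0,t], Dζ⟩ is P-integrable, which does not follow from the stated hypotheses and is needed for the conditional expectations E^P[Z_t − ⟨1_[0,t], Dζ⟩ | ·] in items 1 and 2 to be defined. *)

theory Defs
  imports "HOL-Probability.Probability"
begin

section \<open>Square integrable variables, Gaussian processes\<close>

definition L2 :: "'a measure \<Rightarrow> ('a \<Rightarrow> 'b::{real_normed_vector, second_countable_topology}) set" where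
  "L2 M = {X. X \<in> borel_measurable M \<and> integrable M (\<lambda>\<omega>. (norm (X \<omega>))\<^sup>2)}"

definition L2_tendsto ::
  "'a measure \<Rightarrow> ('i \<Rightarrow> 'a \<Rightarrow> 'b::{real_normed_vector, second_countable_topology}) \<Rightarrow> ('a \<Rightarrow> 'b) \<Rightarrow> 'i filter \<Rightarrow> bool" where
  "L2_tendsto M X Y F \<longleftrightarrow>
     (\<forall>\<^sub>F i in F. X i \<in> L2 M) \<and> Y \<in> L2 M \<and>
     ((\<lambda>i. \<integral>\<omega>. (norm (X i \<omega> - Y \<omega>))\<^sup>2 \<partial>M) \<longlongrightarrow> 0) F"

definition covariance :: "'a measure \<Rightarrow> ('a \<Rightarrow> real) \<Rightarrow> ('a \<Rightarrow> real) \<Rightarrow> real" where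
  "covariance M X Y =
     (\<integral>\<omega>. (X \<omega> - (\<integral>\<omega>'. X \<omega>' \<partial>M)) * (Y \<omega> - (\<integral>\<omega>'. Y \<omega>' \<partial>M)) \<partial>M)"

text \<open>The degenerate law (variance zero) counts as Gaussian.\<close>

definition centered_gaussian :: "'a measure \<Rightarrow> ('a \<Rightarrow> real) \<Rightarrow> bool" where
  "centered_gaussian M X \<longleftrightarrow>
     X \<in> borel_measurable M \<and>
     ((AE \<omega> in M. X \<omega> = 0) \<or> (\<exists>\<sigma>>0. distributed M lborel X (normal_density 0 \<sigma>)))"

definition centered_gaussian_process ::
  "'a measure \<Rightarrow> 'i set \<Rightarrow> ('i \<Rightarrow> 'a \<Rightarrow> real) \<Rightarrow> bool" where
  "centered_gaussian_process M I Z \<longleftrightarrow>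
     (\<forall>(n::nat) c s. (\<forall>i<n. s i \<in> I) \<longrightarrow> centered_gaussian M (\<lambda>\<omega>. \<Sum>i<n. c i * Z (s i) \<omega>))"


section \<open>Isonormal representation\<close>

definition step_functions :: "real \<Rightarrow> (real \<Rightarrow> real) set" where
  "step_functions T =
     {\<phi>. \<exists>(n::nat) c s. (\<forall>i<n. s i \<in> {0..T}) \<and> \<phi> = (\<lambda>x. \<Sum>i<n. c i * indicat_real {0..s i} x)}"

text \<open>
  The increment \<open>1\<^bsub>[0,t+h]\<^esub> - 1\<^bsub>[0,t]\<^esub>\<close>, written \<open>1\<^bsub>[t,t+h]\<^esub>\<close> for either sign of \<open>h\<close>.  For \<open>h > 0\<close>
  it is the indicator of the half-open interval, whose image under the isometry is
  \<open>Z\<^bsub>t+h\<^esub> - Z\<^bsub>t\<^esub>\<close>.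
\<close>

definition step_incr :: "real \<Rightarrow> real \<Rightarrow> real \<Rightarrow> real" where
  "step_incr t h = (\<lambda>x. indicat_real {0..t + h} x - indicat_real {0..t} x)"

text \<open>
  A separable Hilbert space, given as a type \<open>'h\<close>, is the completion of the step functions for the
  covariance of \<open>Z\<close> under \<open>M\<close>: the map \<open>J\<close> sends a step function to its class, is linear with dense
  image, and carries the covariance form to the inner product.  This determines \<open>('h, J)\<close> up to
  a unique isometry; \<open>J\<close> need not be injective, since the covariance form may be degenerate.
\<close>

definition step_completion ::
  "'a measure \<Rightarrow> real \<Rightarrow> (real \<Rightarrow> 'a \<Rightarrow> real) \<Rightarrow>
   ((real \<Rightarrow> real) \<Rightarrow> 'h::{real_inner, banach, second_countable_topology}) \<Rightarrow> bool" where
  "step_completion M T Z J \<longleftrightarrow>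
     (\<forall>\<phi>\<in>step_functions T. \<forall>\<psi>\<in>step_functions T. \<forall>a b.
        J (\<lambda>x. a * \<phi> x + b * \<psi> x) = a *\<^sub>R J \<phi> + b *\<^sub>R J \<psi>) \<and>
     (\<forall>s\<in>{0..T}. \<forall>u\<in>{0..T}.
        inner (J (indicat_real {0..s})) (J (indicat_real {0..u})) = (\<integral>\<omega>. Z s \<omega> * Z u \<omega> \<partial>M)) \<and>
     closure (J ` step_functions T) = UNIV"

text \<open>
  The linear isometry \<open>h \<mapsto> Z(h)\<close> into \<open>L\<^sup>2\<close> extending \<open>1\<^bsub>[0,u]\<^esub> \<mapsto> Z\<^sub>u\<close>.  Elements of \<open>L\<^sup>2\<close> are
  represented by functions, so linearity and the extension property hold almost everywhere.
  The range of \<open>W\<close> is then the closed linear span of \<open>Z\<close>, the first Wiener chaos.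
\<close>

definition isonormal_extension ::
  "'a measure \<Rightarrow> real \<Rightarrow> (real \<Rightarrow> 'a \<Rightarrow> real) \<Rightarrow>
   ((real \<Rightarrow> real) \<Rightarrow> 'h::{real_inner, banach, second_countable_topology}) \<Rightarrow> ('h \<Rightarrow> 'a \<Rightarrow> real) \<Rightarrow> bool" where
  "isonormal_extension M T Z J W \<longleftrightarrow>
     (\<forall>h. W h \<in> L2 M) \<and>
     (\<forall>a b h k. AE \<omega> in M. W (a *\<^sub>R h + b *\<^sub>R k) \<omega> = a * W h \<omega> + b * W k \<omega>) \<and>
     (\<forall>h k. (\<integral>\<omega>. W h \<omega> * W k \<omega> \<partial>M) = inner h k) \<and>
     (\<forall>u\<in>{0..T}. AE \<omega> in M. W (J (indicat_real {0..u})) \<omega> = Z u \<omega>)"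


section \<open>Malliavin derivative\<close>

text \<open>
  Functions on \<open>\<real>\<^sup>n\<close>, with \<open>n\<close> a number, are functions of \<open>nat \<Rightarrow> real\<close> depending only on the
  coordinates below \<open>n\<close>.  The class below consists of the smooth functions which have polynomial
  growth together with all their partial derivatives; a list of coordinates stands for the
  corresponding iterated partial derivative.
\<close>

definition partial_deriv :: "nat \<Rightarrow> ((nat \<Rightarrow> real) \<Rightarrow> real) \<Rightarrow> (nat \<Rightarrow> real) \<Rightarrow> real" where
  "partial_deriv i f x = deriv (\<lambda>y. f (x(i := y))) (x i)"

definition smooth_poly_growth :: "nat \<Rightarrow> ((nat \<Rightarrow> real) \<Rightarrow> real) \<Rightarrow> bool" where
  "smooth_poly_growth n f \<longleftrightarrow>
     (\<forall>x y. (\<forall>i<n. x i = y i) \<longrightarrow> f x = f y) \<and>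
     (\<forall>\<alpha>. set \<alpha> \<subseteq> {..<n} \<longrightarrow>
        continuous_on UNIV (foldr partial_deriv \<alpha> f) \<and>
        (\<forall>i<n. \<forall>x. (\<lambda>y. foldr partial_deriv \<alpha> f (x(i := y))) differentiable (at (x i))) \<and>
        (\<exists>C k. \<forall>x. \<bar>foldr partial_deriv \<alpha> f x\<bar> \<le> C * (1 + (\<Sum>i<n. \<bar>x i\<bar>)) ^ k))"

definition smooth_cylindrical ::
  "('h::real_inner \<Rightarrow> 'a \<Rightarrow> real) \<Rightarrow> ('a \<Rightarrow> real) \<Rightarrow> ('a \<Rightarrow> 'h) \<Rightarrow> bool" where
  "smooth_cylindrical W F DF \<longleftrightarrow>
     (\<exists>n f h. smooth_poly_growth n f \<and>
        F = (\<lambda>\<omega>. f (\<lambda>i. W (h i) \<omega>)) \<and>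
        DF = (\<lambda>\<omega>. \<Sum>i<n. partial_deriv i f (\<lambda>i. W (h i) \<omega>) *\<^sub>R h i))"

text \<open>
  The closure, in \<open>L\<^sup>2(M) \<times> L\<^sup>2(M; 'h)\<close>, of the derivative on smooth cylindrical variables: \<open>F\<close>
  lies in the usual domain \<open>\<bbbD>\<^bsup>1,2\<^esup>\<close> and \<open>DF\<close> is a version of its derivative.
\<close>

definition has_malliavin_derivative ::
  "'a measure \<Rightarrow> ('h::{real_inner, banach, second_countable_topology} \<Rightarrow> 'a \<Rightarrow> real) \<Rightarrow>
   ('a \<Rightarrow> real) \<Rightarrow> ('a \<Rightarrow> 'h) \<Rightarrow> bool" where
  "has_malliavin_derivative M W F DF \<longleftrightarrow>
     (\<exists>Fn DFn. (\<forall>n::nat. smooth_cylindrical W (Fn n) (DFn n)) \<and>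
        L2_tendsto M Fn F sequentially \<and> L2_tendsto M DFn DF sequentially)"


section \<open>Stochastic derivatives\<close>

text \<open>
  For \<open>t\<close> in the open interval \<open>(0,T)\<close> the increments with \<open>t + h\<close> outside \<open>(0,T)\<close>
  do not affect the limit along \<open>at 0\<close>.
\<close>

definition has_L2_derivative ::
  "'a measure \<Rightarrow> 'a measure \<Rightarrow> (real \<Rightarrow> 'a \<Rightarrow> real) \<Rightarrow> real \<Rightarrow> ('a \<Rightarrow> real) \<Rightarrow> bool" where
  "has_L2_derivative R G Z t Y \<longleftrightarrow>
     subalgebra R G \<and>
     L2_tendsto R (\<lambda>h. real_cond_exp R G (\<lambda>\<omega>. (Z (t + h) \<omega> - Z t \<omega>) / h)) Y (at 0)"

definition L2_differentiates ::
  "'a measure \<Rightarrow> 'a measure \<Rightarrow> (real \<Rightarrow> 'a \<Rightarrow> real) \<Rightarrow> real \<Rightarrow> bool" where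
  "L2_differentiates R G Z t \<longleftrightarrow> (\<exists>Y. has_L2_derivative R G Z t Y)"

text \<open>A version of the limit, which is unique up to null sets.\<close>

definition L2_derivative ::
  "'a measure \<Rightarrow> 'a measure \<Rightarrow> (real \<Rightarrow> 'a \<Rightarrow> real) \<Rightarrow> real \<Rightarrow> 'a \<Rightarrow> real" where
  "L2_derivative R G Z t = (SOME Y. has_L2_derivative R G Z t Y)"

definition sigma_rv :: "'a measure \<Rightarrow> ('a \<Rightarrow> real) \<Rightarrow> 'a measure" where
  "sigma_rv R Y = vimage_algebra (space R) Y borel"

end

theory Submission
  imports Defs
begin

text \<open>
  Gaussian integration by parts under \<open>Q\<close> against the density \<open>dP/dQ = exp \<zeta>\<close> gives, for test functions
  \<open>\<phi>\<close> and \<open>k\<close> in the Hilbert space,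
  \<open>E\<^sup>P[\<phi>(Z(g)) (Z(k) - \<langle>k, D\<zeta>\<rangle>)] = \<langle>g, k\<rangle> E\<^sup>P[\<phi>'(Z(g))]\<close>.
  Taking for \<open>k\<close> both the increment \<open>1\<^bsub>[t,t+h]\<^esub>\<close> and \<open>1\<^bsub>[0,t]\<^esub>\<close> and eliminating \<open>E\<^sup>P[\<phi>'(Z(g))]\<close> shows that the
  conditional expectation of the difference quotient is \<open>a\<^sub>h m + n\<^sub>h\<close>, where \<open>n\<^sub>h\<close> converges to
  \<open>E\<^sup>P[\<mu> | Z(g)]\<close>, \<open>m = E\<^sup>P[Z\<^sub>t - \<langle>1\<^bsub>[0,t]\<^esub>, D\<zeta>\<rangle> | Z(g)]\<close> and \<open>a\<^sub>h\<close> is the difference quotient of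
  \<open>\<langle>g, 1\<^bsub>[0,u]\<^esub>\<rangle>\<close> up to a constant factor. So the limit exists iff \<open>a\<^sub>h\<close> converges or \<open>m = 0\<close>.
  The same computation with \<open>\<zeta> = 0\<close> treats \<open>Q\<close>, and conditioning on a smaller field treats \<open>H\<close>.
\<close>

section \<open>Fourier uniqueness with weights\<close>

text \<open>The obstacle is that \<open>\<zeta>\<close> is only assumed to lie in the domain of the
  derivative: \<open>exp \<zeta>\<close> is integrable under Q, but it need not be square integrable
  or differentiable. Integration by parts is therefore established for bounded functions of
  \<open>\<zeta>\<close> and carried to \<open>exp \<zeta>\<close> by dominated convergence, with
  integrability under P as the only control. Sines and cosines suffice as test functions, since a
  signed weight with vanishing Fourier transform along Z(g) integrates to 0 over every set of the
  field of Z(g). The same uniqueness in several variables gives the independence of orthogonal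
  directions on which Gaussian integration by parts rests. The variable m is merely integrable under
  P. However, \<open>a\<^sub>h m\<close> is a difference of square integrable variables for small h,
  so either m is square integrable or \<open>a\<^sub>h\<close> vanishes eventually. Under Q the part
  of m is played by Z(g) itself, that is, the second test direction is g instead of the indicator of
  [0,t]. This is where the square of the norm of g and the division by Z(g) in the formula come
  from.\<close>

lemma integral_weighted_indicator_eq_0_real:
  fixes X Y :: "'a \<Rightarrow> real"
  assumes X[measurable]: "X \<in> borel_measurable M" and Y: "integrable M Y"
    and zero: "\<And>s. (\<integral>\<omega>. iexp (s * X \<omega>) * complex_of_real (Y \<omega>) \<partial>M) = 0"
    and A[measurable]: "A \<in> sets borel"
  shows "(\<integral>\<omega>. indicat_real A (X \<omega>) * Y \<omega> \<partial>M) = 0"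
proof -
  define Y1 Y2 where "Y1 = (\<lambda>\<omega>. max 0 (Y \<omega>))" and "Y2 = (\<lambda>\<omega>. max 0 (- Y \<omega>))"
  have Y_eq: "Y \<omega> = Y1 \<omega> - Y2 \<omega>" for \<omega> by (auto simp: Y1_def Y2_def)
  have Y1: "integrable M Y1" and Y2: "integrable M Y2"
    using Y by (auto simp: Y1_def Y2_def)
  have nn: "0 \<le> Y1 \<omega>" "0 \<le> Y2 \<omega>" for \<omega> by (auto simp: Y1_def Y2_def)
  have Ym[measurable]: "Y \<in> borel_measurable M" "Y1 \<in> borel_measurable M" "Y2 \<in> borel_measurable M"
    using Y Y1 Y2 by auto
  have bounded_mult: "integrable M (\<lambda>\<omega>. f \<omega> * g \<omega>)"
    if "f \<in> borel_measurable M" "\<And>\<omega>. norm (f \<omega>) \<le> 1" "integrable M g" for f g :: "'a \<Rightarrow> complex"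
    using that(3)
  proof (rule Bochner_Integration.integrable_bound)
    show "(\<lambda>\<omega>. f \<omega> * g \<omega>) \<in> borel_measurable M" using that by measurable
    show "AE x in M. norm (f x * g x) \<le> norm (g x)"
      using that(2) by (auto simp: norm_mult mult_left_le_one_le)
  qed
  have split: "(\<integral>\<omega>. iexp (s * X \<omega>) * complex_of_real (Y1 \<omega>) \<partial>M) = (\<integral>\<omega>. iexp (s * X \<omega>) * complex_of_real (Y2 \<omega>) \<partial>M)" for s
  proof -
    have "(\<integral>\<omega>. iexp (s * X \<omega>) * complex_of_real (Y1 \<omega>) \<partial>M) - (\<integral>\<omega>. iexp (s * X \<omega>) * complex_of_real (Y2 \<omega>) \<partial>M)
      = (\<integral>\<omega>. iexp (s * X \<omega>) * complex_of_real (Y1 \<omega>) - iexp (s * X \<omega>) * complex_of_real (Y2 \<omega>) \<partial>M)"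
      by (subst Bochner_Integration.integral_diff) (auto intro!: bounded_mult Y1 Y2)
    also have "\<dots> = 0" using zero[of s] by (simp add: Y_eq algebra_simps)
    finally show ?thesis by simp
  qed
  \<comment> \<open>The common mass of the two parts, equal by the hypothesis at frequency 0. If it
    is 0, then \<open>Y\<close> vanishes almost everywhere; otherwise it normalises both parts to
    probability densities.\<close>
  define c where "c = (\<integral>\<omega>. Y1 \<omega> \<partial>M)"
  have c2: "c = (\<integral>\<omega>. Y2 \<omega> \<partial>M)"
    using split[of 0] by (simp add: c_def)
  have c0: "c \<ge> 0" unfolding c_def by (simp add: nn)
  show ?thesis
  proof (cases "c = 0")
    case True
    have "AE \<omega> in M. Y1 \<omega> = 0" "AE \<omega> in M. Y2 \<omega> = 0"
      using integral_nonneg_eq_0_iff_AE[OF Y1] integral_nonneg_eq_0_iff_AE[OF Y2] nn True c_def c2 by auto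
    then have "AE \<omega> in M. indicat_real A (X \<omega>) * Y \<omega> = 0" by eventually_elim (simp add: Y_eq)
    then show ?thesis by (simp add: integral_eq_zero_AE)
  next
    case False
    with c0 have c: "c > 0" by simp
    \<comment> \<open>The law of \<open>X\<close> under the density \<open>U / c\<close>. For
      \<open>Y1\<close> and \<open>Y2\<close> these laws have the same characteristic function, so
      Levy's uniqueness theorem identifies them.\<close>
    define N where "N = (\<lambda>U::'a\<Rightarrow>real. distr (density M (\<lambda>\<omega>. ennreal (U \<omega> / c))) borel X)"
    have N: "real_distribution (N U) \<and> (\<forall>s. char (N U) s = (\<integral>\<omega>. iexp (s * X \<omega>) * complex_of_real (U \<omega>) \<partial>M) / c)
        \<and> measure (N U) A = (\<integral>\<omega>. indicat_real A (X \<omega>) * U \<omega> \<partial>M) / c"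
      if U: "integrable M U" "\<And>\<omega>. 0 \<le> U \<omega>" "c = (\<integral>\<omega>. U \<omega> \<partial>M)" for U
    proof -
      have [measurable]: "U \<in> borel_measurable M" using U by auto
      have e: "emeasure (density M (\<lambda>\<omega>. ennreal (U \<omega> / c))) (space M) = 1"
        using U c by (subst emeasure_density) (auto simp: nn_integral_eq_integral cong: nn_integral_cong)
      interpret D: prob_space "density M (\<lambda>\<omega>. ennreal (U \<omega> / c))"
        by (rule prob_spaceI) (use e in simp)
      have rd: "real_distribution (N U)" unfolding N_def by (rule D.real_distribution_distr) simp
      have "char (N U) s = (\<integral>\<omega>. iexp (s * X \<omega>) * complex_of_real (U \<omega>) \<partial>M) / c" for s
        unfolding char_def N_def using U c
        by (simp add: integral_distr integral_density scaleR_conv_of_real mult.commute)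
      moreover have "measure (N U) A = (\<integral>\<omega>. indicat_real A (X \<omega>) * U \<omega> \<partial>M) / c"
      proof -
        interpret R: real_distribution "N U" by fact
        have "measure (N U) A = (\<integral>x. indicat_real A x \<partial>N U)" by simp
        also have "\<dots> = (\<integral>\<omega>. indicat_real A (X \<omega>) * U \<omega> \<partial>M) / c"
          unfolding N_def using U c
          by (subst integral_distr) (auto simp: integral_density mult.commute)
        finally show ?thesis .
      qed
      ultimately show ?thesis using rd by auto
    qed
    have "N Y1 = N Y2"
      using N[OF Y1 nn(1) c_def] N[OF Y2 nn(2) c2] split by (intro Levy_uniqueness) auto
    then have eq: "(\<integral>\<omega>. indicat_real A (X \<omega>) * Y1 \<omega> \<partial>M) = (\<integral>\<omega>. indicat_real A (X \<omega>) * Y2 \<omega> \<partial>M)"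
      using N[OF Y1 nn(1) c_def] N[OF Y2 nn(2) c2] c by auto
    have i: "integrable M (\<lambda>\<omega>. indicat_real A (X \<omega>) * U \<omega>)" if "integrable M U" for U
      by (rule Bochner_Integration.integrable_bound[OF that]) (use that in \<open>auto simp: indicator_def\<close>)
    show ?thesis
      using eq by (simp add: Y_eq right_diff_distrib Bochner_Integration.integral_diff[OF i[OF Y1] i[OF Y2]])
  qed
qed

text \<open>Complex weights are needed because the induction over several variables multiplies the
  weight by characters. The transform of \<open>cnj Y\<close> at \<open>s\<close> is the conjugate
  of that of \<open>Y\<close> at \<open>-s\<close>, so the real and imaginary parts of
  \<open>Y\<close> have vanishing transforms separately.\<close>

lemma integral_weighted_indicator_eq_0:
  fixes X :: "'a \<Rightarrow> real" and Y :: "'a \<Rightarrow> complex"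
  assumes X[measurable]: "X \<in> borel_measurable M" and Y: "integrable M Y"
    and zero: "\<And>s. (\<integral>\<omega>. iexp (s * X \<omega>) * Y \<omega> \<partial>M) = 0"
    and A[measurable]: "A \<in> sets borel"
  shows "(\<integral>\<omega>. indicator A (X \<omega>) * Y \<omega> \<partial>M) = 0"
proof -
  have [measurable]: "Y \<in> borel_measurable M" using Y by auto
  have bm: "integrable M (\<lambda>\<omega>. f \<omega> * g \<omega>)"
    if "f \<in> borel_measurable M" "\<And>\<omega>. norm (f \<omega>) \<le> 1" "integrable M g" for f g :: "'a \<Rightarrow> complex"
    using that(3)
  proof (rule Bochner_Integration.integrable_bound)
    show "(\<lambda>\<omega>. f \<omega> * g \<omega>) \<in> borel_measurable M" using that by measurable
    show "AE x in M. norm (f x * g x) \<le> norm (g x)"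
      using that(2) by (auto simp: norm_mult mult_left_le_one_le)
  qed
  have cY: "integrable M (\<lambda>\<omega>. cnj (Y \<omega>))" using Y by simp
  have zc: "(\<integral>\<omega>. iexp (s * X \<omega>) * cnj (Y \<omega>) \<partial>M) = 0" for s
  proof -
    have "(\<integral>\<omega>. iexp (s * X \<omega>) * cnj (Y \<omega>) \<partial>M) = (\<integral>\<omega>. cnj (iexp (- s * X \<omega>) * Y \<omega>) \<partial>M)"
      by (simp add: exp_cnj)
    also have "\<dots> = 0" using zero[of "-s"] by (simp only: Bochner_Integration.integral_cnj) simp
    finally show ?thesis .
  qed
  have i1: "integrable M (\<lambda>\<omega>. iexp (s * X \<omega>) * Y \<omega>)" for s by (rule bm[OF _ _ Y]) auto
  have i2: "integrable M (\<lambda>\<omega>. iexp (s * X \<omega>) * cnj (Y \<omega>))" for s by (rule bm[OF _ _ cY]) auto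
  have re: "(\<integral>\<omega>. iexp (s * X \<omega>) * complex_of_real (Re (Y \<omega>)) \<partial>M) = 0" for s
  proof -
    have "iexp (s * X \<omega>) * complex_of_real (Re (Y \<omega>)) = (iexp (s * X \<omega>) * Y \<omega> + iexp (s * X \<omega>) * cnj (Y \<omega>)) / 2" for \<omega>
      by (simp add: complex_add_cnj distrib_left[symmetric] mult.assoc)
    then show ?thesis using zero[of s] zc[of s] i1[of s] i2[of s]
      by (simp only: Bochner_Integration.integral_divide_zero Bochner_Integration.integral_add) simp
  qed
  have im: "(\<integral>\<omega>. iexp (s * X \<omega>) * complex_of_real (Im (Y \<omega>)) \<partial>M) = 0" for s
  proof -
    have "iexp (s * X \<omega>) * complex_of_real (Im (Y \<omega>)) = (iexp (s * X \<omega>) * Y \<omega> - iexp (s * X \<omega>) * cnj (Y \<omega>)) / (2 * \<i>)" for \<omega>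
      unfolding right_diff_distrib[symmetric] complex_diff_cnj by (simp add: field_simps)
    then show ?thesis using zero[of s] zc[of s] i1[of s] i2[of s]
      by (simp only: Bochner_Integration.integral_divide_zero Bochner_Integration.integral_diff) simp
  qed
  have iA: "integrable M (\<lambda>\<omega>. indicator A (X \<omega>) * Y \<omega>)"
    by (rule bm[OF _ _ Y]) (auto simp: indicator_def)
  have "Re (\<integral>\<omega>. indicator A (X \<omega>) * Y \<omega> \<partial>M) = (\<integral>\<omega>. indicat_real A (X \<omega>) * Re (Y \<omega>) \<partial>M)"
    by (subst integral_Re[symmetric, OF iA]) (auto intro!: Bochner_Integration.integral_cong simp: indicator_def)
  also have "\<dots> = 0" using Y re by (intro integral_weighted_indicator_eq_0_real) auto
  finally have *: "Re (\<integral>\<omega>. indicator A (X \<omega>) * Y \<omega> \<partial>M) = 0" .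
  have "Im (\<integral>\<omega>. indicator A (X \<omega>) * Y \<omega> \<partial>M) = (\<integral>\<omega>. indicat_real A (X \<omega>) * Im (Y \<omega>) \<partial>M)"
    by (subst integral_Im[symmetric, OF iA]) (auto intro!: Bochner_Integration.integral_cong simp: indicator_def)
  also have "\<dots> = 0" using Y im by (intro integral_weighted_indicator_eq_0_real) auto
  finally show ?thesis using * by (simp add: complex_eq_iff)
qed

text \<open>Characters are exchanged for indicators one variable at a time. The character of the new
  variable is absorbed into the weight, the induction hypothesis treats the others, and then the
  one-variable result treats the new one with the other indicators as part of the weight. Hence
  \<open>Y\<close> has to vary in the induction.\<close>

lemma integral_weighted_indicators_eq_0:
  fixes X :: "'i \<Rightarrow> 'a \<Rightarrow> real" and Y :: "'a \<Rightarrow> complex"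
  assumes "finite I" and X: "\<And>i. i \<in> I \<Longrightarrow> X i \<in> borel_measurable M" and "integrable M Y"
    and "\<And>c. (\<integral>\<omega>. iexp (\<Sum>i\<in>I. c i * X i \<omega>) * Y \<omega> \<partial>M) = 0"
    and "\<And>i. i \<in> I \<Longrightarrow> A i \<in> sets borel"
  shows "(\<integral>\<omega>. (\<Prod>i\<in>I. indicator (A i) (X i \<omega>)) * Y \<omega> \<partial>M) = 0"
  using assms
proof (induction I arbitrary: Y rule: finite_induct)
  case empty
  then show ?case by simp
next
  case (insert j I)
  have [measurable]: "X j \<in> borel_measurable M" "Y \<in> borel_measurable M" using insert.prems by auto
  have [measurable]: "i \<in> I \<Longrightarrow> A i \<in> sets borel" "i \<in> I \<Longrightarrow> X i \<in> borel_measurable M" for i using insert.prems by auto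
  have z: "(\<integral>\<omega>. (\<Prod>i\<in>I. indicator (A i) (X i \<omega>)) * (iexp (s * X j \<omega>) * Y \<omega>) \<partial>M) = 0" for s
  proof (rule insert.IH)
    show "integrable M (\<lambda>\<omega>. iexp (s * X j \<omega>) * Y \<omega>)"
      by (rule Bochner_Integration.integrable_bound[OF insert.prems(2)]) (auto simp: norm_mult)
    fix c
    have "(\<Sum>i\<in>insert j I. (c(j := s)) i * X i \<omega>) = s * X j \<omega> + (\<Sum>i\<in>I. c i * X i \<omega>)" for \<omega>
      using insert.hyps by (simp add: sum.insert) (rule sum.cong, auto)
    then have "iexp (\<Sum>i\<in>insert j I. (c(j := s)) i * X i \<omega>) * Y \<omega> = iexp (\<Sum>i\<in>I. c i * X i \<omega>) * (iexp (s * X j \<omega>) * Y \<omega>)" for \<omega>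
      by (simp add: distrib_left exp_add mult_ac)
    then show "(\<integral>\<omega>. iexp (\<Sum>i\<in>I. c i * X i \<omega>) * (iexp (s * X j \<omega>) * Y \<omega>) \<partial>M) = 0"
      using insert.prems(3)[of "c(j := s)"] by (simp only:)
  qed (use insert.prems in auto)
  have "(\<integral>\<omega>. indicator (A j) (X j \<omega>) * ((\<Prod>i\<in>I. indicator (A i) (X i \<omega>)) * Y \<omega>) \<partial>M) = 0"
  proof (rule integral_weighted_indicator_eq_0)
    have "norm (\<Prod>i\<in>I. indicator (A i) (X i \<omega>) :: complex) \<le> 1" for \<omega>
      by (simp add: prod_norm[symmetric] prod_le_1 indicator_def)
    then show "integrable M (\<lambda>\<omega>. (\<Prod>i\<in>I. indicator (A i) (X i \<omega>)) * Y \<omega>)"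
      by (intro Bochner_Integration.integrable_bound[OF insert.prems(2)]) (auto simp: norm_mult mult_left_le_one_le)
    show "(\<integral>\<omega>. iexp (s * X j \<omega>) * ((\<Prod>i\<in>I. indicator (A i) (X i \<omega>)) * Y \<omega>) \<partial>M) = 0" for s
      using z[of s] by (simp add: mult_ac)
  qed (use insert.prems in auto)
  then show ?case using insert.hyps by (simp add: mult_ac)
qed


section \<open>Isonormal Gaussian families\<close>

text \<open>Gaussianity is encoded by the characteristic function of every \<open>W h\<close> at the
  single point 1. As \<open>W\<close> is linear almost everywhere, this determines the joint
  characteristic function of every finite family and includes the degenerate case
  \<open>h = 0\<close>.\<close>

locale isonormal_gaussian = prob_space M for M :: "'a measure" +
  fixes W :: "'h::{real_inner, banach, second_countable_topology} \<Rightarrow> 'a \<Rightarrow> real"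
  assumes W_L2: "W h \<in> L2 M"
    and W_lin: "AE \<omega> in M. W (a *\<^sub>R h + b *\<^sub>R k) \<omega> = a * W h \<omega> + b * W k \<omega>"
    and W_inner: "(\<integral>\<omega>. W h \<omega> * W k \<omega> \<partial>M) = inner h k"
    and W_char: "(\<integral>\<omega>. iexp (W h \<omega>) \<partial>M) = complex_of_real (exp (- (norm h)\<^sup>2 / 2))"
begin

lemma W_meas[measurable]: "W h \<in> borel_measurable M"
  using W_L2[of h] by (simp add: L2_def)

lemma W_zero: "AE \<omega> in M. W 0 \<omega> = 0"
  using W_lin[of 0 0 0 0] by eventually_elim simp

lemma W_scale: "AE \<omega> in M. W (c *\<^sub>R h) \<omega> = c * W h \<omega>"
  using W_lin[of c h 0 0] by eventually_elim simp

lemma W_add: "AE \<omega> in M. W (h + k) \<omega> = W h \<omega> + W k \<omega>"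
  using W_lin[of 1 h 1 k] by eventually_elim simp

lemma W_sum:
  assumes "finite I"
  shows "AE \<omega> in M. W (\<Sum>i\<in>I. c i *\<^sub>R h i) \<omega> = (\<Sum>i\<in>I. c i * W (h i) \<omega>)"
  using assms
proof (induction I rule: finite_induct)
  case empty
  then show ?case using W_zero by simp
next
  case (insert j I)
  show ?case
    using insert.IH W_lin[of "c j" "h j" 1 "\<Sum>i\<in>I. c i *\<^sub>R h i"]
    by eventually_elim (use insert.hyps in simp)
qed

lemma integral_iexp_scale_W: "(\<integral>\<omega>. iexp (s * W h \<omega>) \<partial>M) = complex_of_real (exp (- (s\<^sup>2 * (norm h)\<^sup>2) / 2))"
proof -
  have "(\<integral>\<omega>. iexp (s * W h \<omega>) \<partial>M) = (\<integral>\<omega>. iexp (W (s *\<^sub>R h) \<omega>) \<partial>M)"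
    by (rule integral_cong_AE) (use W_scale[of s h] in \<open>auto elim!: eventually_mono\<close>)
  then show ?thesis by (simp add: W_char power_mult_distrib)
qed

lemma distr_W_unit:
  assumes "norm u = 1"
  shows "distr M borel (W u) = std_normal_distribution"
proof (rule Levy_uniqueness)
  show "real_distribution (distr M borel (W u))" by (rule real_distribution_distr) simp
  show "real_distribution std_normal_distribution" by (rule real_dist_normal_dist)
  show "char (distr M borel (W u)) = char std_normal_distribution"
    using assms integral_iexp_scale_W[of _ u]
    unfolding char_std_normal_distribution by (auto simp: char_def integral_distr fun_eq_iff)
qed

text \<open>After normalisation the law is standard normal and has no atom at 0. This justifies the
  division by \<open>W g\<close> in the final formula.\<close>

lemma W_neq_0_AE:
  assumes "h \<noteq> 0"
  shows "AE \<omega> in M. W h \<omega> \<noteq> 0"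
proof -
  let ?u = "(1 / norm h) *\<^sub>R h"
  have u: "norm ?u = 1" using assms by simp
  have "AE x in std_normal_distribution. x \<noteq> (0::real)"
    by (simp add: AE_density) (use AE_lborel_singleton[of "0::real"] in \<open>auto elim: eventually_mono\<close>)
  then have "AE \<omega> in M. W ?u \<omega> \<noteq> 0"
    unfolding distr_W_unit[OF u, symmetric] by (subst (asm) AE_distr_iff) auto
  then show ?thesis using W_scale[of "1 / norm h" h] by eventually_elim auto
qed

text \<open>Orthogonal Gaussian directions are independent: by Pythagoras the joint characteristic
  function factors. Fourier uniqueness turns this into a product formula for finitely many Borel
  conditions, and finite-dimensional cylinders determine the law of the whole sequence.\<close>

lemma distr_W_orthogonal:
  fixes k :: "nat \<Rightarrow> 'h"
  assumes u: "norm u = 1" and orth: "\<And>i. inner (k i) u = 0"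
  shows "distr M (borel \<Otimes>\<^sub>M Pi\<^sub>M UNIV (\<lambda>_. borel)) (\<lambda>\<omega>. (W u \<omega>, \<lambda>i. W (k i) \<omega>))
    = std_normal_distribution \<Otimes>\<^sub>M distr M (Pi\<^sub>M UNIV (\<lambda>_. borel)) (\<lambda>\<omega> i. W (k i) \<omega>)"
proof -
  let ?S = "Pi\<^sub>M UNIV (\<lambda>_::nat. borel :: real measure)"
  define V where "V = (\<lambda>\<omega> i. W (k i) \<omega>)"
  have V[measurable]: "V \<in> measurable M ?S"
    unfolding V_def by (rule measurable_PiM_single') auto
  define e where "e = (\<lambda>s. complex_of_real (exp (- s\<^sup>2 / 2)))"
  have eu: "(\<integral>\<omega>. iexp (s * W u \<omega>) \<partial>M) = e s" for s
    using integral_iexp_scale_W[of s u] u by (simp add: e_def)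
  have int_iexp: "integrable M (\<lambda>\<omega>. iexp (f \<omega>))" if "f \<in> borel_measurable M" for f
    by (rule integrable_const_bound[of _ 1]) (use that in auto)
  \<comment> \<open>The weight is the centred character of \<open>W u\<close>. Its integral against
    any character of the family \<open>k\<close> vanishes because the squared norms of
    \<open>w\<close> and \<open>s *\<^sub>R u\<close> add.\<close>
  have step1: "(\<integral>\<omega>. (\<Prod>i\<in>I. indicator (A i) (W (k i) \<omega>)) * (iexp (s * W u \<omega>) - e s) \<partial>M) = 0"
    if I: "finite I" and A: "\<And>i. i \<in> I \<Longrightarrow> A i \<in> sets borel" for I s and A :: "nat \<Rightarrow> real set"
  proof (rule integral_weighted_indicators_eq_0[OF I])
    show "integrable M (\<lambda>\<omega>. iexp (s * W u \<omega>) - e s)" by (intro Bochner_Integration.integrable_diff int_iexp) auto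
    fix c :: "nat \<Rightarrow> real"
    define w where "w = (\<Sum>i\<in>I. c i *\<^sub>R k i)"
    have wu: "inner w u = 0" by (simp add: w_def inner_sum_left orth)
    have nsq: "(norm (w + s *\<^sub>R u))\<^sup>2 = (norm w)\<^sup>2 + s\<^sup>2"
      using u wu by (subst norm_add_Pythagorean) (auto simp: orthogonal_def power_mult_distrib)
    have 1: "AE \<omega> in M. iexp (\<Sum>i\<in>I. c i * W (k i) \<omega>) * (iexp (s * W u \<omega>) - e s) = iexp (W (w + s *\<^sub>R u) \<omega>) - e s * iexp (W w \<omega>)"
      using W_sum[OF I, of c k] W_add[of w "s *\<^sub>R u"] W_scale[of s u]
      by eventually_elim (simp add: w_def[symmetric] algebra_simps exp_add)
    have "(\<integral>\<omega>. iexp (\<Sum>i\<in>I. c i * W (k i) \<omega>) * (iexp (s * W u \<omega>) - e s) \<partial>M) =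
      (\<integral>\<omega>. iexp (W (w + s *\<^sub>R u) \<omega>) - e s * iexp (W w \<omega>) \<partial>M)"
      by (rule integral_cong_AE[OF _ _ 1]) auto
    also have "\<dots> = (\<integral>\<omega>. iexp (W (w + s *\<^sub>R u) \<omega>) \<partial>M) - (\<integral>\<omega>. e s * iexp (W w \<omega>) \<partial>M)"
      by (rule Bochner_Integration.integral_diff) (auto intro!: int_iexp)
    also have "\<dots> = 0"
    proof -
      have "exp (- ((norm w)\<^sup>2 + s\<^sup>2) / 2) = exp (- s\<^sup>2 / 2) * exp (- (norm w)\<^sup>2 / 2)"
        by (subst exp_add[symmetric]) (simp add: field_simps)
      then show ?thesis by (simp add: W_char nsq e_def)
    qed
    finally show "(\<integral>\<omega>. iexp (\<Sum>i\<in>I. c i * W (k i) \<omega>) * (iexp (s * W u \<omega>) - e s) \<partial>M) = 0" .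
  qed (use A in auto)
  have step2: "prob {\<omega>\<in>space M. W u \<omega> \<in> B \<and> (\<forall>i\<in>I. W (k i) \<omega> \<in> A i)}
      = prob {\<omega>\<in>space M. W u \<omega> \<in> B} * prob {\<omega>\<in>space M. \<forall>i\<in>I. W (k i) \<omega> \<in> A i}"
    if I[measurable]: "finite I" and A[measurable]: "\<And>i. i \<in> I \<Longrightarrow> A i \<in> sets borel" and B[measurable]: "B \<in> sets borel"
    for I B and A :: "nat \<Rightarrow> real set"
  proof -
    define R where "R = (\<lambda>\<omega>. \<Prod>i\<in>I. indicat_real (A i) (W (k i) \<omega>))"
    have R_eq: "R \<omega> = indicat_real {\<omega>. \<forall>i\<in>I. W (k i) \<omega> \<in> A i} \<omega>" for \<omega>
      unfolding R_def using I by (induction I rule: finite_induct) (auto simp: indicator_def)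
    have Rm[measurable]: "R \<in> borel_measurable M"
      unfolding R_def by measurable
    have R01: "0 \<le> R \<omega>" "R \<omega> \<le> 1" for \<omega> by (auto simp: R_eq indicator_def)
    have Ri: "integrable M R" by (rule integrable_const_bound[of _ 1]) (use R01 in auto)
    define r where "r = (\<integral>\<omega>. R \<omega> \<partial>M)"
    have Rc: "complex_of_real (R \<omega>) = (\<Prod>i\<in>I. indicator (A i) (W (k i) \<omega>))" for \<omega>
      unfolding R_def of_real_prod by (rule prod.cong) (auto simp: indicator_def)
    have ind: "(\<integral>\<omega>. f \<omega> \<partial>M) = prob S" if "S \<in> events" "\<And>\<omega>. \<omega> \<in> space M \<Longrightarrow> f \<omega> = indicat_real S \<omega>" for f S
    proof -
      have "(\<integral>\<omega>. f \<omega> \<partial>M) = (\<integral>\<omega>. indicat_real S \<omega> \<partial>M)"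
        using that(2) by (rule Bochner_Integration.integral_cong[OF refl])
      then show ?thesis using that(1) by simp
    qed
    \<comment> \<open>Now the roles are exchanged: the centred indicator \<open>R - r\<close> of the
      conditions on the family is the weight, and the characters of \<open>W u\<close> are tested
      against it.\<close>
    have "(\<integral>\<omega>. indicat_real B (W u \<omega>) * (R \<omega> - r) \<partial>M) = 0"
    proof (rule integral_weighted_indicator_eq_0_real)
      show "integrable M (\<lambda>\<omega>. R \<omega> - r)" using Ri by simp
      fix s
      have i1: "integrable M (\<lambda>\<omega>. iexp (s * W u \<omega>) * R \<omega>)"
        by (rule integrable_const_bound[of _ 1]) (use R01 in \<open>auto simp: norm_mult\<close>)
      have i2: "integrable M (\<lambda>\<omega>. complex_of_real (R \<omega>))" using Ri by simp
      have "(\<integral>\<omega>. (\<Prod>i\<in>I. indicator (A i) (W (k i) \<omega>)) * (iexp (s * W u \<omega>) - e s) \<partial>M) = 0"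
        by (rule step1[OF I]) (rule A)
      then have "0 = (\<integral>\<omega>. iexp (s * W u \<omega>) * R \<omega> - e s * R \<omega> \<partial>M)"
        by (simp add: Rc right_diff_distrib mult.commute)
      also have "\<dots> = (\<integral>\<omega>. iexp (s * W u \<omega>) * R \<omega> \<partial>M) - e s * r"
        by (subst Bochner_Integration.integral_diff) (use i1 i2 in \<open>auto simp: r_def\<close>)
      finally have 1: "(\<integral>\<omega>. iexp (s * W u \<omega>) * R \<omega> \<partial>M) = e s * r" by simp
      have "(\<integral>\<omega>. iexp (s * W u \<omega>) * complex_of_real (R \<omega> - r) \<partial>M) =
         (\<integral>\<omega>. iexp (s * W u \<omega>) * R \<omega> - iexp (s * W u \<omega>) * r \<partial>M)"
        by (simp add: right_diff_distrib)
      also have "\<dots> = e s * r - e s * r"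
        by (subst Bochner_Integration.integral_diff[OF i1])
           (auto intro!: int_iexp simp del: of_real_mult simp: 1[simplified] eu[simplified] eu 1)
      finally show "(\<integral>\<omega>. iexp (s * W u \<omega>) * complex_of_real (R \<omega> - r) \<partial>M) = 0" by simp
    qed auto
    moreover have i3: "integrable M (\<lambda>\<omega>. indicat_real B (W u \<omega>) * R \<omega>)"
      by (rule integrable_const_bound[of _ 1]) (use R01 in \<open>auto simp: indicator_def\<close>)
    moreover have i4: "integrable M (\<lambda>\<omega>. indicat_real B (W u \<omega>))"
      by (rule integrable_const_bound[of _ 1]) (auto simp: indicator_def)
    ultimately have "(\<integral>\<omega>. indicat_real B (W u \<omega>) * R \<omega> \<partial>M) = (\<integral>\<omega>. indicat_real B (W u \<omega>) \<partial>M) * r"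
      by (simp add: right_diff_distrib)
    moreover have "(\<integral>\<omega>. indicat_real B (W u \<omega>) * R \<omega> \<partial>M) = prob {\<omega>\<in>space M. W u \<omega> \<in> B \<and> (\<forall>i\<in>I. W (k i) \<omega> \<in> A i)}"
      by (rule ind) (auto simp: R_eq indicator_def)
    moreover have "(\<integral>\<omega>. indicat_real B (W u \<omega>) \<partial>M) = prob {\<omega>\<in>space M. W u \<omega> \<in> B}"
      by (rule ind) (auto simp: R_eq indicator_def)
    moreover have "r = prob {\<omega>\<in>space M. \<forall>i\<in>I. W (k i) \<omega> \<in> A i}"
      unfolding r_def
      by (rule ind) (auto simp: R_eq indicator_def)
    ultimately show ?thesis by simp
  qed
  have step3: "emeasure M (W u -` B \<inter> space M \<inter> (V -` C \<inter> space M)) = emeasure M (W u -` B \<inter> space M) * emeasure M (V -` C \<inter> space M)"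
    if B[measurable]: "B \<in> sets borel" and C: "C \<in> sets ?S" for B C
  proof -
    let ?B = "W u -` B \<inter> space M"
    have B'[measurable]: "?B \<in> sets M" by measurable
    \<comment> \<open>For fixed \<open>B\<close> both sides are finite measures in \<open>C\<close>:
      the law of the sequence restricted to the event that \<open>W u\<close> lies in
      \<open>B\<close>, and the full law scaled by the probability of that event. They agree on
      cylinders by \<open>step2\<close>.\<close>
    define P1 where "P1 = distr (density M (indicator ?B)) ?S V"
    define P2 where "P2 = scale_measure (emeasure M ?B) (distr M ?S V)"
    have P1: "emeasure P1 X = emeasure M (?B \<inter> (V -` X \<inter> space M))" if "X \<in> sets ?S" for X
      unfolding P1_def using that by (subst emeasure_distr) (auto simp: emeasure_restricted measurable_sets)
    have P2: "emeasure P2 X = emeasure M ?B * emeasure M (V -` X \<inter> space M)" if "X \<in> sets ?S" for X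
      unfolding P2_def using that by (simp add: emeasure_distr)
    have "P1 = P2"
    proof (rule measure_eqI_PiM_infinite)
      show "finite_measure P1"
        by (rule finite_measureI) (simp add: P1_def emeasure_distr emeasure_restricted)
      fix A :: "nat \<Rightarrow> real set" and J :: "nat set" assume J: "finite J" "J \<subseteq> UNIV" and A[measurable]: "\<And>i. i \<in> J \<Longrightarrow> A i \<in> sets (borel :: real measure)"
      let ?E = "prod_emb UNIV (\<lambda>_::nat. borel :: real measure) J (Pi\<^sub>E J A)"
      have E: "?E \<in> sets ?S" using J A by (intro sets_PiM_I) auto
      have E_eq: "V -` ?E \<inter> space M = {\<omega>\<in>space M. \<forall>i\<in>J. W (k i) \<omega> \<in> A i}"
        by (auto simp: prod_emb_def V_def PiE_iff)
      have "?B \<inter> (V -` ?E \<inter> space M) = {\<omega>\<in>space M. W u \<omega> \<in> B \<and> (\<forall>i\<in>J. W (k i) \<omega> \<in> A i)}"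
        unfolding E_eq by auto
      moreover have "?B = {\<omega>\<in>space M. W u \<omega> \<in> B}" by auto
      ultimately show "emeasure P1 ?E = emeasure P2 ?E"
        using step2[OF J(1) A B] by (simp add: P1[OF E] P2[OF E] E_eq emeasure_eq_measure ennreal_mult)
    qed (auto simp: P1_def P2_def)
    then show ?thesis using P1[OF C] P2[OF C] by simp
  qed
  interpret N: prob_space std_normal_distribution by (rule prob_space_normal_density) simp
  interpret D: prob_space "distr M ?S V" by (rule prob_space_distr) simp
  have "std_normal_distribution \<Otimes>\<^sub>M distr M ?S V = distr M (borel \<Otimes>\<^sub>M ?S) (\<lambda>\<omega>. (W u \<omega>, V \<omega>))"
  proof (rule pair_measure_eqI)
    fix A B assume A: "A \<in> sets std_normal_distribution" and B: "B \<in> sets (distr M ?S V)"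
    then have [measurable]: "A \<in> sets borel" "B \<in> sets ?S" by auto
    have "(\<lambda>\<omega>. (W u \<omega>, V \<omega>)) -` (A \<times> B) \<inter> space M = W u -` A \<inter> space M \<inter> (V -` B \<inter> space M)" by auto
    then show "emeasure std_normal_distribution A * emeasure (distr M ?S V) B
       = emeasure (distr M (borel \<Otimes>\<^sub>M ?S) (\<lambda>\<omega>. (W u \<omega>, V \<omega>))) (A \<times> B)"
      using step3[of A B] by (simp add: emeasure_distr distr_W_unit[OF u, symmetric])
  qed (auto simp: N.sigma_finite_measure_axioms D.sigma_finite_measure_axioms cong: sets_pair_measure_cong)
  then show ?thesis by (simp add: V_def)
qed

end


section \<open>Gaussian integration by parts\<close>

lemma smooth_poly_growthD:
  assumes "smooth_poly_growth n f"
  shows smooth_poly_growth_cong: "(\<And>i. i < n \<Longrightarrow> x i = y i) \<Longrightarrow> f x = f y"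
    and smooth_poly_growth_continuous: "continuous_on UNIV f"
    and smooth_poly_growth_continuous_partial: "i < n \<Longrightarrow> continuous_on UNIV (partial_deriv i f)"
    and smooth_poly_growth_has_partial:
      "i < n \<Longrightarrow> ((\<lambda>y. f (x(i := y))) has_real_derivative partial_deriv i f (x(i := z))) (at z)"
proof -
  have *: "continuous_on UNIV (foldr partial_deriv \<alpha> f) \<and>
        (\<forall>i<n. \<forall>x. (\<lambda>y. foldr partial_deriv \<alpha> f (x(i := y))) differentiable (at (x i)))"
    if "set \<alpha> \<subseteq> {..<n}" for \<alpha>
    using assms that unfolding smooth_poly_growth_def by blast
  show "(\<And>i. i < n \<Longrightarrow> x i = y i) \<Longrightarrow> f x = f y"
    using assms unfolding smooth_poly_growth_def by blast
  show "continuous_on UNIV f" using *[of "[]"] by simp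
  show "i < n \<Longrightarrow> continuous_on UNIV (partial_deriv i f)" using *[of "[i]"] by simp
  assume "i < n"
  then have "(\<lambda>y. f ((x(i := z))(i := y))) differentiable (at ((x(i := z)) i))"
    using *[of "[]", THEN conjunct2, rule_format, of i "x(i := z)"] by simp
  then show "((\<lambda>y. f (x(i := y))) has_real_derivative partial_deriv i f (x(i := z))) (at z)"
    by (simp add: DERIV_deriv_iff_real_differentiable partial_deriv_def)
qed

lemma smooth_poly_growth_partial_cong:
  assumes f: "smooth_poly_growth n f" and "\<And>j. j < n \<Longrightarrow> y j = z j" "i < n"
  shows "partial_deriv i f y = partial_deriv i f z"
proof -
  have "f (y(i := w)) = f (z(i := w))" for w
    by (rule smooth_poly_growth_cong[OF f]) (use assms in auto)
  then show ?thesis using assms by (simp add: partial_deriv_def)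
qed

text \<open>Only partial derivatives are given, on a function space without a norm. Their continuity
  allows the coordinates to be set in motion one after another, with the chain rule read off from a
  function of two real parameters.\<close>

lemma smooth_poly_growth_has_directional:
  assumes f: "smooth_poly_growth n f"
  shows "((\<lambda>s. f (\<lambda>i. x i + s * a i)) has_real_derivative
    (\<Sum>i<n. a i * partial_deriv i f (\<lambda>i. x i + s * a i))) (at s)"
proof -
  \<comment> \<open>The point in which only the coordinates below \<open>k\<close> move. For
    \<open>k = n\<close> it agrees with the full line in all coordinates that \<open>f\<close>
    depends on.\<close>
  define pt where "pt = (\<lambda>k x s i. if i < k then x i + s * a i else x i :: real)"
  have "k \<le> n \<Longrightarrow> ((\<lambda>s. f (pt k x s)) has_real_derivative
     (\<Sum>i<k. a i * partial_deriv i f (pt k x s))) (at s)" for k x s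
  proof (induction k arbitrary: x s)
    case 0
    then show ?case by (simp add: pt_def)
  next
    case (Suc k)
    define q where "q = (\<lambda>r. x(k := x k + r * a k))"
    have q_eq: "pt (Suc k) x r = pt k (q r) r" for r by (auto simp: pt_def q_def fun_eq_iff)
    \<comment> \<open>Here \<open>s\<close> moves the coordinates below \<open>k\<close> and
      \<open>r\<close> moves coordinate \<open>k\<close>. The derivative in \<open>s\<close> is the
      induction hypothesis, the one in \<open>r\<close> is jointly continuous, so the function is
      differentiable in the pair; the diagonal \<open>r = s\<close> gives the next case.\<close>
    have d: "((\<lambda>(s, r). f (pt k (q r) s)) has_derivative
        (\<lambda>(u, v). u * (\<Sum>i<k. a i * partial_deriv i f (pt k (q s) s))
           + blinfun_scaleR_left (a k * partial_deriv k f (pt k (q s) s)) v)) (at (s, s) within UNIV \<times> UNIV)"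
    proof (rule has_derivative_partialsI[where fy="\<lambda>s r. blinfun_scaleR_left (a k * partial_deriv k f (pt k (q r) s))"])
      show "((\<lambda>s'. f (pt k (q s) s')) has_derivative (\<lambda>u. u * (\<Sum>i<k. a i * partial_deriv i f (pt k (q s) s)))) (at s within UNIV)"
        using Suc.IH[of "q s" s] Suc.prems by (simp add: has_field_derivative_def mult.commute[of _ "sum _ _"])
      show "((\<lambda>r. f (pt k (q r) s')) has_derivative blinfun_apply (blinfun_scaleR_left (a k * partial_deriv k f (pt k (q r) s')))) (at r within UNIV)" for s' r
      proof -
        have e: "pt k (q r) s' = (pt k x s')(k := x k + r * a k)" for r by (auto simp: pt_def q_def fun_eq_iff)
        have "((\<lambda>r. f ((pt k x s')(k := x k + r * a k))) has_real_derivative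
            partial_deriv k f ((pt k x s')(k := x k + r * a k)) * a k) (at r)"
          by (rule DERIV_chain2[OF smooth_poly_growth_has_partial[OF f]]) (use Suc.prems in \<open>auto intro!: derivative_eq_intros\<close>)
        then show ?thesis unfolding e
          by (simp add: has_field_derivative_def mult_commute_abs mult.commute[of _ "a k"])
      qed
      have "continuous_on UNIV (\<lambda>p::real \<times> real. pt k (q (snd p)) (fst p))"
      proof (rule continuous_on_coordinatewise_then_product)
        fix i
        have "pt k (q r) s i = (if i < k then x i + s * a i else if i = k then x k + r * a k else x i)" for r s
          by (auto simp: pt_def q_def)
        then show "continuous_on UNIV (\<lambda>p::real \<times> real. pt k (q (snd p)) (fst p) i)"
          by (cases "i < k"; cases "i = k") (auto intro!: continuous_intros)
      qed
      from continuous_on_compose2[OF smooth_poly_growth_continuous_partial[OF f, of k] this]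
      have "continuous_on UNIV (\<lambda>p::real \<times> real. a k * partial_deriv k f (pt k (q (snd p)) (fst p)))"
        using Suc.prems by (auto intro!: continuous_intros)
      then have "continuous_on UNIV (\<lambda>p::real \<times> real. blinfun_scaleR_left (a k * partial_deriv k f (pt k (q (snd p)) (fst p))))"
        by (intro bounded_linear.continuous_on[OF bounded_linear_blinfun_scaleR_left])
      then show "continuous (at (s, s) within UNIV \<times> UNIV) (\<lambda>(s, r). blinfun_scaleR_left (a k * partial_deriv k f (pt k (q r) s)))"
        by (simp add: continuous_on_eq_continuous_within case_prod_beta')
    qed auto
    have "((\<lambda>s. f (pt k (q s) s)) has_derivative (\<lambda>v. v * (\<Sum>i<k. a i * partial_deriv i f (pt k (q s) s))
           + v * (a k * partial_deriv k f (pt k (q s) s)))) (at s)"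
    proof -
      have "((\<lambda>s. (s, s)) has_derivative (\<lambda>v. (v, v))) (at s)"
        by (intro has_derivative_Pair has_derivative_ident)
      from has_derivative_compose[OF this d[unfolded UNIV_Times_UNIV]] show ?thesis by simp
    qed
    then show ?case unfolding q_eq has_field_derivative_def
      by (rule has_derivative_eq_rhs) (simp add: fun_eq_iff algebra_simps)
  qed
  from this[of n x s] have *: "((\<lambda>s. f (pt n x s)) has_real_derivative
     (\<Sum>i<n. a i * partial_deriv i f (pt n x s))) (at s)" by simp
  have "f (pt n x s) = f (\<lambda>i. x i + s * a i)" for s
    by (rule smooth_poly_growth_cong[OF f]) (auto simp: pt_def)
  moreover have "(\<Sum>i<n. a i * partial_deriv i f (pt n x s)) = (\<Sum>i<n. a i * partial_deriv i f (\<lambda>i. x i + s * a i))"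
    by (intro sum.cong refl arg_cong2[where f="(*)"] smooth_poly_growth_partial_cong[OF f]) (auto simp: pt_def)
  ultimately show ?thesis using * by simp
qed

text \<open>The density \<open>n\<close> has derivative \<open>- x * n x\<close>, so the integrand
  times \<open>n\<close> is the derivative of \<open>n * \<Psi>\<close>, which tends to 0 at both
  ends because \<open>\<Psi>\<close> is bounded. Integrability of \<open>\<Psi>'\<close> is asked
  only against the Gaussian law, which is what Fubini supplies in the application.\<close>

lemma std_normal_integration_by_parts:
  fixes \<Psi> \<Psi>' :: "real \<Rightarrow> real"
  assumes d: "\<And>x. (\<Psi> has_real_derivative \<Psi>' x) (at x)" and c: "continuous_on UNIV \<Psi>'"
    and b: "\<And>x. \<bar>\<Psi> x\<bar> \<le> C" and i: "integrable std_normal_distribution \<Psi>'"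
  shows "integrable std_normal_distribution (\<lambda>x. x * \<Psi> x)"
    and "(\<integral>x. \<Psi>' x - x * \<Psi> x \<partial>std_normal_distribution) = 0"
proof -
  let ?n = std_normal_density
  have cont: "continuous_on UNIV \<Psi>"
    using d by (meson DERIV_isCont continuous_at_imp_continuous_on)
  have [measurable]: "\<Psi> \<in> borel_measurable borel" "\<Psi>' \<in> borel_measurable borel"
    using cont c by (auto intro: borel_measurable_continuous_onI)
  have i1: "integrable lborel (\<lambda>x. ?n x * \<Psi>' x)"
    using i by (simp add: integrable_density)
  have "integrable lborel (\<lambda>x. (?n x * x) * \<Psi> x)"
  proof (rule Bochner_Integration.integrable_bound)
    show "integrable lborel (\<lambda>x. (?n x * x ^ 1) * C)"
      by (intro integrable_mult_left integrable_std_normal_moment)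
    show "AE x in lborel. norm (?n x * x * \<Psi> x) \<le> norm ((?n x * x ^ 1) * C)"
    proof (rule AE_I2)
      fix x show "norm (?n x * x * \<Psi> x) \<le> norm ((?n x * x ^ 1) * C)"
        using b[of x] by (simp add: abs_mult) (intro mult_left_mono, auto)
    qed
  qed simp
  then have i2: "integrable lborel (\<lambda>x. ?n x * (x * \<Psi> x))" by (simp add: mult.assoc)
  then show "integrable std_normal_distribution (\<lambda>x. x * \<Psi> x)" by (simp add: integrable_density)
  have dn: "(?n has_real_derivative (- x * ?n x)) (at x)" for x
  proof -
    have "((\<lambda>x. c * exp (- x\<^sup>2 / 2)) has_real_derivative - x * (c * exp (- x\<^sup>2 / 2))) (at x)" for c :: real
      by (auto intro!: derivative_eq_intros)
    then show ?thesis unfolding std_normal_density_def .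
  qed
  have lim: "((\<lambda>x. ?n x) \<longlongrightarrow> 0) at_top" "((\<lambda>x. ?n x) \<longlongrightarrow> 0) at_bot"
  proof -
    have 1: "filterlim (\<lambda>x::real. x\<^sup>2 / 2) at_top at_top"
      by (intro filterlim_tendsto_pos_mult_at_top[OF tendsto_const, of "1/2", simplified] filterlim_pow_at_top filterlim_ident) auto
    have 2: "((\<lambda>x. ?n x) \<longlongrightarrow> 1 / sqrt (2 * pi) * 0) at_top"
      unfolding std_normal_density_def
      by (intro tendsto_mult tendsto_const filterlim_compose[OF exp_at_bot])
         (use 1 in \<open>simp add: filterlim_uminus_at_top\<close>)
    then show "((\<lambda>x. ?n x) \<longlongrightarrow> 0) at_top" by simp
    have "((\<lambda>x. ?n (- x)) \<longlongrightarrow> 0) at_bot"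
      using filterlim_compose[OF 2 filterlim_uminus_at_top_at_bot] by simp
    then show "((\<lambda>x. ?n x) \<longlongrightarrow> 0) at_bot" by (simp add: std_normal_density_def)
  qed
  have lim': "((\<lambda>x. ?n x * \<Psi> x) \<longlongrightarrow> 0) at_top" "((\<lambda>x. ?n x * \<Psi> x) \<longlongrightarrow> 0) at_bot"
    by (rule Lim_null_comparison[where g="\<lambda>x. ?n x * C"];
        use b in \<open>auto intro!: always_eventually mult_left_mono tendsto_mult_left_zero lim simp: abs_mult\<close>)+
  have "(LBINT x=-\<infinity>..\<infinity>. ?n x * (\<Psi>' x - x * \<Psi> x)) = 0 - 0"
  proof (rule interval_integral_FTC_integrable[where F="\<lambda>x. ?n x * \<Psi> x"])
    show "((\<lambda>x. ?n x * \<Psi> x) has_vector_derivative ?n x * (\<Psi>' x - x * \<Psi> x)) (at x)" for x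
      unfolding has_real_derivative_iff_has_vector_derivative[symmetric]
      by (auto intro!: derivative_eq_intros d dn simp: algebra_simps)
    have "continuous_on UNIV (\<lambda>x. ?n x * (\<Psi>' x - x * \<Psi> x))"
      unfolding std_normal_density_def by (intro continuous_intros c cont) auto
    then show "isCont (\<lambda>x. ?n x * (\<Psi>' x - x * \<Psi> x)) x" for x
      by (simp add: continuous_on_eq_continuous_at)
    show "set_integrable lborel (einterval (-\<infinity>) \<infinity>) (\<lambda>x. ?n x * (\<Psi>' x - x * \<Psi> x))"
      using i1 i2 by (simp add: set_integrable_def einterval_def right_diff_distrib)
  qed (simp_all add: ereal_tendsto_simps1 lim')
  then show "(\<integral>x. \<Psi>' x - x * \<Psi> x \<partial>std_normal_distribution) = 0"
    by (simp add: integral_density interval_integral_to_infinity_eq interval_lebesgue_integral_def set_lebesgue_integral_def einterval_def)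
qed

context isonormal_gaussian begin

text \<open>
  The variables \<open>W (k i)\<close> split into their components along \<open>u\<close> and the orthogonal remainder, which
  is independent of \<open>W u\<close>; conditionally on the remainder, the claim is one-dimensional.
\<close>

lemma integration_by_parts_unit:
  fixes k :: "nat \<Rightarrow> 'h" and \<Phi> \<Phi>' :: "(nat \<Rightarrow> real) \<Rightarrow> real"
  assumes u: "norm u = 1"
    and \<Phi>[measurable]: "\<Phi> \<in> borel_measurable (Pi\<^sub>M UNIV (\<lambda>_. borel))"
    and \<Phi>'[measurable]: "\<Phi>' \<in> borel_measurable (Pi\<^sub>M UNIV (\<lambda>_. borel))"
    and b: "\<And>x. \<bar>\<Phi> x\<bar> \<le> C"
    and d: "\<And>x s. ((\<lambda>s. \<Phi> (\<lambda>i. x i + s * inner (k i) u)) has_real_derivative \<Phi>' (\<lambda>i. x i + s * inner (k i) u)) (at s)"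
    and c: "\<And>x. continuous_on UNIV (\<lambda>s. \<Phi>' (\<lambda>i. x i + s * inner (k i) u))"
    and int: "integrable M (\<lambda>\<omega>. \<Phi>' (\<lambda>i. W (k i) \<omega>))"
  shows "(\<integral>\<omega>. \<Phi> (\<lambda>i. W (k i) \<omega>) * W u \<omega> \<partial>M) = (\<integral>\<omega>. \<Phi>' (\<lambda>i. W (k i) \<omega>) \<partial>M)"
proof -
  let ?S = "Pi\<^sub>M UNIV (\<lambda>_::nat. borel :: real measure)"
  let ?N = "std_normal_distribution"
  define k' where "k' = (\<lambda>i. k i - inner (k i) u *\<^sub>R u)"
  have orth: "inner (k' i) u = 0" for i
    using u by (simp add: k'_def inner_diff_left dot_square_norm)
  have "AE \<omega> in M. \<forall>i. W (k i) \<omega> = W (k' i) \<omega> + W u \<omega> * inner (k i) u"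
    unfolding AE_all_countable
  proof
    fix i
    show "AE \<omega> in M. W (k i) \<omega> = W (k' i) \<omega> + W u \<omega> * inner (k i) u"
      using W_lin[of 1 "k' i" "inner (k i) u" u] by eventually_elim (simp add: k'_def)
  qed
  then have ae: "AE \<omega> in M. (\<lambda>i. W (k i) \<omega>) = (\<lambda>i. W (k' i) \<omega> + W u \<omega> * inner (k i) u)"
    by eventually_elim auto
  have [measurable]: "(\<lambda>\<omega> i. W (l i) \<omega>) \<in> measurable M ?S" for l
    by (rule measurable_PiM_single') auto
  let ?D = "distr M ?S (\<lambda>\<omega> i. W (k' i) \<omega>)"
  interpret N: prob_space ?N by (rule prob_space_normal_density) simp
  interpret D: prob_space ?D by (rule prob_space_distr) simp
  interpret ND: pair_sigma_finite ?N ?D ..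
  \<comment> \<open>\<open>p\<close> rebuilds the family from its component \<open>x\<close> along
    \<open>u\<close> and the remainder \<open>v\<close>; for fixed \<open>v\<close> it runs through
    a line on which \<open>\<Phi>'\<close> is the derivative of \<open>\<Phi>\<close>.\<close>
  define p where "p = (\<lambda>(x::real, v) i. v i + x * inner (k i) u)"
  have p[measurable]: "p \<in> measurable (borel \<Otimes>\<^sub>M ?S) ?S"
    unfolding p_def case_prod_beta' by (rule measurable_PiM_single') auto
  note law = distr_W_orthogonal[OF u orth, symmetric]
  define G where "G = (\<lambda>z. \<Phi>' (p z) - fst z * \<Phi> (p z))"
  have Gm[measurable]: "G \<in> borel_measurable (borel \<Otimes>\<^sub>M ?S)" unfolding G_def by measurable
  have ae': "AE \<omega> in M. \<Phi>' (\<lambda>i. W (k i) \<omega>) = \<Phi>' (p (W u \<omega>, \<lambda>i. W (k' i) \<omega>))"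
    "AE \<omega> in M. \<Phi> (\<lambda>i. W (k i) \<omega>) = \<Phi> (p (W u \<omega>, \<lambda>i. W (k' i) \<omega>))"
    using ae by (auto simp: p_def elim!: eventually_mono)
  have i1: "integrable M (\<lambda>\<omega>. \<Phi>' (p (W u \<omega>, \<lambda>i. W (k' i) \<omega>)))"
    using int by (rule Bochner_Integration.integrable_cong_AE_imp) (use ae' in \<open>auto\<close>)
  have Wi: "integrable M (W u)"
    using W_L2[of u] by (auto simp: L2_def intro: square_integrable_imp_integrable)
  have "\<bar>\<Phi> x\<bar> \<le> \<bar>C\<bar>" for x using b[of x] by simp
  then have i2: "integrable M (\<lambda>\<omega>. W u \<omega> * \<Phi> (\<lambda>i. W (k i) \<omega>))"
    by (intro Bochner_Integration.integrable_bound[OF integrable_mult_right[OF Wi, of C]])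
       (auto simp: abs_mult mult.commute[of "\<bar>C\<bar>"] intro!: mult_left_mono)
  have i2': "integrable M (\<lambda>\<omega>. W u \<omega> * \<Phi> (p (W u \<omega>, \<lambda>i. W (k' i) \<omega>)))"
    using i2
  proof (rule Bochner_Integration.integrable_cong_AE_imp)
    show "AE \<omega> in M. W u \<omega> * \<Phi> (\<lambda>i. W (k i) \<omega>) = W u \<omega> * \<Phi> (p (W u \<omega>, \<lambda>i. W (k' i) \<omega>))"
      using ae'(2) by eventually_elim simp
  qed measurable
  have iG: "integrable (?N \<Otimes>\<^sub>M ?D) G"
    unfolding law by (subst integrable_distr_eq) (use i1 i2' in \<open>auto simp: G_def\<close>)
  have i\<Phi>': "integrable (?N \<Otimes>\<^sub>M ?D) (\<lambda>(x, v). \<Phi>' (p (x, v)))"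
    unfolding law by (subst integrable_distr_eq) (use i1 in \<open>auto\<close>)
  have "(\<integral>\<omega>. \<Phi>' (\<lambda>i. W (k i) \<omega>) \<partial>M) - (\<integral>\<omega>. W u \<omega> * \<Phi> (\<lambda>i. W (k i) \<omega>) \<partial>M)
     = (\<integral>\<omega>. \<Phi>' (\<lambda>i. W (k i) \<omega>) - W u \<omega> * \<Phi> (\<lambda>i. W (k i) \<omega>) \<partial>M)"
    using int i2 by simp
  also have "\<dots> = (\<integral>\<omega>. G (W u \<omega>, \<lambda>i. W (k' i) \<omega>) \<partial>M)"
  proof (rule integral_cong_AE)
    show "AE \<omega> in M. \<Phi>' (\<lambda>i. W (k i) \<omega>) - W u \<omega> * \<Phi> (\<lambda>i. W (k i) \<omega>) = G (W u \<omega>, \<lambda>i. W (k' i) \<omega>)"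
      using ae' by eventually_elim (simp add: G_def)
  qed auto
  also have "\<dots> = (\<integral>z. G z \<partial>(?N \<Otimes>\<^sub>M ?D))"
    unfolding law by (subst integral_distr) auto
  also have "\<dots> = (\<integral>v. (\<integral>x. G (x, v) \<partial>?N) \<partial>?D)"
    using ND.integral_snd[of "\<lambda>x v. G (x, v)"] iG by simp
  also have "\<dots> = (\<integral>v. 0 \<partial>?D)"
  proof (rule integral_cong_AE)
    \<comment> \<open>Integrability of the derivative along the line through \<open>v\<close> is the
      one input of the one-dimensional formula that is available only for almost every
      \<open>v\<close>.\<close>
    show "AE v in ?D. (\<integral>x. G (x, v) \<partial>?N) = 0"
      using ND.AE_integrable_snd[OF i\<Phi>']
    proof eventually_elim
      case (elim v)
      show ?case
        unfolding G_def fst_conv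
        by (rule std_normal_integration_by_parts(2)[where C=C]) (use elim b d c in \<open>auto simp: p_def\<close>)
    qed
  qed auto
  finally show ?thesis by (simp add: mult.commute)
qed

text \<open>Both sides scale linearly with \<open>h\<close>, which reduces the claim to a unit
  direction. For \<open>h = 0\<close> both vanish, \<open>\<Phi>'\<close> being the derivative of a
  constant.\<close>

lemma integration_by_parts:
  fixes k :: "nat \<Rightarrow> 'h" and \<Phi> \<Phi>' :: "(nat \<Rightarrow> real) \<Rightarrow> real"
  assumes \<Phi>[measurable]: "\<Phi> \<in> borel_measurable (Pi\<^sub>M UNIV (\<lambda>_. borel))"
    and \<Phi>'[measurable]: "\<Phi>' \<in> borel_measurable (Pi\<^sub>M UNIV (\<lambda>_. borel))"
    and b: "\<And>x. \<bar>\<Phi> x\<bar> \<le> C"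
    and d: "\<And>x s. ((\<lambda>s. \<Phi> (\<lambda>i. x i + s * inner (k i) h)) has_real_derivative \<Phi>' (\<lambda>i. x i + s * inner (k i) h)) (at s)"
    and c: "\<And>x. continuous_on UNIV (\<lambda>s. \<Phi>' (\<lambda>i. x i + s * inner (k i) h))"
    and int: "integrable M (\<lambda>\<omega>. \<Phi>' (\<lambda>i. W (k i) \<omega>))"
  shows "(\<integral>\<omega>. \<Phi> (\<lambda>i. W (k i) \<omega>) * W h \<omega> \<partial>M) = (\<integral>\<omega>. \<Phi>' (\<lambda>i. W (k i) \<omega>) \<partial>M)"
proof (cases "h = 0")
  case True
  have "\<Phi>' x = 0" for x
    using DERIV_unique[OF d[of x 0, unfolded True, simplified] DERIV_const] by (simp add: True)
  moreover have "(\<integral>\<omega>. \<Phi> (\<lambda>i. W (k i) \<omega>) * W h \<omega> \<partial>M) = 0"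
    by (rule integral_eq_zero_AE) (use W_zero in \<open>auto simp: True\<close>)
  ultimately show ?thesis by simp
next
  case False
  define r u where "r = norm h" and "u = (1 / r) *\<^sub>R h"
  have r: "r > 0" using False by (simp add: r_def)
  have u: "norm u = 1" using False by (simp add: u_def r_def)
  have h: "h = r *\<^sub>R u" using r by (simp add: u_def)
  have ku: "inner (k i) u = inner (k i) h / r" for i by (simp add: u_def)
  have p: "(\<lambda>i. x i + s * (inner (k i) h / r)) = (\<lambda>i. x i + (s / r) * inner (k i) h)" for x s by simp
  have "(\<integral>\<omega>. \<Phi> (\<lambda>i. W (k i) \<omega>) * W u \<omega> \<partial>M) = (\<integral>\<omega>. \<Phi>' (\<lambda>i. W (k i) \<omega>) / r \<partial>M)"
  proof (rule integration_by_parts_unit[OF u])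
    show "((\<lambda>s. \<Phi> (\<lambda>i. x i + s * inner (k i) u)) has_real_derivative \<Phi>' (\<lambda>i. x i + s * inner (k i) u) / r) (at s)" for x s
      unfolding ku p by (rule DERIV_chain2[OF d, THEN DERIV_cong]) (use r in \<open>auto intro!: derivative_eq_intros\<close>)
    show "continuous_on UNIV (\<lambda>s. \<Phi>' (\<lambda>i. x i + s * inner (k i) u) / r)" for x
      unfolding ku p by (intro continuous_intros continuous_on_compose2[OF c[of x]]) (use r in auto)
  qed (use b int in auto)
  moreover have "(\<integral>\<omega>. \<Phi> (\<lambda>i. W (k i) \<omega>) * W h \<omega> \<partial>M) = (\<integral>\<omega>. r * (\<Phi> (\<lambda>i. W (k i) \<omega>) * W u \<omega>) \<partial>M)"
  proof (rule integral_cong_AE)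
    have [measurable]: "(\<lambda>\<omega> i. W (k i) \<omega>) \<in> measurable M (Pi\<^sub>M UNIV (\<lambda>_::nat. borel :: real measure))"
      by (rule measurable_PiM_single') auto
    show "AE \<omega> in M. \<Phi> (\<lambda>i. W (k i) \<omega>) * W h \<omega> = r * (\<Phi> (\<lambda>i. W (k i) \<omega>) * W u \<omega>)"
      using W_scale[of r u] unfolding h[symmetric] by eventually_elim simp
    show "(\<lambda>\<omega>. \<Phi> (\<lambda>i. W (k i) \<omega>) * W h \<omega>) \<in> borel_measurable M" by measurable
    show "(\<lambda>\<omega>. r * (\<Phi> (\<lambda>i. W (k i) \<omega>) * W u \<omega>)) \<in> borel_measurable M" by measurable
  qed
  ultimately show ?thesis using r by simp
qed

end


section \<open>Integration by parts for Malliavin differentiable variables\<close>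

lemma L2_measurable: "X \<in> L2 M \<Longrightarrow> X \<in> borel_measurable M"
  by (simp add: L2_def)

lemma L2_iff_real: "(X :: 'a \<Rightarrow> real) \<in> L2 M \<longleftrightarrow> X \<in> borel_measurable M \<and> integrable M (\<lambda>\<omega>. (X \<omega>)\<^sup>2)"
  by (simp add: L2_def)

lemma abs_mult_le_squares: "\<bar>a * b\<bar> \<le> a\<^sup>2 + b\<^sup>2" for a b :: real
proof -
  have "2 * (\<bar>a\<bar> * \<bar>b\<bar>) \<le> a\<^sup>2 + b\<^sup>2" using sum_squares_bound[of "\<bar>a\<bar>" "\<bar>b\<bar>"] by (simp add: mult.assoc)
  moreover have "0 \<le> \<bar>a\<bar> * \<bar>b\<bar>" by simp
  ultimately show ?thesis unfolding abs_mult by linarith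
qed

lemma L2_mult_integrable:
  fixes X Y :: "'a \<Rightarrow> real"
  assumes "X \<in> L2 M" "Y \<in> L2 M"
  shows "integrable M (\<lambda>\<omega>. X \<omega> * Y \<omega>)"
proof (rule Bochner_Integration.integrable_bound)
  show "integrable M (\<lambda>\<omega>. (X \<omega>)\<^sup>2 + (Y \<omega>)\<^sup>2)" using assms by (simp add: L2_iff_real)
  show "AE \<omega> in M. norm (X \<omega> * Y \<omega>) \<le> norm ((X \<omega>)\<^sup>2 + (Y \<omega>)\<^sup>2)"
    using abs_mult_le_squares by auto
qed (use assms in \<open>auto simp: L2_def\<close>)

lemma L2_add:
  fixes X Y :: "'a \<Rightarrow> 'b::{real_normed_vector, second_countable_topology}"
  assumes "X \<in> L2 M" "Y \<in> L2 M"
  shows "(\<lambda>\<omega>. X \<omega> + Y \<omega>) \<in> L2 M"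
proof -
  have [measurable]: "X \<in> borel_measurable M" "Y \<in> borel_measurable M" using assms by (auto dest: L2_measurable)
  have "integrable M (\<lambda>\<omega>. (norm (X \<omega> + Y \<omega>))\<^sup>2)"
  proof (rule Bochner_Integration.integrable_bound)
    show "integrable M (\<lambda>\<omega>. 2 * ((norm (X \<omega>))\<^sup>2 + (norm (Y \<omega>))\<^sup>2))" using assms by (simp add: L2_def)
    have "(norm (x + y))\<^sup>2 \<le> 2 * ((norm x)\<^sup>2 + (norm y)\<^sup>2)" for x y :: 'b
    proof -
      have "(norm (x + y))\<^sup>2 \<le> (norm x + norm y)\<^sup>2" by (intro power_mono norm_triangle_ineq) auto
      also have "\<dots> \<le> 2 * ((norm x)\<^sup>2 + (norm y)\<^sup>2)"
        using sum_squares_bound[of "norm x" "norm y"] by (simp add: power2_sum)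
      finally show ?thesis .
    qed
    then show "AE \<omega> in M. norm ((norm (X \<omega> + Y \<omega>))\<^sup>2) \<le> norm (2 * ((norm (X \<omega>))\<^sup>2 + (norm (Y \<omega>))\<^sup>2))" by auto
  qed simp
  then show ?thesis by (simp add: L2_def)
qed

lemma L2_scaleR:
  fixes X :: "'a \<Rightarrow> 'b::{real_normed_vector, second_countable_topology}"
  assumes "X \<in> L2 M"
  shows "(\<lambda>\<omega>. c *\<^sub>R X \<omega>) \<in> L2 M"
  using assms by (auto simp: L2_def power_mult_distrib)

lemma L2_diff:
  fixes X Y :: "'a \<Rightarrow> 'b::{real_normed_vector, second_countable_topology}"
  assumes "X \<in> L2 M" "Y \<in> L2 M"
  shows "(\<lambda>\<omega>. X \<omega> - Y \<omega>) \<in> L2 M"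
  using L2_add[OF assms(1) L2_scaleR[OF assms(2), of "-1"]] by simp

lemma L2_mult_left: "X \<in> L2 M \<Longrightarrow> (\<lambda>\<omega>. c * X \<omega>) \<in> L2 M" for X :: "'a \<Rightarrow> real"
  using L2_scaleR[of X M c] by simp

lemma L2_abs: "X \<in> L2 M \<Longrightarrow> (\<lambda>\<omega>. \<bar>X \<omega>\<bar>) \<in> L2 M" for X :: "'a \<Rightarrow> real"
  by (auto simp: L2_iff_real)

lemma L2_inner:
  fixes X :: "'a \<Rightarrow> 'h::{real_inner, second_countable_topology}"
  assumes "X \<in> L2 M"
  shows "(\<lambda>\<omega>. inner (X \<omega>) h) \<in> L2 M"
proof -
  have [measurable]: "X \<in> borel_measurable M" using assms by (rule L2_measurable)
  have "integrable M (\<lambda>\<omega>. (inner (X \<omega>) h)\<^sup>2)"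
  proof (rule Bochner_Integration.integrable_bound)
    show "integrable M (\<lambda>\<omega>. (norm (X \<omega>))\<^sup>2 * (norm h)\<^sup>2)" using assms by (simp add: L2_def)
    show "AE \<omega> in M. norm ((inner (X \<omega>) h)\<^sup>2) \<le> norm ((norm (X \<omega>))\<^sup>2 * (norm h)\<^sup>2)"
    proof (rule AE_I2)
      fix \<omega>
      have "\<bar>inner (X \<omega>) h\<bar>\<^sup>2 \<le> (norm (X \<omega>) * norm h)\<^sup>2"
        by (intro power_mono Cauchy_Schwarz_ineq2) simp
      then show "norm ((inner (X \<omega>) h)\<^sup>2) \<le> norm ((norm (X \<omega>))\<^sup>2 * (norm h)\<^sup>2)" by (simp add: power_mult_distrib)
    qed
  qed simp
  then show ?thesis by (simp add: L2_iff_real)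
qed

lemma (in finite_measure) L2_const: "(\<lambda>\<omega>. c) \<in> L2 M" for c :: "'b::{real_normed_vector, second_countable_topology}"
  by (simp add: L2_def)

lemma (in finite_measure) L2_integrable: "X \<in> L2 M \<Longrightarrow> integrable M X" for X :: "'a \<Rightarrow> real"
  by (auto simp: L2_iff_real intro: square_integrable_imp_integrable)

lemma L2_Cauchy_Schwarz:
  fixes X Y :: "'a \<Rightarrow> real"
  assumes X: "X \<in> L2 M" and Y: "Y \<in> L2 M"
  shows "(\<integral>\<omega>. \<bar>X \<omega> * Y \<omega>\<bar> \<partial>M)\<^sup>2 \<le> (\<integral>\<omega>. (X \<omega>)\<^sup>2 \<partial>M) * (\<integral>\<omega>. (Y \<omega>)\<^sup>2 \<partial>M)"
proof -
  let ?I = "\<integral>\<omega>. \<bar>X \<omega> * Y \<omega>\<bar> \<partial>M" and ?x = "\<integral>\<omega>. (X \<omega>)\<^sup>2 \<partial>M" and ?y = "\<integral>\<omega>. (Y \<omega>)\<^sup>2 \<partial>M"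
  have iX: "integrable M (\<lambda>\<omega>. (X \<omega>)\<^sup>2)" and iY: "integrable M (\<lambda>\<omega>. (Y \<omega>)\<^sup>2)" using X Y by (auto simp: L2_iff_real)
  have iXY: "integrable M (\<lambda>\<omega>. \<bar>X \<omega> * Y \<omega>\<bar>)" using L2_mult_integrable[OF X Y] by simp
  have q: "0 \<le> ?x * a\<^sup>2 - 2 * a * b * ?I + ?y * b\<^sup>2" for a b
  proof -
    have "0 \<le> (\<integral>\<omega>. (a * \<bar>X \<omega>\<bar> - b * \<bar>Y \<omega>\<bar>)\<^sup>2 \<partial>M)" by simp
    also have "\<dots> = (\<integral>\<omega>. (a\<^sup>2 * (X \<omega>)\<^sup>2 - (2 * a * b) * \<bar>X \<omega> * Y \<omega>\<bar>) + b\<^sup>2 * (Y \<omega>)\<^sup>2 \<partial>M)"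
      by (rule Bochner_Integration.integral_cong) (auto simp: power2_diff power_mult_distrib abs_mult)
    also have "\<dots> = a\<^sup>2 * ?x - 2 * a * b * ?I + b\<^sup>2 * ?y"
      using iX iY iXY by simp
    finally show ?thesis by (simp add: mult_ac)
  qed
  have y0: "0 \<le> ?y" by simp
  show ?thesis
  proof (cases "?y = 0")
    case True
    have "AE \<omega> in M. (Y \<omega>)\<^sup>2 = 0" using integral_nonneg_eq_0_iff_AE[OF iY] True by simp
    then have "AE \<omega> in M. \<bar>X \<omega> * Y \<omega>\<bar> = 0" by eventually_elim simp
    then have "?I = 0" by (rule integral_eq_zero_AE)
    then show ?thesis using True by simp
  next
    case False
    then have y: "?y > 0" using y0 by linarith
    \<comment> \<open>The nonnegative quadratic form \<open>q\<close> is evaluated at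
      \<open>a = ?y\<close>, \<open>b = ?I\<close>, its minimiser up to scaling.\<close>
    have "0 \<le> ?y * (?x * ?y - ?I\<^sup>2)"
      using q[of ?y ?I] by (simp add: power2_eq_square algebra_simps)
    then show ?thesis using y by (simp add: zero_le_mult_iff)
  qed
qed

lemma L2_tendsto_0_mult:
  fixes X :: "'i \<Rightarrow> 'a \<Rightarrow> real"
  assumes X: "\<forall>\<^sub>F i in F. X i \<in> L2 M" and lim: "((\<lambda>i. \<integral>\<omega>. (X i \<omega>)\<^sup>2 \<partial>M) \<longlongrightarrow> 0) F" and Y: "Y \<in> L2 M"
  shows "((\<lambda>i. \<integral>\<omega>. \<bar>X i \<omega> * Y \<omega>\<bar> \<partial>M) \<longlongrightarrow> 0) F"
proof -
  have "((\<lambda>i. sqrt ((\<integral>\<omega>. (X i \<omega>)\<^sup>2 \<partial>M) * (\<integral>\<omega>. (Y \<omega>)\<^sup>2 \<partial>M))) \<longlongrightarrow> sqrt (0 * (\<integral>\<omega>. (Y \<omega>)\<^sup>2 \<partial>M))) F"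
    by (intro tendsto_intros lim)
  then have l: "((\<lambda>i. sqrt ((\<integral>\<omega>. (X i \<omega>)\<^sup>2 \<partial>M) * (\<integral>\<omega>. (Y \<omega>)\<^sup>2 \<partial>M))) \<longlongrightarrow> 0) F" by simp
  show ?thesis
  proof (rule Lim_null_comparison[OF _ l])
    show "\<forall>\<^sub>F i in F. norm (\<integral>\<omega>. \<bar>X i \<omega> * Y \<omega>\<bar> \<partial>M) \<le> sqrt ((\<integral>\<omega>. (X i \<omega>)\<^sup>2 \<partial>M) * (\<integral>\<omega>. (Y \<omega>)\<^sup>2 \<partial>M))"
      using X by eventually_elim (simp add: real_le_rsqrt[OF L2_Cauchy_Schwarz] Y)
  qed
qed

context isonormal_gaussian begin

text \<open>The product \<open>\<rho> (F) * \<phi> (W g)\<close> is itself a function of finitely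
  many Gaussian variables, and \<open>\<rho>\<close> makes it bounded although \<open>f\<close> may
  grow polynomially. The right-hand side is its derivative in direction \<open>h\<close> by the
  product and chain rules.\<close>

lemma integration_by_parts_cylindrical:
  assumes sc: "smooth_cylindrical W F DF" and int: "integrable M (\<lambda>\<omega>. inner (DF \<omega>) h)"
    and \<rho>: "\<And>x. (\<rho> has_real_derivative \<rho>' x) (at x)" "continuous_on UNIV \<rho>'"
    and \<rho>b: "\<And>x. \<bar>\<rho> x\<bar> \<le> C" "\<And>x. \<bar>\<rho>' x\<bar> \<le> C"
    and \<phi>: "\<And>x. (\<phi> has_real_derivative \<phi>' x) (at x)" "continuous_on UNIV \<phi>'"
    and \<phi>b: "\<And>x. \<bar>\<phi> x\<bar> \<le> C'" "\<And>x. \<bar>\<phi>' x\<bar> \<le> C'"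
  shows "(\<integral>\<omega>. \<rho> (F \<omega>) * \<phi> (W g \<omega>) * W h \<omega> \<partial>M)
     = (\<integral>\<omega>. \<rho>' (F \<omega>) * inner (DF \<omega>) h * \<phi> (W g \<omega>) + \<rho> (F \<omega>) * \<phi>' (W g \<omega>) * inner g h \<partial>M)"
proof -
  obtain n f l where f: "smooth_poly_growth n f" and F: "F = (\<lambda>\<omega>. f (\<lambda>i. W (l i) \<omega>))"
    and DF: "DF = (\<lambda>\<omega>. \<Sum>i<n. partial_deriv i f (\<lambda>i. W (l i) \<omega>) *\<^sub>R l i)"
    using sc unfolding smooth_cylindrical_def by blast
  \<comment> \<open>Coordinate \<open>n\<close> is free to carry \<open>g\<close>, since
    \<open>f\<close> and its partial derivatives depend only on the coordinates below
    \<open>n\<close>.\<close>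
  define k where "k = l(n := g)"
  define a where "a = (\<lambda>i. inner (k i) h)"
  have a_eq: "inner (k i) h = a i" for i by (simp add: a_def)
  define \<Phi> where "\<Phi> = (\<lambda>x. \<rho> (f x) * \<phi> (x n))"
  define \<Phi>' where "\<Phi>' = (\<lambda>x. \<rho>' (f x) * (\<Sum>i<n. a i * partial_deriv i f x) * \<phi> (x n) + \<rho> (f x) * \<phi>' (x n) * a n)"
  have \<rho>c: "continuous_on UNIV \<rho>" and \<phi>c: "continuous_on UNIV \<phi>"
    using \<rho>(1) \<phi>(1) by (meson DERIV_isCont continuous_at_imp_continuous_on)+
  have [measurable]: "\<rho> \<in> borel_measurable borel" "\<rho>' \<in> borel_measurable borel"
    "\<phi> \<in> borel_measurable borel" "\<phi>' \<in> borel_measurable borel"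
    using \<rho>c \<phi>c \<rho>(2) \<phi>(2) by (auto intro: borel_measurable_continuous_onI)
  note fc = smooth_poly_growth_continuous[OF f] smooth_poly_growth_continuous_partial[OF f]
  have [measurable]: "f \<in> borel_measurable (Pi\<^sub>M UNIV (\<lambda>_. borel))"
    "i < n \<Longrightarrow> partial_deriv i f \<in> borel_measurable (Pi\<^sub>M UNIV (\<lambda>_. borel))" for i
    unfolding measurable_cong_sets[OF sets_PiM_equal_borel refl]
    using fc by (auto intro: borel_measurable_continuous_onI)
  have f_eq: "f (\<lambda>i. W (k i) \<omega>) = F \<omega>" for \<omega>
    unfolding F by (rule smooth_poly_growth_cong[OF f]) (simp add: k_def)
  have DF_eq: "(\<Sum>i<n. a i * partial_deriv i f (\<lambda>i. W (k i) \<omega>)) = inner (DF \<omega>) h" for \<omega>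
  proof -
    have "a i * partial_deriv i f (\<lambda>i. W (k i) \<omega>) = partial_deriv i f (\<lambda>i. W (l i) \<omega>) * inner (l i) h" if "i < n" for i
      using smooth_poly_growth_partial_cong[OF f _ that, of "\<lambda>i. W (k i) \<omega>" "\<lambda>i. W (l i) \<omega>"] that
      by (simp add: a_def k_def mult.commute)
    then show ?thesis unfolding DF by (simp add: inner_sum_left)
  qed
  have kn: "W (k n) \<omega> = W g \<omega>" "a n = inner g h" for \<omega> by (auto simp: k_def a_def)
  have lm: "(\<lambda>\<omega> i. W (k i) \<omega>) \<in> measurable M (Pi\<^sub>M UNIV (\<lambda>_. borel))"
    by (rule measurable_PiM_single') auto
  have [measurable]: "F \<in> borel_measurable M"
    using measurable_compose[OF lm, of f borel] by (simp add: f_eq)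
  have [measurable]: "(\<lambda>\<omega>. inner (DF \<omega>) h) \<in> borel_measurable M" using int by auto
  have lc: "continuous_on UNIV (\<lambda>s i. x i + s * a i)" for x
    by (intro continuous_on_coordinatewise_then_product continuous_intros)
  have "(\<integral>\<omega>. \<Phi> (\<lambda>i. W (k i) \<omega>) * W h \<omega> \<partial>M) = (\<integral>\<omega>. \<Phi>' (\<lambda>i. W (k i) \<omega>) \<partial>M)"
  proof (rule integration_by_parts[where C="C * C'"])
    show "\<Phi> \<in> borel_measurable (Pi\<^sub>M UNIV (\<lambda>_. borel))" unfolding \<Phi>_def by measurable
    show "\<Phi>' \<in> borel_measurable (Pi\<^sub>M UNIV (\<lambda>_. borel))" unfolding \<Phi>'_def by measurable
    show "\<bar>\<Phi> x\<bar> \<le> C * C'" for x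
      unfolding \<Phi>_def abs_mult using \<rho>b(1)[of "f x"] \<phi>b(1)[of "x n"] by (intro mult_mono) auto
    show "((\<lambda>s. \<Phi> (\<lambda>i. x i + s * inner (k i) h)) has_real_derivative \<Phi>' (\<lambda>i. x i + s * inner (k i) h)) (at s)" for x s
      unfolding \<Phi>_def \<Phi>'_def a_eq
      by (auto intro!: derivative_eq_intros DERIV_chain2[OF \<rho>(1)] DERIV_chain2[OF \<phi>(1)]
          smooth_poly_growth_has_directional[OF f] simp: algebra_simps)
    have "continuous_on UNIV (\<lambda>s. partial_deriv i f (\<lambda>i. x i + s * a i))" if "i < n" for i x
      by (rule continuous_on_compose2[OF fc(2)[OF that] lc]) simp
    moreover have "continuous_on UNIV (\<lambda>s. f (\<lambda>i. x i + s * a i))" for x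
      by (rule continuous_on_compose2[OF fc(1) lc]) simp
    ultimately show "continuous_on UNIV (\<lambda>s. \<Phi>' (\<lambda>i. x i + s * inner (k i) h))" for x
      unfolding \<Phi>'_def a_eq
      by (intro continuous_intros continuous_on_compose2[OF \<rho>(2)] continuous_on_compose2[OF \<rho>c]
          continuous_on_compose2[OF \<phi>c] continuous_on_compose2[OF \<phi>(2)]) auto
    have "integrable M (\<lambda>\<omega>. \<rho>' (F \<omega>) * inner (DF \<omega>) h * \<phi> (W g \<omega>))"
    proof (rule Bochner_Integration.integrable_bound)
      show "integrable M (\<lambda>\<omega>. C * inner (DF \<omega>) h * C')" using int by simp
      have "\<bar>\<rho>' x\<bar> * y * \<bar>\<phi> z\<bar> \<le> \<bar>C\<bar> * y * \<bar>C'\<bar>" if "y \<ge> 0" for x y z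
        using that \<rho>b(2)[of x] \<phi>b(1)[of z] by (intro mult_mono) auto
      then show "AE \<omega> in M. norm (\<rho>' (F \<omega>) * inner (DF \<omega>) h * \<phi> (W g \<omega>)) \<le> norm (C * inner (DF \<omega>) h * C')"
        by (auto simp: abs_mult)
    qed simp
    moreover have "integrable M (\<lambda>\<omega>. \<rho> (F \<omega>) * \<phi>' (W g \<omega>) * inner g h)"
    proof (rule integrable_const_bound[of _ "\<bar>C\<bar> * \<bar>C'\<bar> * \<bar>inner g h\<bar>"])
      have "\<bar>\<rho> x\<bar> * \<bar>\<phi>' z\<bar> \<le> \<bar>C\<bar> * \<bar>C'\<bar>" for x z
        using \<rho>b(1)[of x] \<phi>b(2)[of z] by (intro mult_mono) auto
      then show "AE \<omega> in M. norm (\<rho> (F \<omega>) * \<phi>' (W g \<omega>) * inner g h) \<le> \<bar>C\<bar> * \<bar>C'\<bar> * \<bar>inner g h\<bar>"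
        by (auto simp: abs_mult intro!: mult_right_mono)
    qed simp
    ultimately show "integrable M (\<lambda>\<omega>. \<Phi>' (\<lambda>i. W (k i) \<omega>))"
      unfolding \<Phi>'_def f_eq DF_eq kn by simp
  qed
  then show ?thesis
    unfolding \<Phi>_def \<Phi>'_def f_eq DF_eq kn .
qed

text \<open>The formula survives the closure of the derivative: in the difference between an
  approximation and the limit every term has a factor \<open>Fn - F\<close> or
  \<open>DFn - DF\<close> tending to 0 in mean square, multiplied by bounded factors and at most one
  fixed square integrable variable.\<close>

lemma integration_by_parts_malliavin:
  assumes mall: "has_malliavin_derivative M W F DF"
    and \<rho>: "\<And>x. (\<rho> has_real_derivative \<rho>' x) (at x)"
    and \<rho>b: "\<And>x. \<bar>\<rho> x\<bar> \<le> C" "\<And>x. \<bar>\<rho>' x\<bar> \<le> C" and lip: "\<And>x y. \<bar>\<rho>' x - \<rho>' y\<bar> \<le> C * \<bar>x - y\<bar>"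
    and \<phi>: "\<And>x. (\<phi> has_real_derivative \<phi>' x) (at x)" "continuous_on UNIV \<phi>'"
    and \<phi>b: "\<And>x. \<bar>\<phi> x\<bar> \<le> C'" "\<And>x. \<bar>\<phi>' x\<bar> \<le> C'"
  shows "(\<integral>\<omega>. \<rho> (F \<omega>) * \<phi> (W g \<omega>) * W h \<omega> - (\<rho>' (F \<omega>) * inner (DF \<omega>) h * \<phi> (W g \<omega>)
           + \<rho> (F \<omega>) * \<phi>' (W g \<omega>) * inner g h) \<partial>M) = 0"
proof -
  obtain Fn DFn where sc: "\<And>n::nat. smooth_cylindrical W (Fn n) (DFn n)"
    and F: "L2_tendsto M Fn F sequentially" and DF: "L2_tendsto M DFn DF sequentially"
    using mall unfolding has_malliavin_derivative_def by blast
  have C0: "C \<ge> 0" "C' \<ge> 0" using \<rho>b(1)[of 0] \<phi>b(1)[of 0] by auto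
  have \<rho>'c: "continuous_on UNIV \<rho>'"
  proof (rule lipschitz_on_continuous_on)
    show "C-lipschitz_on UNIV \<rho>'" using lip C0 by (auto simp: lipschitz_on_def dist_real_def)
  qed
  have \<rho>lip: "\<bar>\<rho> x - \<rho> y\<bar> \<le> C * \<bar>x - y\<bar>" for x y
    using field_differentiable_bound[of UNIV \<rho> \<rho>' C x y] \<rho> \<rho>b(2) by auto
  have \<rho>c: "continuous_on UNIV \<rho>" and \<phi>c: "continuous_on UNIV \<phi>"
    using \<rho>(1) \<phi>(1) by (meson DERIV_isCont continuous_at_imp_continuous_on)+
  have [measurable]: "\<rho> \<in> borel_measurable borel" "\<rho>' \<in> borel_measurable borel"
    "\<phi> \<in> borel_measurable borel" "\<phi>' \<in> borel_measurable borel"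
    using \<rho>c \<phi>c \<rho>'c \<phi>(2) by (auto intro: borel_measurable_continuous_onI)
  \<comment> \<open>The defect of the formula for a pair \<open>G\<close>, \<open>DG\<close>. Its
    integral is 0 on cylindrical pairs, and the aim is to show that this passes to the
    limit.\<close>
  define d where "d = (\<lambda>G DG \<omega>. \<rho> (G \<omega>) * \<phi> (W g \<omega>) * W h \<omega> - (\<rho>' (G \<omega>) * inner (DG \<omega>) h * \<phi> (W g \<omega>)
           + \<rho> (G \<omega>) * \<phi>' (W g \<omega>) * inner g h))"
  define dh where "dh = (\<lambda>\<omega>. inner (DF \<omega>) h)"
  have FL2: "F \<in> L2 M" and DFL2: "DF \<in> L2 M" using F DF by (auto simp: L2_tendsto_def)
  have dhL2: "dh \<in> L2 M" unfolding dh_def by (rule L2_inner[OF DFL2])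
  have di: "integrable M (d G DG)" and d0: "smooth_cylindrical W G DG \<Longrightarrow> integral\<^sup>L M (d G DG) = 0"
    if G: "G \<in> L2 M" and DG: "DG \<in> L2 M" for G DG
  proof -
    have [measurable]: "G \<in> borel_measurable M" "DG \<in> borel_measurable M" using G DG by (auto dest: L2_measurable)
    have i: "integrable M (\<lambda>\<omega>. inner (DG \<omega>) h)" by (intro L2_integrable L2_inner DG)
    have i1: "integrable M (\<lambda>\<omega>. \<rho> (G \<omega>) * \<phi> (W g \<omega>) * W h \<omega>)"
    proof (rule Bochner_Integration.integrable_bound)
      show "integrable M (\<lambda>\<omega>. C * C' * W h \<omega>)" using L2_integrable[OF W_L2] by simp
      show "AE \<omega> in M. norm (\<rho> (G \<omega>) * \<phi> (W g \<omega>) * W h \<omega>) \<le> norm (C * C' * W h \<omega>)"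
        using \<rho>b \<phi>b C0 by (auto simp: abs_mult intro!: mult_right_mono mult_mono)
    qed simp
    have i2: "integrable M (\<lambda>\<omega>. \<rho>' (G \<omega>) * inner (DG \<omega>) h * \<phi> (W g \<omega>))"
    proof (rule Bochner_Integration.integrable_bound)
      show "integrable M (\<lambda>\<omega>. C * inner (DG \<omega>) h * C')" using i by simp
      show "AE \<omega> in M. norm (\<rho>' (G \<omega>) * inner (DG \<omega>) h * \<phi> (W g \<omega>)) \<le> norm (C * inner (DG \<omega>) h * C')"
        using \<rho>b \<phi>b C0 by (auto simp: abs_mult intro!: mult_right_mono mult_mono)
    qed simp
    have i3: "integrable M (\<lambda>\<omega>. \<rho> (G \<omega>) * \<phi>' (W g \<omega>) * inner g h)"
    proof (rule integrable_const_bound[of _ "C * C' * \<bar>inner g h\<bar>"])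
      show "AE \<omega> in M. norm (\<rho> (G \<omega>) * \<phi>' (W g \<omega>) * inner g h) \<le> C * C' * \<bar>inner g h\<bar>"
        using \<rho>b \<phi>b C0 by (auto simp: abs_mult intro!: mult_right_mono mult_mono)
    qed simp
    show "integrable M (d G DG)" unfolding d_def using i1 i2 i3 by simp
    assume "smooth_cylindrical W G DG"
    from integration_by_parts_cylindrical[OF this i \<rho> \<rho>'c \<rho>b \<phi> \<phi>b]
    show "integral\<^sup>L M (d G DG) = 0" unfolding d_def using i1 i2 i3 by simp
  qed
  have ev: "\<forall>\<^sub>F n in sequentially. Fn n \<in> L2 M \<and> DFn n \<in> L2 M"
    using F DF by (auto simp: L2_tendsto_def eventually_conj_iff)
  define X where "X = (\<lambda>n \<omega>. \<bar>Fn n \<omega> - F \<omega>\<bar>)"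
  define Y where "Y = (\<lambda>n \<omega>. inner (DFn n \<omega> - DF \<omega>) h)"
  have XL2: "\<forall>\<^sub>F n in sequentially. X n \<in> L2 M"
    using ev unfolding X_def by eventually_elim (intro L2_abs L2_diff[OF _ FL2], simp)
  have YL2: "\<forall>\<^sub>F n in sequentially. Y n \<in> L2 M"
    using ev unfolding Y_def by eventually_elim (intro L2_inner L2_diff[OF _ DFL2], simp)
  have Xlim: "(\<lambda>n. \<integral>\<omega>. (X n \<omega>)\<^sup>2 \<partial>M) \<longlonglongrightarrow> 0" using F by (simp add: L2_tendsto_def X_def)
  have Ylim: "(\<lambda>n. \<integral>\<omega>. (Y n \<omega>)\<^sup>2 \<partial>M) \<longlonglongrightarrow> 0"
  proof (rule Lim_null_comparison)
    show "(\<lambda>n. (\<integral>\<omega>. (norm (DFn n \<omega> - DF \<omega>))\<^sup>2 \<partial>M) * (norm h)\<^sup>2) \<longlonglongrightarrow> 0"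
      using DF by (intro tendsto_mult_left_zero) (simp add: L2_tendsto_def)
    show "\<forall>\<^sub>F n in sequentially. norm (\<integral>\<omega>. (Y n \<omega>)\<^sup>2 \<partial>M) \<le> (\<integral>\<omega>. (norm (DFn n \<omega> - DF \<omega>))\<^sup>2 \<partial>M) * (norm h)\<^sup>2"
      using ev YL2
    proof eventually_elim
      case (elim n)
      have "(\<integral>\<omega>. (Y n \<omega>)\<^sup>2 \<partial>M) \<le> (\<integral>\<omega>. (norm (DFn n \<omega> - DF \<omega>))\<^sup>2 * (norm h)\<^sup>2 \<partial>M)"
      proof (rule integral_mono)
        show "integrable M (\<lambda>\<omega>. (norm (DFn n \<omega> - DF \<omega>))\<^sup>2 * (norm h)\<^sup>2)"
          using L2_diff[OF _ DFL2] elim by (auto simp: L2_def)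
        show "(Y n \<omega>)\<^sup>2 \<le> (norm (DFn n \<omega> - DF \<omega>))\<^sup>2 * (norm h)\<^sup>2" for \<omega>
          unfolding Y_def using Cauchy_Schwarz_ineq2[of "DFn n \<omega> - DF \<omega>" h]
          by (metis abs_ge_zero power2_abs power_mono power_mult_distrib)
      qed (use elim in \<open>auto simp: L2_iff_real\<close>)
      then show ?case by simp
    qed
  qed
  define v where "v = (\<lambda>n \<omega>. C * C' * \<bar>X n \<omega> * W h \<omega>\<bar> + C * C' * \<bar>X n \<omega> * dh \<omega>\<bar> + C * C' * \<bar>Y n \<omega> * 1\<bar>
     + C * C' * \<bar>inner g h\<bar> * \<bar>X n \<omega> * 1\<bar>)"
  have bound: "\<bar>d (Fn n) (DFn n) \<omega> - d F DF \<omega>\<bar> \<le> v n \<omega>" for n \<omega>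
  proof -
    have tri: "\<bar>a - b - c - e\<bar> \<le> \<bar>a\<bar> + \<bar>b\<bar> + \<bar>c\<bar> + \<bar>e\<bar>" for a b c e :: real by linarith
    have 1: "\<bar>\<rho> (Fn n \<omega>) - \<rho> (F \<omega>)\<bar> * \<bar>\<phi> (W g \<omega>)\<bar> * \<bar>W h \<omega>\<bar> \<le> (C * X n \<omega>) * C' * \<bar>W h \<omega>\<bar>"
      using \<rho>lip[of "Fn n \<omega>" "F \<omega>"] \<phi>b C0 by (intro mult_right_mono mult_mono) (auto simp: X_def)
    have 2: "\<bar>\<rho>' (Fn n \<omega>) - \<rho>' (F \<omega>)\<bar> * \<bar>dh \<omega>\<bar> * \<bar>\<phi> (W g \<omega>)\<bar> \<le> (C * X n \<omega>) * \<bar>dh \<omega>\<bar> * C'"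
      using lip[of "Fn n \<omega>" "F \<omega>"] \<phi>b C0 by (intro mult_right_mono mult_mono) (auto simp: X_def)
    have 3: "\<bar>\<rho>' (Fn n \<omega>)\<bar> * \<bar>Y n \<omega>\<bar> * \<bar>\<phi> (W g \<omega>)\<bar> \<le> C * \<bar>Y n \<omega>\<bar> * C'"
      using \<rho>b \<phi>b C0 by (intro mult_right_mono mult_mono) auto
    have 4: "\<bar>\<rho> (Fn n \<omega>) - \<rho> (F \<omega>)\<bar> * \<bar>\<phi>' (W g \<omega>)\<bar> * \<bar>inner g h\<bar> \<le> (C * X n \<omega>) * C' * \<bar>inner g h\<bar>"
      using \<rho>lip[of "Fn n \<omega>" "F \<omega>"] \<phi>b C0 by (intro mult_right_mono mult_mono) (auto simp: X_def)
    \<comment> \<open>The term with \<open>\<rho>'\<close> is split so that the increment of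
      \<open>\<rho>'\<close>, controlled by its Lipschitz bound, meets the fixed \<open>dh\<close>,
      while the varying \<open>Y n\<close> meets only the bounded \<open>\<rho>'\<close>.\<close>
    have e: "d (Fn n) (DFn n) \<omega> - d F DF \<omega> = (\<rho> (Fn n \<omega>) - \<rho> (F \<omega>)) * \<phi> (W g \<omega>) * W h \<omega>
       - (\<rho>' (Fn n \<omega>) - \<rho>' (F \<omega>)) * dh \<omega> * \<phi> (W g \<omega>) - \<rho>' (Fn n \<omega>) * Y n \<omega> * \<phi> (W g \<omega>)
       - (\<rho> (Fn n \<omega>) - \<rho> (F \<omega>)) * \<phi>' (W g \<omega>) * inner g h"
      by (simp add: d_def dh_def Y_def inner_diff_left algebra_simps)
    have "\<bar>d (Fn n) (DFn n) \<omega> - d F DF \<omega>\<bar> \<le> \<bar>\<rho> (Fn n \<omega>) - \<rho> (F \<omega>)\<bar> * \<bar>\<phi> (W g \<omega>)\<bar> * \<bar>W h \<omega>\<bar>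
       + \<bar>\<rho>' (Fn n \<omega>) - \<rho>' (F \<omega>)\<bar> * \<bar>dh \<omega>\<bar> * \<bar>\<phi> (W g \<omega>)\<bar> + \<bar>\<rho>' (Fn n \<omega>)\<bar> * \<bar>Y n \<omega>\<bar> * \<bar>\<phi> (W g \<omega>)\<bar>
       + \<bar>\<rho> (Fn n \<omega>) - \<rho> (F \<omega>)\<bar> * \<bar>\<phi>' (W g \<omega>)\<bar> * \<bar>inner g h\<bar>"
      unfolding e abs_mult[symmetric] by (rule tri)
    also have "\<dots> \<le> (C * X n \<omega>) * C' * \<bar>W h \<omega>\<bar> + (C * X n \<omega>) * \<bar>dh \<omega>\<bar> * C' + C * \<bar>Y n \<omega>\<bar> * C'
       + (C * X n \<omega>) * C' * \<bar>inner g h\<bar>"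
      by (intro add_mono 1 2 3 4)
    also have "\<dots> = v n \<omega>" by (simp add: v_def X_def abs_mult mult_ac)
    finally show ?thesis .
  qed
  note one = L2_const[of "1::real"]
  have iv: "integrable M (v n) \<and> integral\<^sup>L M (v n) = C * C' * (\<integral>\<omega>. \<bar>X n \<omega> * W h \<omega>\<bar> \<partial>M) + C * C' * (\<integral>\<omega>. \<bar>X n \<omega> * dh \<omega>\<bar> \<partial>M)
     + C * C' * (\<integral>\<omega>. \<bar>Y n \<omega> * 1\<bar> \<partial>M) + C * C' * \<bar>inner g h\<bar> * (\<integral>\<omega>. \<bar>X n \<omega> * 1\<bar> \<partial>M)"
    if X: "X n \<in> L2 M" and Y: "Y n \<in> L2 M" for n
  proof -
    have "integrable M (\<lambda>\<omega>. \<bar>X n \<omega> * W h \<omega>\<bar>)" "integrable M (\<lambda>\<omega>. \<bar>X n \<omega> * dh \<omega>\<bar>)"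
      "integrable M (\<lambda>\<omega>. \<bar>Y n \<omega> * 1\<bar>)" "integrable M (\<lambda>\<omega>. \<bar>X n \<omega> * 1\<bar>)"
      by (intro integrable_abs L2_mult_integrable X Y W_L2 dhL2 one)+
    then show ?thesis unfolding v_def by simp
  qed
  have "(\<lambda>n. C * C' * (\<integral>\<omega>. \<bar>X n \<omega> * W h \<omega>\<bar> \<partial>M) + C * C' * (\<integral>\<omega>. \<bar>X n \<omega> * dh \<omega>\<bar> \<partial>M)
     + C * C' * (\<integral>\<omega>. \<bar>Y n \<omega> * 1\<bar> \<partial>M) + C * C' * \<bar>inner g h\<bar> * (\<integral>\<omega>. \<bar>X n \<omega> * 1\<bar> \<partial>M)) \<longlonglongrightarrow> 
     C * C' * 0 + C * C' * 0 + C * C' * 0 + C * C' * \<bar>inner g h\<bar> * 0"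
    by (intro tendsto_intros L2_tendsto_0_mult[OF XL2 Xlim] L2_tendsto_0_mult[OF YL2 Ylim] W_L2 dhL2 one)
  then have vlim: "(\<lambda>n. C * C' * (\<integral>\<omega>. \<bar>X n \<omega> * W h \<omega>\<bar> \<partial>M) + C * C' * (\<integral>\<omega>. \<bar>X n \<omega> * dh \<omega>\<bar> \<partial>M)
     + C * C' * (\<integral>\<omega>. \<bar>Y n \<omega> * 1\<bar> \<partial>M) + C * C' * \<bar>inner g h\<bar> * (\<integral>\<omega>. \<bar>X n \<omega> * 1\<bar> \<partial>M)) \<longlonglongrightarrow> 0" by simp
  have "(\<lambda>n. integral\<^sup>L M (d F DF)) \<longlonglongrightarrow> 0"
  proof (rule Lim_null_comparison[OF _ vlim])
    show "\<forall>\<^sub>F n in sequentially. norm (integral\<^sup>L M (d F DF)) \<le> C * C' * (\<integral>\<omega>. \<bar>X n \<omega> * W h \<omega>\<bar> \<partial>M) + C * C' * (\<integral>\<omega>. \<bar>X n \<omega> * dh \<omega>\<bar> \<partial>M)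
     + C * C' * (\<integral>\<omega>. \<bar>Y n \<omega> * 1\<bar> \<partial>M) + C * C' * \<bar>inner g h\<bar> * (\<integral>\<omega>. \<bar>X n \<omega> * 1\<bar> \<partial>M)"
      using ev XL2 YL2
    proof eventually_elim
      case (elim n)
      have i: "integrable M (d F DF)" "integrable M (d (Fn n) (DFn n))"
        using di FL2 DFL2 elim by auto
      have "norm (integral\<^sup>L M (d F DF)) = norm (\<integral>\<omega>. d (Fn n) (DFn n) \<omega> - d F DF \<omega> \<partial>M)"
        using i d0[OF _ _ sc] elim by simp
      also have "\<dots> \<le> (\<integral>\<omega>. norm (d (Fn n) (DFn n) \<omega> - d F DF \<omega>) \<partial>M)"
        by (rule integral_norm_bound)
      also have "\<dots> \<le> integral\<^sup>L M (v n)"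
        using i iv[of n] elim bound by (intro integral_mono) auto
      finally show ?case using iv[of n] elim by simp
    qed
  qed
  then have "integral\<^sup>L M (d F DF) = 0" by (simp add: tendsto_const_iff)
  then show ?thesis unfolding d_def .
qed

end


text \<open>
  Bounded substitutes for \<open>exp\<close> which, together with their derivatives, are dominated by \<open>exp\<close> and
  converge to it as \<open>N \<rightarrow> \<infinity>\<close>; this allows an integration by parts against \<open>exp F\<close> when \<open>exp F\<close> is
  not known to be Malliavin differentiable.
\<close>

definition exp_cutoff :: "real \<Rightarrow> real \<Rightarrow> real" where
  "exp_cutoff N x = exp x / (1 + exp x / N)"

definition exp_cutoff' :: "real \<Rightarrow> real \<Rightarrow> real" where
  "exp_cutoff' N x = exp x / (1 + exp x / N)\<^sup>2"

definition exp_cutoff'' :: "real \<Rightarrow> real \<Rightarrow> real" where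
  "exp_cutoff'' N x = exp x * (1 - exp x / N) / (1 + exp x / N) ^ 3"

lemma exp_cutoff_derivs:
  assumes "N > 0"
  shows "(exp_cutoff N has_real_derivative exp_cutoff' N x) (at x)"
    and "(exp_cutoff' N has_real_derivative exp_cutoff'' N x) (at x)"
proof -
  have p: "1 + exp x / N > 0" using assms by (simp add: add_pos_pos)
  have d: "((\<lambda>x. 1 + exp x / N) has_real_derivative exp x / N) (at x)"
    using assms by (auto intro!: derivative_eq_intros)
  have "((\<lambda>x. exp x / (1 + exp x / N)) has_real_derivative
      (exp x * (1 + exp x / N) - exp x * (exp x / N)) / ((1 + exp x / N) * (1 + exp x / N))) (at x)"
    using p by (intro DERIV_divide DERIV_exp d) simp
  then show "(exp_cutoff N has_real_derivative exp_cutoff' N x) (at x)"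
    by (simp add: exp_cutoff_def[abs_def] exp_cutoff'_def power2_eq_square distrib_left)
  have "((\<lambda>x. exp x / (1 + exp x / N)\<^sup>2) has_real_derivative
      (exp x * (1 + exp x / N)\<^sup>2 - exp x * (2 * (1 + exp x / N) * (exp x / N))) / ((1 + exp x / N)\<^sup>2 * (1 + exp x / N)\<^sup>2)) (at x)"
    using p by (intro DERIV_divide DERIV_exp DERIV_cong[OF DERIV_power[OF d, of 2]]) auto
  moreover have "(e * q\<^sup>2 - e * (2 * q * (q - 1))) / (q\<^sup>2 * q\<^sup>2) = e * (1 - (q - 1)) / q ^ 3" if "q > 0" for e q :: real
    using that by (simp add: field_simps power2_eq_square power3_eq_cube)
  from this[OF p] have "(exp x * (1 + exp x / N)\<^sup>2 - exp x * (2 * (1 + exp x / N) * (exp x / N))) / ((1 + exp x / N)\<^sup>2 * (1 + exp x / N)\<^sup>2)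
     = exp_cutoff'' N x"
    by (simp add: exp_cutoff''_def)
  ultimately show "(exp_cutoff' N has_real_derivative exp_cutoff'' N x) (at x)"
    by (simp add: exp_cutoff'_def[abs_def])
qed

text \<open>With \<open>q = 1 + exp x / N \<ge> 1\<close> the cutoff is
  \<open>N * (q - 1) / q\<close>, and its second derivative is the first one times
  \<open>(2 - q) / q\<close>, a factor of modulus at most 1. The bounds by \<open>exp x\<close>
  provide the majorant for the limit. Those by \<open>N\<close> make the cutoff admissible in the
  integration by parts, the last one as Lipschitz constant of the derivative.\<close>

lemma exp_cutoff_bounds:
  assumes "N > 0"
  shows "\<bar>exp_cutoff N x\<bar> \<le> exp x" "\<bar>exp_cutoff' N x\<bar> \<le> exp x"
    and "\<bar>exp_cutoff N x\<bar> \<le> N" "\<bar>exp_cutoff' N x\<bar> \<le> N" "\<bar>exp_cutoff'' N x\<bar> \<le> N"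
proof -
  define q where "q = 1 + exp x / N"
  have q: "q \<ge> 1" "q > 0" using assms by (auto simp: q_def add_pos_pos)
  have e: "exp x = N * (q - 1)" using assms by (simp add: q_def)
  have c0: "exp_cutoff N x \<ge> 0" "exp_cutoff' N x \<ge> 0"
    using q by (auto simp: exp_cutoff_def exp_cutoff'_def q_def[symmetric])
  have le: "exp_cutoff' N x \<le> exp_cutoff N x"
    using q mult_left_mono[of 1 q q] unfolding exp_cutoff_def exp_cutoff'_def q_def[symmetric]
    by (intro divide_left_mono) (auto simp: power2_eq_square)
  have b1: "exp_cutoff N x \<le> exp x"
    using q divide_left_mono[of 1 q "exp x"] unfolding exp_cutoff_def q_def[symmetric] by simp
  have b2: "exp_cutoff N x \<le> N"
    using q assms unfolding exp_cutoff_def q_def[symmetric] e by (simp add: field_simps)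
  show "\<bar>exp_cutoff N x\<bar> \<le> exp x" "\<bar>exp_cutoff' N x\<bar> \<le> exp x" "\<bar>exp_cutoff N x\<bar> \<le> N" "\<bar>exp_cutoff' N x\<bar> \<le> N"
    using c0 le b1 b2 by auto
  have "\<bar>exp_cutoff'' N x\<bar> = exp_cutoff' N x * (\<bar>2 - q\<bar> / q)"
    using q unfolding exp_cutoff''_def exp_cutoff'_def q_def[symmetric]
    by (simp add: q_def abs_mult power2_eq_square power3_eq_cube)
  also have "\<dots> \<le> exp_cutoff' N x * 1"
    using q c0 by (intro mult_left_mono) (auto simp: abs_le_iff)
  finally show "\<bar>exp_cutoff'' N x\<bar> \<le> N" using le b2 by simp
qed

lemma exp_cutoff_limits:
  "(\<lambda>n. exp_cutoff (real (Suc n)) x) \<longlonglongrightarrow> exp x" "(\<lambda>n. exp_cutoff' (real (Suc n)) x) \<longlonglongrightarrow> exp x"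
proof -
  have "(\<lambda>n. exp x * inverse (real (Suc n))) \<longlonglongrightarrow> 0"
    by (intro tendsto_mult_right_zero LIMSEQ_inverse_real_of_nat)
  then have l: "(\<lambda>n. exp x / real (Suc n)) \<longlonglongrightarrow> 0" by (simp add: divide_inverse)
  have "(\<lambda>n. exp_cutoff (real (Suc n)) x) \<longlonglongrightarrow> exp x / (1 + 0)"
    unfolding exp_cutoff_def by (intro tendsto_intros l) auto
  then show "(\<lambda>n. exp_cutoff (real (Suc n)) x) \<longlonglongrightarrow> exp x" by simp
  have "(\<lambda>n. exp_cutoff' (real (Suc n)) x) \<longlonglongrightarrow> exp x / (1 + 0)\<^sup>2"
    unfolding exp_cutoff'_def by (intro tendsto_intros l) auto
  then show "(\<lambda>n. exp_cutoff' (real (Suc n)) x) \<longlonglongrightarrow> exp x" by simp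
qed

context isonormal_gaussian begin

text \<open>The formula for the cutoffs passes to the limit by dominated convergence, the majorant
  being assembled from the three integrable functions in the hypotheses. Read with
  \<open>exp F\<close> as a density, these say that 1, \<open>W h\<close> and
  \<open>inner (DF \<omega>) h\<close> are integrable under the changed measure.\<close>

lemma integration_by_parts_exp:
  assumes mall: "has_malliavin_derivative M W F DF"
    and i0: "integrable M (\<lambda>\<omega>. exp (F \<omega>))"
    and i1: "integrable M (\<lambda>\<omega>. exp (F \<omega>) * W h \<omega>)"
    and i2: "integrable M (\<lambda>\<omega>. exp (F \<omega>) * inner (DF \<omega>) h)"
    and \<phi>: "\<And>x. (\<phi> has_real_derivative \<phi>' x) (at x)" "continuous_on UNIV \<phi>'"
    and \<phi>b: "\<And>x. \<bar>\<phi> x\<bar> \<le> C" "\<And>x. \<bar>\<phi>' x\<bar> \<le> C"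
  shows "(\<integral>\<omega>. exp (F \<omega>) * (\<phi> (W g \<omega>) * (W h \<omega> - inner (DF \<omega>) h)) \<partial>M)
     = inner g h * (\<integral>\<omega>. exp (F \<omega>) * \<phi>' (W g \<omega>) \<partial>M)"
proof -
  have C0: "C \<ge> 0" using \<phi>b(1)[of 0] by simp
  have \<phi>c: "continuous_on UNIV \<phi>"
    using \<phi>(1) by (meson DERIV_isCont continuous_at_imp_continuous_on)
  have Fm[measurable]: "F \<in> borel_measurable M" and [measurable]: "DF \<in> borel_measurable M"
    using mall by (auto simp: has_malliavin_derivative_def L2_tendsto_def L2_def)
  have [measurable]: "\<phi> \<in> borel_measurable borel" "\<phi>' \<in> borel_measurable borel"
    using \<phi>c \<phi>(2) by (auto intro: borel_measurable_continuous_onI)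
  have [measurable]: "exp_cutoff N \<in> borel_measurable borel" "exp_cutoff' N \<in> borel_measurable borel" for N
    unfolding exp_cutoff_def exp_cutoff'_def by measurable
  have z: "(\<integral>\<omega>. exp_cutoff (real (Suc n)) (F \<omega>) * \<phi> (W g \<omega>) * W h \<omega> - (exp_cutoff' (real (Suc n)) (F \<omega>) * inner (DF \<omega>) h * \<phi> (W g \<omega>)
           + exp_cutoff (real (Suc n)) (F \<omega>) * \<phi>' (W g \<omega>) * inner g h) \<partial>M) = 0" for n
  proof (rule integration_by_parts_malliavin[OF mall _ _ _ _ \<phi> \<phi>b, where C="real (Suc n)"])
    have N: "real (Suc n) > 0" by simp
    note b = exp_cutoff_bounds[OF N] and d = exp_cutoff_derivs[OF N]
    show "\<bar>exp_cutoff' (real (Suc n)) x - exp_cutoff' (real (Suc n)) y\<bar> \<le> real (Suc n) * \<bar>x - y\<bar>" for x y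
      using field_differentiable_bound[of UNIV "exp_cutoff' (real (Suc n))" _ "real (Suc n)" x y, OF _ d(2)] b(5) by auto
  qed (use exp_cutoff_bounds[of "real (Suc n)"] exp_cutoff_derivs[of "real (Suc n)"] in auto)
  have bi1: "\<bar>r * p * w\<bar> \<le> C * \<bar>e * w\<bar>" if "\<bar>r\<bar> \<le> e" "\<bar>p\<bar> \<le> C" for r p w e :: real
  proof -
    have "\<bar>r\<bar> * \<bar>p\<bar> * \<bar>w\<bar> \<le> e * C * \<bar>w\<bar>" using that C0 by (intro mult_right_mono mult_mono) auto
    also have "\<dots> = C * \<bar>e * w\<bar>" using that by (simp add: abs_mult)
    finally show ?thesis by (simp add: abs_mult)
  qed
  let ?L = "\<lambda>\<omega>. exp (F \<omega>) * \<phi> (W g \<omega>) * W h \<omega> - (exp (F \<omega>) * inner (DF \<omega>) h * \<phi> (W g \<omega>)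
           + exp (F \<omega>) * \<phi>' (W g \<omega>) * inner g h)"
  have "(\<lambda>n. \<integral>\<omega>. exp_cutoff (real (Suc n)) (F \<omega>) * \<phi> (W g \<omega>) * W h \<omega> - (exp_cutoff' (real (Suc n)) (F \<omega>) * inner (DF \<omega>) h * \<phi> (W g \<omega>)
           + exp_cutoff (real (Suc n)) (F \<omega>) * \<phi>' (W g \<omega>) * inner g h) \<partial>M)
    \<longlonglongrightarrow> (\<integral>\<omega>. ?L \<omega> \<partial>M)"
  proof (rule integral_dominated_convergence)
    show "integrable M (\<lambda>\<omega>. C * \<bar>exp (F \<omega>) * W h \<omega>\<bar> + C * \<bar>exp (F \<omega>) * inner (DF \<omega>) h\<bar> + C * \<bar>exp (F \<omega>) * inner g h\<bar>)"
      using i0 i1 i2 by (intro Bochner_Integration.integrable_add integrable_mult_right integrable_abs integrable_mult_left)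
    show "AE \<omega> in M. (\<lambda>n. exp_cutoff (real (Suc n)) (F \<omega>) * \<phi> (W g \<omega>) * W h \<omega> - (exp_cutoff' (real (Suc n)) (F \<omega>) * inner (DF \<omega>) h * \<phi> (W g \<omega>)
           + exp_cutoff (real (Suc n)) (F \<omega>) * \<phi>' (W g \<omega>) * inner g h)) \<longlonglongrightarrow> ?L \<omega>"
      by (intro AE_I2 tendsto_intros exp_cutoff_limits)
    show "AE \<omega> in M. norm (exp_cutoff (real (Suc n)) (F \<omega>) * \<phi> (W g \<omega>) * W h \<omega> - (exp_cutoff' (real (Suc n)) (F \<omega>) * inner (DF \<omega>) h * \<phi> (W g \<omega>)
           + exp_cutoff (real (Suc n)) (F \<omega>) * \<phi>' (W g \<omega>) * inner g h))
      \<le> C * \<bar>exp (F \<omega>) * W h \<omega>\<bar> + C * \<bar>exp (F \<omega>) * inner (DF \<omega>) h\<bar> + C * \<bar>exp (F \<omega>) * inner g h\<bar>" for n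
    proof (rule AE_I2)
      fix \<omega>
      note b = exp_cutoff_bounds[of "real (Suc n)" "F \<omega>"]
      have "\<bar>exp_cutoff (real (Suc n)) (F \<omega>) * \<phi> (W g \<omega>) * W h \<omega>\<bar> \<le> C * \<bar>exp (F \<omega>) * W h \<omega>\<bar>"
        using b \<phi>b by (intro bi1) auto
      moreover have "\<bar>exp_cutoff' (real (Suc n)) (F \<omega>) * \<phi> (W g \<omega>) * inner (DF \<omega>) h\<bar> \<le> C * \<bar>exp (F \<omega>) * inner (DF \<omega>) h\<bar>"
        using b \<phi>b by (intro bi1) auto
      moreover have "\<bar>exp_cutoff (real (Suc n)) (F \<omega>) * \<phi>' (W g \<omega>) * inner g h\<bar> \<le> C * \<bar>exp (F \<omega>) * inner g h\<bar>"
        using b \<phi>b by (intro bi1) auto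
      moreover have "exp_cutoff' (real (Suc n)) (F \<omega>) * inner (DF \<omega>) h * \<phi> (W g \<omega>) = exp_cutoff' (real (Suc n)) (F \<omega>) * \<phi> (W g \<omega>) * inner (DF \<omega>) h"
        by simp
      ultimately show "norm (exp_cutoff (real (Suc n)) (F \<omega>) * \<phi> (W g \<omega>) * W h \<omega> - (exp_cutoff' (real (Suc n)) (F \<omega>) * inner (DF \<omega>) h * \<phi> (W g \<omega>)
           + exp_cutoff (real (Suc n)) (F \<omega>) * \<phi>' (W g \<omega>) * inner g h))
        \<le> C * \<bar>exp (F \<omega>) * W h \<omega>\<bar> + C * \<bar>exp (F \<omega>) * inner (DF \<omega>) h\<bar> + C * \<bar>exp (F \<omega>) * inner g h\<bar>"
        unfolding real_norm_def by linarith
    qed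
  qed measurable
  then have L0: "(\<integral>\<omega>. ?L \<omega> \<partial>M) = 0" unfolding z by (simp add: tendsto_const_iff)
  have j: "integrable M (\<lambda>\<omega>. e \<omega> * p (W g \<omega>))"
    if "integrable M e" "p \<in> borel_measurable borel" "\<And>x. \<bar>p x\<bar> \<le> C" for e and p :: "real \<Rightarrow> real"
    by (rule Bochner_Integration.integrable_bound[OF integrable_mult_right[OF that(1), of C]])
       (use that C0 in \<open>auto simp: abs_mult mult.commute[of C] intro!: mult_left_mono\<close>)
  have j1: "integrable M (\<lambda>\<omega>. exp (F \<omega>) * W h \<omega> * \<phi> (W g \<omega>))" using i1 \<phi>b by (intro j) auto
  have j2: "integrable M (\<lambda>\<omega>. exp (F \<omega>) * inner (DF \<omega>) h * \<phi> (W g \<omega>))" using i2 \<phi>b by (intro j) auto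
  have j3: "integrable M (\<lambda>\<omega>. exp (F \<omega>) * \<phi>' (W g \<omega>))" using i0 \<phi>b by (intro j) auto
  have "(\<integral>\<omega>. ?L \<omega> \<partial>M) = (\<integral>\<omega>. (exp (F \<omega>) * W h \<omega> * \<phi> (W g \<omega>) - exp (F \<omega>) * inner (DF \<omega>) h * \<phi> (W g \<omega>)) - exp (F \<omega>) * \<phi>' (W g \<omega>) * inner g h \<partial>M)"
    by (rule Bochner_Integration.integral_cong) (auto simp: algebra_simps)
  also have "\<dots> = (\<integral>\<omega>. exp (F \<omega>) * W h \<omega> * \<phi> (W g \<omega>) - exp (F \<omega>) * inner (DF \<omega>) h * \<phi> (W g \<omega>) \<partial>M) - (\<integral>\<omega>. exp (F \<omega>) * \<phi>' (W g \<omega>) \<partial>M) * inner g h"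
    by (subst Bochner_Integration.integral_diff) (use j1 j2 j3 in auto)
  also have "(\<integral>\<omega>. exp (F \<omega>) * W h \<omega> * \<phi> (W g \<omega>) - exp (F \<omega>) * inner (DF \<omega>) h * \<phi> (W g \<omega>) \<partial>M)
     = (\<integral>\<omega>. exp (F \<omega>) * (\<phi> (W g \<omega>) * (W h \<omega> - inner (DF \<omega>) h)) \<partial>M)"
    by (rule Bochner_Integration.integral_cong) (auto simp: algebra_simps)
  finally show ?thesis using L0 by (simp add: mult.commute)
qed

text \<open>The exponential formula with exponent 0, which is a cylindrical variable in no
  coordinates with derivative 0.\<close>

lemma integration_by_parts_W:
  assumes \<phi>: "\<And>x. (\<phi> has_real_derivative \<phi>' x) (at x)" "continuous_on UNIV \<phi>'"
    and \<phi>b: "\<And>x. \<bar>\<phi> x\<bar> \<le> C" "\<And>x. \<bar>\<phi>' x\<bar> \<le> C"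
  shows "(\<integral>\<omega>. \<phi> (W g \<omega>) * W h \<omega> \<partial>M) = inner g h * (\<integral>\<omega>. \<phi>' (W g \<omega>) \<partial>M)"
proof -
  have c: "smooth_poly_growth 0 (\<lambda>_. 0)"
    unfolding smooth_poly_growth_def by (auto intro!: exI[of _ 0])
  have "smooth_cylindrical W (\<lambda>_. 0) (\<lambda>_. 0)"
    unfolding smooth_cylindrical_def by (rule exI[of _ 0], rule exI[of _ "\<lambda>_. 0"], use c in auto)
  then have "has_malliavin_derivative M W (\<lambda>_. 0) (\<lambda>_. 0)"
    unfolding has_malliavin_derivative_def L2_tendsto_def
    by (intro exI[of _ "\<lambda>_ _. 0"]) (auto simp: L2_def)
  from integration_by_parts_exp[OF this _ _ _ \<phi> \<phi>b, of h g] show ?thesis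
    using L2_integrable[OF W_L2] by simp
qed

end


section \<open>Conditional expectations and convergence in mean square\<close>

text \<open>The two moments are the real and imaginary parts of the weighted Fourier transform, and
  the sets of the generated field are preimages of Borel sets, so Fourier uniqueness
  applies.\<close>

lemma trig_moments_eq_0_imp_set_integral_eq_0:
  fixes X Y :: "'a \<Rightarrow> real"
  assumes X[measurable]: "X \<in> borel_measurable M" and Y: "integrable M Y"
    and c: "\<And>s. (\<integral>\<omega>. cos (s * X \<omega>) * Y \<omega> \<partial>M) = 0" and s: "\<And>s. (\<integral>\<omega>. sin (s * X \<omega>) * Y \<omega> \<partial>M) = 0"
    and A: "A \<in> sets (sigma_rv M X)"
  shows "(\<integral>\<omega>\<in>A. Y \<omega> \<partial>M) = 0"
proof -
  have [measurable]: "Y \<in> borel_measurable M" using Y by auto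
  obtain B where B: "B \<in> sets borel" and AB: "A = X -` B \<inter> space M"
    using A unfolding sigma_rv_def by (subst (asm) sets_vimage_algebra2) auto
  have "(\<integral>\<omega>. indicat_real B (X \<omega>) * Y \<omega> \<partial>M) = 0"
  proof (rule integral_weighted_indicator_eq_0_real[OF X Y _ B])
    fix r
    have i: "integrable M (\<lambda>\<omega>. iexp (r * X \<omega>) * complex_of_real (Y \<omega>))"
      by (rule Bochner_Integration.integrable_bound[OF Y]) (auto simp: norm_mult)
    show "(\<integral>\<omega>. iexp (r * X \<omega>) * complex_of_real (Y \<omega>) \<partial>M) = 0"
      unfolding complex_eq_iff integral_Re[OF i, symmetric] integral_Im[OF i, symmetric]
      using c[of r] s[of r] by (simp add: Re_exp Im_exp)
  qed
  moreover have "(\<integral>\<omega>\<in>A. Y \<omega> \<partial>M) = (\<integral>\<omega>. indicat_real B (X \<omega>) * Y \<omega> \<partial>M)"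
    unfolding set_lebesgue_integral_def AB by (rule Bochner_Integration.integral_cong) (auto simp: indicator_def)
  ultimately show ?thesis by simp
qed

lemma L2_cong_AE:
  fixes X Y :: "'a \<Rightarrow> real"
  assumes "X \<in> L2 M" "Y \<in> borel_measurable M" "AE \<omega> in M. X \<omega> = Y \<omega>"
  shows "Y \<in> L2 M"
proof -
  have "integrable M (\<lambda>\<omega>. (X \<omega>)\<^sup>2)" using assms by (simp add: L2_iff_real)
  then have "integrable M (\<lambda>\<omega>. (Y \<omega>)\<^sup>2)"
    by (rule Bochner_Integration.integrable_cong_AE_imp) (use assms in \<open>auto elim: eventually_mono\<close>)
  then show ?thesis using assms by (simp add: L2_iff_real)
qed

lemma L2_tendsto_cong_AE:
  fixes X X' :: "'i \<Rightarrow> 'a \<Rightarrow> real"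
  assumes X: "L2_tendsto M X Y F" and X': "\<forall>\<^sub>F i in F. X' i \<in> borel_measurable M \<and> (AE \<omega> in M. X i \<omega> = X' i \<omega>)"
    and Y': "Y' \<in> borel_measurable M" "AE \<omega> in M. Y \<omega> = Y' \<omega>"
  shows "L2_tendsto M X' Y' F"
proof -
  have Y: "Y \<in> L2 M" and XL2: "\<forall>\<^sub>F i in F. X i \<in> L2 M" using X by (auto simp: L2_tendsto_def)
  have Y'L2: "Y' \<in> L2 M" using L2_cong_AE[OF Y Y'] .
  have ev: "\<forall>\<^sub>F i in F. X' i \<in> L2 M"
    using XL2 X' by eventually_elim (use L2_cong_AE in blast)
  have "\<forall>\<^sub>F i in F. (\<integral>\<omega>. (norm (X i \<omega> - Y \<omega>))\<^sup>2 \<partial>M) = (\<integral>\<omega>. (norm (X' i \<omega> - Y' \<omega>))\<^sup>2 \<partial>M)"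
    using XL2 X' ev
  proof eventually_elim
    case (elim i)
    show ?case
    proof (rule integral_cong_AE)
      show "AE \<omega> in M. (norm (X i \<omega> - Y \<omega>))\<^sup>2 = (norm (X' i \<omega> - Y' \<omega>))\<^sup>2"
        using elim(2)[THEN conjunct2] Y'(2) by eventually_elim simp
    qed (use elim Y Y'L2 in \<open>auto dest!: L2_measurable\<close>)
  qed
  then show ?thesis using X ev Y'L2 by (simp add: L2_tendsto_def tendsto_cong)
qed

lemma L2_tendsto_add:
  fixes X X' :: "'i \<Rightarrow> 'a \<Rightarrow> real"
  assumes "L2_tendsto M X Y F" "L2_tendsto M X' Y' F"
  shows "L2_tendsto M (\<lambda>i \<omega>. X i \<omega> + X' i \<omega>) (\<lambda>\<omega>. Y \<omega> + Y' \<omega>) F"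
proof -
  have Y: "Y \<in> L2 M" "Y' \<in> L2 M" and X: "\<forall>\<^sub>F i in F. X i \<in> L2 M \<and> X' i \<in> L2 M"
    using assms by (auto simp: L2_tendsto_def eventually_conj_iff)
  have l: "((\<lambda>i. 2 * (\<integral>\<omega>. (norm (X i \<omega> - Y \<omega>))\<^sup>2 \<partial>M) + 2 * (\<integral>\<omega>. (norm (X' i \<omega> - Y' \<omega>))\<^sup>2 \<partial>M)) \<longlongrightarrow> 2 * 0 + 2 * 0) F"
    using assms by (intro tendsto_intros) (auto simp: L2_tendsto_def)
  have "((\<lambda>i. \<integral>\<omega>. (norm (X i \<omega> + X' i \<omega> - (Y \<omega> + Y' \<omega>)))\<^sup>2 \<partial>M) \<longlongrightarrow> 0) F"
  proof (rule Lim_null_comparison)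
    show "((\<lambda>i. 2 * (\<integral>\<omega>. (norm (X i \<omega> - Y \<omega>))\<^sup>2 \<partial>M) + 2 * (\<integral>\<omega>. (norm (X' i \<omega> - Y' \<omega>))\<^sup>2 \<partial>M)) \<longlongrightarrow> 0) F"
      using l by simp
    show "\<forall>\<^sub>F i in F. norm (\<integral>\<omega>. (norm (X i \<omega> + X' i \<omega> - (Y \<omega> + Y' \<omega>)))\<^sup>2 \<partial>M)
       \<le> 2 * (\<integral>\<omega>. (norm (X i \<omega> - Y \<omega>))\<^sup>2 \<partial>M) + 2 * (\<integral>\<omega>. (norm (X' i \<omega> - Y' \<omega>))\<^sup>2 \<partial>M)"
      using X
    proof eventually_elim
      case (elim i)
      have d: "(\<lambda>\<omega>. X i \<omega> - Y \<omega>) \<in> L2 M" "(\<lambda>\<omega>. X' i \<omega> - Y' \<omega>) \<in> L2 M" using elim Y by (auto intro: L2_diff)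
      have s: "(\<lambda>\<omega>. X i \<omega> + X' i \<omega> - (Y \<omega> + Y' \<omega>)) \<in> L2 M" using elim Y by (intro L2_diff L2_add) auto
      have "(\<integral>\<omega>. (norm (X i \<omega> + X' i \<omega> - (Y \<omega> + Y' \<omega>)))\<^sup>2 \<partial>M)
        \<le> (\<integral>\<omega>. 2 * (norm (X i \<omega> - Y \<omega>))\<^sup>2 + 2 * (norm (X' i \<omega> - Y' \<omega>))\<^sup>2 \<partial>M)"
      proof (rule integral_mono)
        fix \<omega>
        have "(a + b)\<^sup>2 \<le> 2 * a\<^sup>2 + 2 * b\<^sup>2" for a b :: real using sum_squares_bound[of a b] by (simp add: power2_sum)
        from this[of "X i \<omega> - Y \<omega>" "X' i \<omega> - Y' \<omega>"]
        show "(norm (X i \<omega> + X' i \<omega> - (Y \<omega> + Y' \<omega>)))\<^sup>2 \<le> 2 * (norm (X i \<omega> - Y \<omega>))\<^sup>2 + 2 * (norm (X' i \<omega> - Y' \<omega>))\<^sup>2"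
          by (simp add: algebra_simps)
      qed (use d s in \<open>auto simp: L2_iff_real\<close>)
      then show ?case using d by (simp add: L2_iff_real)
    qed
  qed
  moreover have "\<forall>\<^sub>F i in F. (\<lambda>\<omega>. X i \<omega> + X' i \<omega>) \<in> L2 M" using X by eventually_elim (auto intro: L2_add)
  ultimately show ?thesis using Y by (simp add: L2_tendsto_def L2_add)
qed

lemma L2_tendsto_uminus:
  fixes X :: "'i \<Rightarrow> 'a \<Rightarrow> real"
  assumes "L2_tendsto M X Y F"
  shows "L2_tendsto M (\<lambda>i \<omega>. - X i \<omega>) (\<lambda>\<omega>. - Y \<omega>) F"
proof -
  have "(\<bar>y - x\<bar>)\<^sup>2 = (x - y)\<^sup>2" for x y :: real by (simp add: power2_commute)
  then show ?thesis using assms by (simp add: L2_tendsto_def L2_iff_real)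
qed

lemma L2_tendsto_diff:
  fixes X X' :: "'i \<Rightarrow> 'a \<Rightarrow> real"
  assumes "L2_tendsto M X Y F" "L2_tendsto M X' Y' F"
  shows "L2_tendsto M (\<lambda>i \<omega>. X i \<omega> - X' i \<omega>) (\<lambda>\<omega>. Y \<omega> - Y' \<omega>) F"
  using L2_tendsto_add[OF assms(1) L2_tendsto_uminus[OF assms(2)]] by simp

lemma L2_tendsto_unique:
  fixes X :: "'i \<Rightarrow> 'a \<Rightarrow> real"
  assumes "L2_tendsto M X Y F" "L2_tendsto M X Y' F" and "F \<noteq> bot"
  shows "AE \<omega> in M. Y \<omega> = Y' \<omega>"
proof -
  have "L2_tendsto M (\<lambda>i \<omega>. X i \<omega> - X i \<omega>) (\<lambda>\<omega>. Y \<omega> - Y' \<omega>) F" by (rule L2_tendsto_diff[OF assms(1,2)])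
  then have i: "integrable M (\<lambda>\<omega>. (Y \<omega> - Y' \<omega>)\<^sup>2)" and "((\<lambda>i::'i. \<integral>\<omega>. (Y \<omega> - Y' \<omega>)\<^sup>2 \<partial>M) \<longlongrightarrow> 0) F"
    by (auto simp: L2_tendsto_def L2_iff_real power2_commute)
  then have "(\<integral>\<omega>. (Y \<omega> - Y' \<omega>)\<^sup>2 \<partial>M) = 0" using assms(3) by (simp add: tendsto_const_iff)
  then have "AE \<omega> in M. (Y \<omega> - Y' \<omega>)\<^sup>2 = 0" using integral_nonneg_eq_0_iff_AE[OF i] by simp
  then show ?thesis by eventually_elim simp
qed

text \<open>Dividing by a nonzero \<open>a\<close> would make \<open>m\<close> square integrable.
  This is the dichotomy that handles a merely integrable \<open>m\<close>.\<close>

lemma L2_mult_imp_eq_0: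
  fixes m :: "'a \<Rightarrow> real"
  assumes "(\<lambda>\<omega>. a * m \<omega>) \<in> L2 M" "m \<notin> L2 M"
  shows "a = 0"
  using L2_mult_left[OF assms(1), of "1 / a"] assms(2) by (cases "a = 0") auto

text \<open>The factor \<open>m\<close> need not be square integrable: if it is not, then \<open>a\<close> vanishes eventually.\<close>

lemma L2_tendsto_scaled:
  fixes m :: "'a \<Rightarrow> real"
  assumes a: "(a \<longlongrightarrow> c) F" and m: "m \<in> borel_measurable M" and L2: "\<forall>\<^sub>F i in F. (\<lambda>\<omega>. a i * m \<omega>) \<in> L2 M"
    and "F \<noteq> bot"
  shows "L2_tendsto M (\<lambda>i \<omega>. a i * m \<omega>) (\<lambda>\<omega>. c * m \<omega>) F"
proof (cases "m \<in> L2 M")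
  case True
  have "((\<lambda>i. (a i - c)\<^sup>2 * (\<integral>\<omega>. (m \<omega>)\<^sup>2 \<partial>M)) \<longlongrightarrow> (c - c)\<^sup>2 * (\<integral>\<omega>. (m \<omega>)\<^sup>2 \<partial>M)) F"
    by (intro tendsto_intros a)
  then have "((\<lambda>i. \<integral>\<omega>. (norm (a i * m \<omega> - c * m \<omega>))\<^sup>2 \<partial>M) \<longlongrightarrow> 0) F"
    by (simp add: left_diff_distrib[symmetric] power_mult_distrib)
  then show ?thesis using L2 L2_mult_left[OF True] by (simp add: L2_tendsto_def)
next
  case False
  have ev: "\<forall>\<^sub>F i in F. a i = 0"
    using L2 by eventually_elim (rule L2_mult_imp_eq_0[OF _ False])
  then have "c = 0" using tendsto_unique[OF assms(4) a] tendsto_eventually by blast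
  then show ?thesis
    using ev by (auto simp: L2_tendsto_def L2_def elim!: eventually_mono intro!: tendsto_eventually)
qed

text \<open>Pairing with \<open>m\<close> recovers the coefficient: the mean of
  \<open>a i * m * m\<close> is \<open>a i\<close> times the nonzero second moment of
  \<open>m\<close>, and it converges to the mean of \<open>V * m\<close>. If \<open>m\<close> is not
  square integrable, then \<open>a\<close> is eventually 0.\<close>

lemma L2_tendsto_scaled_imp_convergent:
  fixes m :: "'a \<Rightarrow> real"
  assumes lim: "L2_tendsto M (\<lambda>i \<omega>. a i * m \<omega>) V F" and m: "m \<in> borel_measurable M" and m0: "\<not> (AE \<omega> in M. m \<omega> = 0)"
  shows "\<exists>c. (a \<longlongrightarrow> c) F"
proof (cases "m \<in> L2 M")
  case True
  let ?q = "\<integral>\<omega>. (m \<omega>)\<^sup>2 \<partial>M"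
  have V: "V \<in> L2 M" and L2: "\<forall>\<^sub>F i in F. (\<lambda>\<omega>. a i * m \<omega>) \<in> L2 M" using lim by (auto simp: L2_tendsto_def)
  have q: "?q \<noteq> 0"
  proof
    assume "?q = 0"
    then have "AE \<omega> in M. (m \<omega>)\<^sup>2 = 0" using True integral_nonneg_eq_0_iff_AE[of M "\<lambda>\<omega>. (m \<omega>)\<^sup>2"] by (simp add: L2_iff_real)
    then show False using m0 by simp
  qed
  have iVm: "integrable M (\<lambda>\<omega>. V \<omega> * m \<omega>)" by (rule L2_mult_integrable[OF V True])
  have "((\<lambda>i. \<integral>\<omega>. \<bar>(a i * m \<omega> - V \<omega>) * m \<omega>\<bar> \<partial>M) \<longlongrightarrow> 0) F"
  proof (rule L2_tendsto_0_mult[OF _ _ True])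
    show "\<forall>\<^sub>F i in F. (\<lambda>\<omega>. a i * m \<omega> - V \<omega>) \<in> L2 M" using L2 by eventually_elim (rule L2_diff[OF _ V])
    show "((\<lambda>i. \<integral>\<omega>. (a i * m \<omega> - V \<omega>)\<^sup>2 \<partial>M) \<longlongrightarrow> 0) F" using lim by (simp add: L2_tendsto_def)
  qed
  then have "((\<lambda>i. a i * ?q - (\<integral>\<omega>. V \<omega> * m \<omega> \<partial>M)) \<longlongrightarrow> 0) F"
  proof (rule Lim_null_comparison[rotated], intro always_eventually allI)
    fix i
    have "a i * ?q - (\<integral>\<omega>. V \<omega> * m \<omega> \<partial>M) = (\<integral>\<omega>. a i * (m \<omega>)\<^sup>2 - V \<omega> * m \<omega> \<partial>M)"
      using iVm True by (simp add: L2_iff_real)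
    also have "\<dots> = (\<integral>\<omega>. (a i * m \<omega> - V \<omega>) * m \<omega> \<partial>M)"
      by (rule Bochner_Integration.integral_cong) (auto simp: algebra_simps power2_eq_square)
    finally have "a i * ?q - (\<integral>\<omega>. V \<omega> * m \<omega> \<partial>M) = (\<integral>\<omega>. (a i * m \<omega> - V \<omega>) * m \<omega> \<partial>M)" .
    then show "norm (a i * ?q - (\<integral>\<omega>. V \<omega> * m \<omega> \<partial>M)) \<le> (\<integral>\<omega>. \<bar>(a i * m \<omega> - V \<omega>) * m \<omega>\<bar> \<partial>M)"
      using integral_norm_bound[of M "\<lambda>\<omega>. (a i * m \<omega> - V \<omega>) * m \<omega>"] by simp
  qed
  then have "((\<lambda>i. a i * ?q) \<longlongrightarrow> (\<integral>\<omega>. V \<omega> * m \<omega> \<partial>M)) F" by (simp add: LIM_zero_iff)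
  then have "((\<lambda>i. a i * ?q / ?q) \<longlongrightarrow> (\<integral>\<omega>. V \<omega> * m \<omega> \<partial>M) / ?q) F" by (intro tendsto_divide tendsto_const q)
  then show ?thesis using q by auto
next
  case False
  have "\<forall>\<^sub>F i in F. (\<lambda>\<omega>. a i * m \<omega>) \<in> L2 M" using lim by (simp add: L2_tendsto_def)
  then have "\<forall>\<^sub>F i in F. a i = 0" by eventually_elim (rule L2_mult_imp_eq_0[OF _ False])
  then show ?thesis by (intro exI[of _ 0] tendsto_eventually)
qed

context finite_measure begin

text \<open>Conditional Jensen for the square: conditioning is a contraction in mean square and
  hence preserves convergence there.\<close>

lemma L2_real_cond_exp:
  assumes H: "subalgebra M H" and X: "X \<in> L2 M"
  shows "real_cond_exp M H X \<in> L2 M" "(\<integral>\<omega>. (real_cond_exp M H X \<omega>)\<^sup>2 \<partial>M) \<le> (\<integral>\<omega>. (X \<omega>)\<^sup>2 \<partial>M)"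
proof -
  interpret F: finite_measure_subalgebra M H by standard (rule H)
  have i: "integrable M (\<lambda>\<omega>. (X \<omega>)\<^sup>2)" using X by (simp add: L2_iff_real)
  have le: "AE \<omega> in M. (real_cond_exp M H X \<omega>)\<^sup>2 \<le> real_cond_exp M H (\<lambda>\<omega>. (X \<omega>)\<^sup>2) \<omega>"
    by (rule F.real_cond_exp_jensens_inequality(2)[where I=UNIV])
       (use i L2_integrable[OF X] convex_power2 in auto)
  have i2: "integrable M (real_cond_exp M H (\<lambda>\<omega>. (X \<omega>)\<^sup>2))" using F.real_cond_exp_int(1)[OF i] .
  have i3: "integrable M (\<lambda>\<omega>. (real_cond_exp M H X \<omega>)\<^sup>2)"
    by (rule Bochner_Integration.integrable_bound[OF i2]) (use le in \<open>auto elim!: eventually_mono\<close>)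
  then show "real_cond_exp M H X \<in> L2 M" by (simp add: L2_iff_real)
  have "(\<integral>\<omega>. (real_cond_exp M H X \<omega>)\<^sup>2 \<partial>M) \<le> (\<integral>\<omega>. real_cond_exp M H (\<lambda>\<omega>. (X \<omega>)\<^sup>2) \<omega> \<partial>M)"
    by (rule integral_mono_AE[OF i3 i2 le])
  also have "\<dots> = (\<integral>\<omega>. (X \<omega>)\<^sup>2 \<partial>M)" using F.real_cond_exp_int(2)[OF i] .
  finally show "(\<integral>\<omega>. (real_cond_exp M H X \<omega>)\<^sup>2 \<partial>M) \<le> (\<integral>\<omega>. (X \<omega>)\<^sup>2 \<partial>M)" .
qed

lemma L2_tendsto_real_cond_exp:
  fixes X :: "'i \<Rightarrow> 'a \<Rightarrow> real"
  assumes H: "subalgebra M H" and X: "L2_tendsto M X Y F"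
  shows "L2_tendsto M (\<lambda>i. real_cond_exp M H (X i)) (real_cond_exp M H Y) F"
proof -
  interpret F: finite_measure_subalgebra M H by standard (rule H)
  have Y: "Y \<in> L2 M" and ev: "\<forall>\<^sub>F i in F. X i \<in> L2 M"
    and lim: "((\<lambda>i. \<integral>\<omega>. (norm (X i \<omega> - Y \<omega>))\<^sup>2 \<partial>M) \<longlongrightarrow> 0) F"
    using X by (auto simp: L2_tendsto_def)
  have "((\<lambda>i. \<integral>\<omega>. (norm (real_cond_exp M H (X i) \<omega> - real_cond_exp M H Y \<omega>))\<^sup>2 \<partial>M) \<longlongrightarrow> 0) F"
  proof (rule Lim_null_comparison[OF _ lim])
    show "\<forall>\<^sub>F i in F. norm (\<integral>\<omega>. (norm (real_cond_exp M H (X i) \<omega> - real_cond_exp M H Y \<omega>))\<^sup>2 \<partial>M) \<le> (\<integral>\<omega>. (norm (X i \<omega> - Y \<omega>))\<^sup>2 \<partial>M)"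
      using ev
    proof eventually_elim
      case (elim i)
      have "AE \<omega> in M. real_cond_exp M H (\<lambda>\<omega>. X i \<omega> - Y \<omega>) \<omega> = real_cond_exp M H (X i) \<omega> - real_cond_exp M H Y \<omega>"
        by (rule F.real_cond_exp_diff) (use elim Y L2_integrable in auto)
      then have "(\<integral>\<omega>. (norm (real_cond_exp M H (X i) \<omega> - real_cond_exp M H Y \<omega>))\<^sup>2 \<partial>M) = (\<integral>\<omega>. (real_cond_exp M H (\<lambda>\<omega>. X i \<omega> - Y \<omega>) \<omega>)\<^sup>2 \<partial>M)"
        by (intro integral_cong_AE) (auto elim!: eventually_mono)
      then show ?case using L2_real_cond_exp(2)[OF H L2_diff[OF elim Y]] by simp
    qed
  qed
  moreover have "\<forall>\<^sub>F i in F. real_cond_exp M H (X i) \<in> L2 M" using ev by eventually_elim (rule L2_real_cond_exp(1)[OF H])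
  ultimately show ?thesis using L2_real_cond_exp(1)[OF H Y] by (simp add: L2_tendsto_def)
qed

lemma has_L2_derivative_unique:
  assumes "has_L2_derivative M H Z t Y" "has_L2_derivative M H Z t Y'"
  shows "AE \<omega> in M. Y \<omega> = Y' \<omega>"
  using assms by (auto simp: has_L2_derivative_def intro: L2_tendsto_unique)

lemma L2_derivative_eq:
  assumes "has_L2_derivative M H Z t Y"
  shows "AE \<omega> in M. L2_derivative M H Z t \<omega> = Y \<omega>"
  unfolding L2_derivative_def by (rule has_L2_derivative_unique[OF someI[of "has_L2_derivative M H Z t"] assms]) (rule assms)

text \<open>Conditioning the identity \<open>eq\<close> gives \<open>a h * m + n h\<close> for the
  conditioned difference quotient, where \<open>n h\<close> converges by contraction. What remains
  is the convergence of \<open>a h * m\<close>. Stating the identity through integrals over the sets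
  of \<open>H\<close> lets it be restricted to smaller fields, and leaving \<open>m0\<close> and
  \<open>N\<close> abstract lets it serve both measures.\<close>

lemma has_L2_derivative_decomposition:
  fixes N :: "real \<Rightarrow> 'a \<Rightarrow> real"
  assumes H: "subalgebra M H"
    and \<Delta>: "\<forall>\<^sub>F h in at 0. (\<lambda>\<omega>. (Z (t + h) \<omega> - Z t \<omega>) / h) \<in> L2 M"
    and N: "L2_tendsto M N N0 (at 0)" and m0: "integrable M m0"
    and eq: "\<forall>\<^sub>F h in at 0. \<forall>A\<in>sets H. (\<integral>\<omega>\<in>A. (Z (t + h) \<omega> - Z t \<omega>) / h - a h * m0 \<omega> - N h \<omega> \<partial>M) = 0"
  shows "(a \<longlongrightarrow> c) (at 0) \<Longrightarrow> has_L2_derivative M H Z t (\<lambda>\<omega>. c * real_cond_exp M H m0 \<omega> + real_cond_exp M H N0 \<omega>)"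
    and "AE \<omega> in M. real_cond_exp M H m0 \<omega> = 0 \<Longrightarrow> has_L2_derivative M H Z t (real_cond_exp M H N0)"
    and "L2_differentiates M H Z t \<Longrightarrow> \<not> (AE \<omega> in M. real_cond_exp M H m0 \<omega> = 0) \<Longrightarrow> \<exists>c. (a \<longlongrightarrow> c) (at 0)"
proof -
  interpret F: finite_measure_subalgebra M H by standard (rule H)
  define D where "D = (\<lambda>h. real_cond_exp M H (\<lambda>\<omega>. (Z (t + h) \<omega> - Z t \<omega>) / h))"
  define m n n0 where "m = real_cond_exp M H m0" and "n = (\<lambda>h. real_cond_exp M H (N h))" and "n0 = real_cond_exp M H N0"
  have nlim: "L2_tendsto M n n0 (at 0)" unfolding n_def n0_def by (rule L2_tendsto_real_cond_exp[OF H N])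
  have [measurable]: "m \<in> borel_measurable M" "n h \<in> borel_measurable M" "n0 \<in> borel_measurable M" "D h \<in> borel_measurable M" for h
    by (auto simp: m_def n_def n0_def D_def)
  have NL2: "\<forall>\<^sub>F h in at 0. N h \<in> L2 M" and nL2: "\<forall>\<^sub>F h in at 0. n h \<in> L2 M" using N nlim by (auto simp: L2_tendsto_def)
  have DL2: "\<forall>\<^sub>F h in at 0. D h \<in> L2 M"
    using \<Delta> unfolding D_def by eventually_elim (rule L2_real_cond_exp(1)[OF H])
  have Deq: "\<forall>\<^sub>F h in at 0. AE \<omega> in M. D h \<omega> = a h * m \<omega> + n h \<omega>"
    using \<Delta> NL2 eq
  proof eventually_elim
    case (elim h)
    let ?D = "\<lambda>\<omega>. (Z (t + h) \<omega> - Z t \<omega>) / h"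
    have i: "integrable M ?D" "integrable M (N h)" using elim L2_integrable by blast+
    have i': "integrable M (\<lambda>\<omega>. a h * m0 \<omega>)" using m0 by simp
    have "AE \<omega> in M. real_cond_exp M H (\<lambda>\<omega>. ?D \<omega> - a h * m0 \<omega> - N h \<omega>) \<omega> = 0"
      by (rule F.real_cond_exp_charact) (use elim i i' in auto)
    moreover have "AE \<omega> in M. real_cond_exp M H (\<lambda>\<omega>. ?D \<omega> - a h * m0 \<omega> - N h \<omega>) \<omega> = real_cond_exp M H (\<lambda>\<omega>. ?D \<omega> - a h * m0 \<omega>) \<omega> - n h \<omega>"
      unfolding n_def by (rule F.real_cond_exp_diff) (use i i' in auto)
    moreover have "AE \<omega> in M. real_cond_exp M H (\<lambda>\<omega>. ?D \<omega> - a h * m0 \<omega>) \<omega> = D h \<omega> - real_cond_exp M H (\<lambda>\<omega>. a h * m0 \<omega>) \<omega>"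
      unfolding D_def by (rule F.real_cond_exp_diff) (use i i' in auto)
    moreover have "AE \<omega> in M. real_cond_exp M H (\<lambda>\<omega>. a h * m0 \<omega>) \<omega> = a h * m \<omega>"
      unfolding m_def by (rule F.real_cond_exp_cmult[OF m0])
    ultimately show ?case by eventually_elim simp
  qed
  \<comment> \<open>The product is square integrable as a difference of two such variables, although
    \<open>m\<close> itself may fail to be; this is the form in which the scaling lemmas need
    it.\<close>
  have amL2: "\<forall>\<^sub>F h in at 0. (\<lambda>\<omega>. a h * m \<omega>) \<in> L2 M"
    using DL2 nL2 Deq
  proof eventually_elim
    case (elim h)
    show ?case
      by (rule L2_cong_AE[OF L2_diff[OF elim(1,2)]]) (use elim(3) in \<open>auto elim!: eventually_mono\<close>)
  qed
  {
    assume a: "(a \<longlongrightarrow> c) (at 0)"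
    have "L2_tendsto M (\<lambda>h \<omega>. a h * m \<omega>) (\<lambda>\<omega>. c * m \<omega>) (at 0)"
      by (rule L2_tendsto_scaled[OF a _ amL2]) auto
    from L2_tendsto_add[OF this nlim]
    have "L2_tendsto M D (\<lambda>\<omega>. c * m \<omega> + n0 \<omega>) (at 0)"
    proof (rule L2_tendsto_cong_AE)
      show "\<forall>\<^sub>F h in at 0. D h \<in> borel_measurable M \<and> (AE \<omega> in M. a h * m \<omega> + n h \<omega> = D h \<omega>)"
        using Deq by eventually_elim (auto elim!: eventually_mono)
    qed auto
    then show "has_L2_derivative M H Z t (\<lambda>\<omega>. c * real_cond_exp M H m0 \<omega> + real_cond_exp M H N0 \<omega>)"
      using H by (simp add: has_L2_derivative_def D_def m_def n0_def)
  }
  {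
    assume "AE \<omega> in M. real_cond_exp M H m0 \<omega> = 0"
    then have z: "AE \<omega> in M. m \<omega> = 0" by (simp add: m_def)
    from nlim have "L2_tendsto M D n0 (at 0)"
    proof (rule L2_tendsto_cong_AE)
      show "\<forall>\<^sub>F h in at 0. D h \<in> borel_measurable M \<and> (AE \<omega> in M. n h \<omega> = D h \<omega>)"
        using Deq
      proof eventually_elim
        case (elim h)
        have "AE \<omega> in M. n h \<omega> = D h \<omega>" using elim z by eventually_elim simp
        then show ?case by simp
      qed
    qed auto
    then show "has_L2_derivative M H Z t (real_cond_exp M H N0)"
      using H by (simp add: has_L2_derivative_def D_def n0_def)
  }
  {
    assume "L2_differentiates M H Z t" and nz: "\<not> (AE \<omega> in M. real_cond_exp M H m0 \<omega> = 0)"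
    then obtain Y where "L2_tendsto M D Y (at 0)"
      by (auto simp: L2_differentiates_def has_L2_derivative_def D_def)
    then have Y: "L2_tendsto M (\<lambda>h \<omega>. D h \<omega> - n h \<omega>) (\<lambda>\<omega>. Y \<omega> - n0 \<omega>) (at 0)" by (rule L2_tendsto_diff[OF _ nlim])
    have Ym: "(\<lambda>\<omega>. Y \<omega> - n0 \<omega>) \<in> borel_measurable M" using Y by (simp add: L2_tendsto_def L2_iff_real)
    from Y have "L2_tendsto M (\<lambda>h \<omega>. a h * m \<omega>) (\<lambda>\<omega>. Y \<omega> - n0 \<omega>) (at 0)"
    proof (rule L2_tendsto_cong_AE)
      show "\<forall>\<^sub>F h in at 0. (\<lambda>\<omega>. a h * m \<omega>) \<in> borel_measurable M \<and> (AE \<omega> in M. D h \<omega> - n h \<omega> = a h * m \<omega>)"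
        using Deq
      proof eventually_elim
        case (elim h)
        have "AE \<omega> in M. D h \<omega> - n h \<omega> = a h * m \<omega>" using elim by eventually_elim simp
        then show ?case by simp
      qed
    qed (use Ym in auto)
    then show "\<exists>c. (a \<longlongrightarrow> c) (at 0)"
      by (rule L2_tendsto_scaled_imp_convergent) (use nz in \<open>auto simp: m_def\<close>)
  }
qed

end


section \<open>Stochastic derivatives under both measures\<close>

text \<open>Writing the exponent through the second moment puts the degenerate law and the scaled
  standard normal law under one formula, which can then be expressed by the norm in the Hilbert
  space.\<close>

lemma (in prob_space) centered_gaussian_char:
  assumes "centered_gaussian M X"
  shows "(\<integral>\<omega>. iexp (X \<omega>) \<partial>M) = complex_of_real (exp (- (\<integral>\<omega>. (X \<omega>)\<^sup>2 \<partial>M) / 2))"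
proof -
  have X[measurable]: "X \<in> borel_measurable M" using assms by (simp add: centered_gaussian_def)
  consider "AE \<omega> in M. X \<omega> = 0" | \<sigma> where "\<sigma> > 0" "distributed M lborel X (normal_density 0 \<sigma>)"
    using assms by (auto simp: centered_gaussian_def)
  then show ?thesis
  proof cases
    case 1
    have "(\<integral>\<omega>. iexp (X \<omega>) \<partial>M) = (\<integral>\<omega>. 1 \<partial>M)"
      by (rule integral_cong_AE) (use 1 in \<open>auto elim: eventually_mono\<close>)
    moreover have "(\<integral>\<omega>. (X \<omega>)\<^sup>2 \<partial>M) = 0"
      by (rule integral_eq_zero_AE) (use 1 in \<open>auto elim: eventually_mono\<close>)
    ultimately show ?thesis by (simp add: prob_space)
  next
    case 2
    define Y where "Y = (\<lambda>\<omega>. X \<omega> / \<sigma>)"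
    have Y: "distributed M lborel Y std_normal_density"
      using 2 normal_standard_normal_convert[of \<sigma> X 0] by (simp add: Y_def)
    have XY: "X \<omega> = \<sigma> * Y \<omega>" for \<omega> using 2 by (simp add: Y_def)
    have [measurable]: "Y \<in> borel_measurable M" unfolding Y_def by measurable
    have dY: "distr M borel Y = std_normal_distribution"
      using distributed_distr_eq_density[OF Y] by (simp cong: distr_cong)
    have "(\<integral>\<omega>. iexp (X \<omega>) \<partial>M) = char (distr M borel Y) \<sigma>"
      by (simp add: char_def integral_distr XY)
    then have 1: "(\<integral>\<omega>. iexp (X \<omega>) \<partial>M) = complex_of_real (exp (- \<sigma>\<^sup>2 / 2))"
      by (simp add: dY char_std_normal_distribution)
    have "(\<integral>\<omega>. (Y \<omega>)\<^sup>2 \<partial>M) = 1"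
      using standard_normal_distributed_variance[OF Y] standard_normal_distributed_expectation[OF Y] by simp
    then have "(\<integral>\<omega>. (X \<omega>)\<^sup>2 \<partial>M) = \<sigma>\<^sup>2" by (simp add: XY power_mult_distrib)
    then show ?thesis using 1 by simp
  qed
qed

lemma indicat_step_functions: "s \<in> {0..T} \<Longrightarrow> indicat_real {0..s} \<in> step_functions T"
  unfolding step_functions_def by (intro CollectI exI[of _ 1] exI[of _ "\<lambda>_. 1"] exI[of _ "\<lambda>_. s"]) auto

lemma step_completion_lin:
  assumes "step_completion M T Z J" "\<phi> \<in> step_functions T" "\<psi> \<in> step_functions T"
  shows "J (\<lambda>x. a * \<phi> x + b * \<psi> x) = a *\<^sub>R J \<phi> + b *\<^sub>R J \<psi>"
  using assms by (auto simp: step_completion_def)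

lemma step_completion_sum:
  fixes n :: nat
  assumes J: "step_completion M T Z J" and T: "0 \<le> T" and s: "\<And>i. i < n \<Longrightarrow> s i \<in> {0..T}"
  shows "J (\<lambda>x. \<Sum>i<n. c i * indicat_real {0..s i} x) = (\<Sum>i<n. c i *\<^sub>R J (indicat_real {0..s i}))"
  using s
proof (induction n)
  case 0
  \<comment> \<open>The value of \<open>J\<close> at the zero function is found from a combination
    with both coefficients 0; the time 0 serves only to have some step function at hand, whence
    \<open>0 \<le> T\<close>.\<close>
  show ?case
    using step_completion_lin[OF J indicat_step_functions[of 0 T] indicat_step_functions[of 0 T], of 0 0] T by simp
next
  case (Suc n)
  have 1: "(\<lambda>x. \<Sum>i<n. c i * indicat_real {0..s i} x) \<in> step_functions T"
    using Suc.prems unfolding step_functions_def by (intro CollectI exI[of _ n] exI[of _ c] exI[of _ s]) auto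
  have 2: "indicat_real {0..s n} \<in> step_functions T" using Suc.prems by (intro indicat_step_functions) auto
  from step_completion_lin[OF J 1 2, of 1 "c n"] Suc show ?case by simp
qed

lemma step_completion_incr:
  assumes J: "step_completion M T Z J" and "t \<in> {0..T}" "t + h \<in> {0..T}"
  shows "J (step_incr t h) = J (indicat_real {0..t + h}) - J (indicat_real {0..t})"
  using step_completion_lin[OF J indicat_step_functions[OF assms(3)] indicat_step_functions[OF assms(2)], of 1 "-1"]
  by (simp add: step_incr_def[abs_def])

lemma cmod_iexp_diff_le: "cmod (iexp x - iexp y) \<le> \<bar>x - y\<bar>"
proof -
  have "iexp x - iexp y = iexp y * (iexp (x - y) - 1)"
    by (simp add: right_diff_distrib exp_add[symmetric])
  then have "cmod (iexp x - iexp y) = cmod (iexp (x - y) - 1)" by (simp add: norm_mult)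
  also have "\<dots> \<le> \<bar>x - y\<bar>" using iexp_approx1[of "x - y" 0] by simp
  finally show ?thesis .
qed

text \<open>On images of step functions \<open>W\<close> is almost everywhere a finite combination
  of values of \<open>Z\<close>, hence Gaussian with variance given by the norm. Density of these
  images and continuity of the characteristic function in \<open>h\<close> extend the formula to the
  whole space.\<close>

lemma isonormal_gaussianI:
  assumes M: "prob_space M" and Z: "centered_gaussian_process M {0..T} Z" and T: "0 \<le> T"
    and J: "step_completion M T Z J" and W: "isonormal_extension M T Z J W"
  shows "isonormal_gaussian M W"
proof -
  interpret prob_space M by fact
  have WL2: "W h \<in> L2 M" and lin: "AE \<omega> in M. W (a *\<^sub>R h + b *\<^sub>R k) \<omega> = a * W h \<omega> + b * W k \<omega>"
    and inn: "(\<integral>\<omega>. W h \<omega> * W k \<omega> \<partial>M) = inner h k"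
    and ext: "u \<in> {0..T} \<Longrightarrow> AE \<omega> in M. W (J (indicat_real {0..u})) \<omega> = Z u \<omega>" for a b h k u
    using W by (auto simp: isonormal_extension_def)
  have [measurable]: "W h \<in> borel_measurable M" for h using WL2[of h] by (rule L2_measurable)
  have sq: "(\<integral>\<omega>. (W h \<omega>)\<^sup>2 \<partial>M) = (norm h)\<^sup>2" for h
    using inn[of h h] by (simp add: power2_eq_square[of "W h _"] power2_norm_eq_inner)
  have step: "(\<integral>\<omega>. iexp (W (J \<phi>) \<omega>) \<partial>M) = complex_of_real (exp (- (norm (J \<phi>))\<^sup>2 / 2))"
    if step_fun: "\<phi> \<in> step_functions T" for \<phi>
  proof -
    obtain n c s where s: "\<And>i::nat. i < n \<Longrightarrow> s i \<in> {0..T}" and \<phi>: "\<phi> = (\<lambda>x. \<Sum>i<n. c i * indicat_real {0..s i} x)"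
      using step_fun unfolding step_functions_def by blast
    have "AE \<omega> in M. W (\<Sum>i<m. c i *\<^sub>R J (indicat_real {0..s i})) \<omega> = (\<Sum>i<m. c i * Z (s i) \<omega>)" if "m \<le> n" for m
      using that
    proof (induction m)
      case 0
      show ?case using lin[of 0 0 0 0] by eventually_elim simp
    next
      case (Suc m)
      have "AE \<omega> in M. W (J (indicat_real {0..s m})) \<omega> = Z (s m) \<omega>" using ext s Suc.prems by auto
      moreover have "AE \<omega> in M. W (\<Sum>i<m. c i *\<^sub>R J (indicat_real {0..s i})) \<omega> = (\<Sum>i<m. c i * Z (s i) \<omega>)"
        using Suc by simp
      ultimately show ?case
        using lin[of 1 "\<Sum>i<m. c i *\<^sub>R J (indicat_real {0..s i})" "c m" "J (indicat_real {0..s m})"]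
        by eventually_elim simp
    qed
    from this[OF order_refl] have ae: "AE \<omega> in M. W (J \<phi>) \<omega> = (\<Sum>i<n. c i * Z (s i) \<omega>)"
      unfolding \<phi> by (subst step_completion_sum[where n=n and s=s and c=c, OF J T]) (use s in auto)
    have cg: "centered_gaussian M (\<lambda>\<omega>. \<Sum>i<n. c i * Z (s i) \<omega>)"
      using Z s by (auto simp: centered_gaussian_process_def)
    then have [measurable]: "(\<lambda>\<omega>. \<Sum>i<n. c i * Z (s i) \<omega>) \<in> borel_measurable M" by (simp add: centered_gaussian_def)
    have "(\<integral>\<omega>. iexp (W (J \<phi>) \<omega>) \<partial>M) = (\<integral>\<omega>. iexp (\<Sum>i<n. c i * Z (s i) \<omega>) \<partial>M)"
      by (rule integral_cong_AE) (use ae in \<open>auto elim: eventually_mono simp del: of_real_sum\<close>)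
    also have "\<dots> = complex_of_real (exp (- (\<integral>\<omega>. (\<Sum>i<n. c i * Z (s i) \<omega>)\<^sup>2 \<partial>M) / 2))"
      by (rule centered_gaussian_char[OF cg])
    also have "(\<integral>\<omega>. (\<Sum>i<n. c i * Z (s i) \<omega>)\<^sup>2 \<partial>M) = (\<integral>\<omega>. (W (J \<phi>) \<omega>)\<^sup>2 \<partial>M)"
      by (rule integral_cong_AE) (use ae in \<open>auto elim: eventually_mono\<close>)
    finally show ?thesis by (simp add: sq)
  qed
  \<comment> \<open>The map from \<open>h\<close> to the mean of \<open>iexp (W h \<omega>)\<close>
    is 1-Lipschitz: the complex exponential is, and the mean of
    \<open>\<bar>W (k - h) \<omega>\<bar>\<close> is at most \<open>norm (k - h)\<close> by
    Cauchy-Schwarz and the isometry.\<close>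
  have near: "cmod ((\<integral>\<omega>. iexp (W k \<omega>) \<partial>M) - (\<integral>\<omega>. iexp (W h \<omega>) \<partial>M)) \<le> norm (k - h)" for k h
  proof -
    have i: "integrable M (\<lambda>\<omega>. iexp (W h \<omega>))" for h by (rule integrable_const_bound[of _ 1]) auto
    have ae: "AE \<omega> in M. W (k - h) \<omega> = W k \<omega> - W h \<omega>" using lin[of 1 k "-1" h] by eventually_elim simp
    have "cmod ((\<integral>\<omega>. iexp (W k \<omega>) \<partial>M) - (\<integral>\<omega>. iexp (W h \<omega>) \<partial>M)) = cmod (\<integral>\<omega>. iexp (W k \<omega>) - iexp (W h \<omega>) \<partial>M)"
      using i by (subst Bochner_Integration.integral_diff) auto
    also have "\<dots> \<le> (\<integral>\<omega>. cmod (iexp (W k \<omega>) - iexp (W h \<omega>)) \<partial>M)" by (rule integral_norm_bound)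
    also have "\<dots> \<le> (\<integral>\<omega>. \<bar>W (k - h) \<omega> * 1\<bar> \<partial>M)"
    proof (rule integral_mono_AE)
      show "integrable M (\<lambda>\<omega>. cmod (iexp (W k \<omega>) - iexp (W h \<omega>)))" using i by auto
      show "integrable M (\<lambda>\<omega>. \<bar>W (k - h) \<omega> * 1\<bar>)" using L2_integrable[OF WL2] by simp
      show "AE \<omega> in M. cmod (iexp (W k \<omega>) - iexp (W h \<omega>)) \<le> \<bar>W (k - h) \<omega> * 1\<bar>"
        using ae by eventually_elim (use cmod_iexp_diff_le in simp)
    qed
    also have "\<dots> \<le> norm (k - h)"
      using L2_Cauchy_Schwarz[OF WL2[of "k - h"] L2_const[of 1]]
      by (intro power2_le_imp_le[OF _ norm_ge_zero]) (simp add: sq prob_space)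
    finally show ?thesis .
  qed
  show ?thesis
  proof
    fix h
    have "h \<in> closure (J ` step_functions T)" using J by (simp add: step_completion_def)
    then obtain x where x: "\<And>n. x n \<in> J ` step_functions T" "x \<longlonglongrightarrow> h" unfolding closure_sequential by blast
    have "(\<lambda>n. norm (x n - h)) \<longlonglongrightarrow> 0"
      using x(2) by (simp add: LIM_zero_iff tendsto_norm_zero_iff)
    then have "(\<lambda>n. (\<integral>\<omega>. iexp (W (x n) \<omega>) \<partial>M) - (\<integral>\<omega>. iexp (W h \<omega>) \<partial>M)) \<longlonglongrightarrow> 0"
      by (rule Lim_null_comparison[rotated]) (use near in auto)
    then have "(\<lambda>n. \<integral>\<omega>. iexp (W (x n) \<omega>) \<partial>M) \<longlonglongrightarrow> (\<integral>\<omega>. iexp (W h \<omega>) \<partial>M)" by (simp only: LIM_zero_iff)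
    moreover have "(\<integral>\<omega>. iexp (W (x n) \<omega>) \<partial>M) = complex_of_real (exp (- (norm (x n))\<^sup>2 / 2))" for n
      using x(1)[of n] step by auto
    moreover have "(\<lambda>n. complex_of_real (exp (- (norm (x n))\<^sup>2 / 2))) \<longlonglongrightarrow> complex_of_real (exp (- (norm h)\<^sup>2 / 2))"
      by (intro tendsto_intros x) auto
    ultimately show "(\<integral>\<omega>. iexp (W h \<omega>) \<partial>M) = complex_of_real (exp (- (norm h)\<^sup>2 / 2))"
      by (auto intro: LIMSEQ_unique)
  qed (use WL2 lin inn in auto)
qed

lemma integrable_bounded_mult:
  fixes f g :: "'a \<Rightarrow> real"
  assumes f: "integrable M f" and g[measurable]: "g \<in> borel_measurable M" and C: "\<And>\<omega>. \<bar>g \<omega>\<bar> \<le> C"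
  shows "integrable M (\<lambda>\<omega>. g \<omega> * f \<omega>)"
proof (rule Bochner_Integration.integrable_bound)
  have [measurable]: "f \<in> borel_measurable M" using f by auto
  show "(\<lambda>\<omega>. g \<omega> * f \<omega>) \<in> borel_measurable M" by measurable
  show "integrable M (\<lambda>\<omega>. C * f \<omega>)" using f by simp
  show "AE \<omega> in M. norm (g \<omega> * f \<omega>) \<le> norm (C * f \<omega>)"
  proof (rule AE_I2)
    fix \<omega>
    have "\<bar>g \<omega>\<bar> \<le> \<bar>C\<bar>" using C[of \<omega>] by simp
    then show "norm (g \<omega> * f \<omega>) \<le> norm (C * f \<omega>)" by (simp add: abs_mult mult_right_mono)
  qed
qed

text \<open>This links integration by parts with conditional expectations: cosines and sines are
  bounded with bounded continuous derivatives, hence admissible test functions, and they are enough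
  to determine integrals over the generated field.\<close>

lemma test_moments_eq_0_imp_set_integral_eq_0:
  fixes X Y :: "'a \<Rightarrow> real"
  assumes X: "X \<in> borel_measurable M" and Y: "integrable M Y"
    and test: "\<And>\<phi> \<phi>' C. (\<And>x. (\<phi> has_real_derivative \<phi>' x) (at x)) \<Longrightarrow> continuous_on UNIV \<phi>' \<Longrightarrow>
      (\<And>x. \<bar>\<phi> x\<bar> \<le> C) \<Longrightarrow> (\<And>x. \<bar>\<phi>' x\<bar> \<le> C) \<Longrightarrow> (\<integral>\<omega>. \<phi> (X \<omega>) * Y \<omega> \<partial>M) = 0"
    and A: "A \<in> sets (sigma_rv M X)"
  shows "(\<integral>\<omega>\<in>A. Y \<omega> \<partial>M) = 0"
proof (rule trig_moments_eq_0_imp_set_integral_eq_0[OF X Y _ _ A])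
  fix s :: real
  \<comment> \<open>The constant \<open>1 + \<bar>s\<bar>\<close> bounds at once the function and
    its derivative, which carries the inner factor \<open>s\<close>.\<close>
  have *: "\<bar>y\<bar> \<le> 1 + \<bar>s\<bar>" "\<bar>y * s\<bar> \<le> 1 + \<bar>s\<bar>" if "\<bar>y\<bar> \<le> 1" for y
    using that mult_right_mono[OF that, of "\<bar>s\<bar>"] by (auto simp: abs_mult)
  show "(\<integral>\<omega>. cos (s * X \<omega>) * Y \<omega> \<partial>M) = 0"
    by (rule test[of "\<lambda>x. cos (s * x)" "\<lambda>x. - sin (s * x) * s" "1 + \<bar>s\<bar>"])
       (rule *; simp | auto intro!: derivative_eq_intros continuous_intros)+
  show "(\<integral>\<omega>. sin (s * X \<omega>) * Y \<omega> \<partial>M) = 0"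
    by (rule test[of "\<lambda>x. sin (s * x)" "\<lambda>x. cos (s * x) * s" "1 + \<bar>s\<bar>"])
       (rule *; simp | auto intro!: derivative_eq_intros continuous_intros)+
qed

lemma subalgebra_sigma_rv:
  assumes "X \<in> borel_measurable M"
  shows "subalgebra M (sigma_rv M X)"
proof -
  have "sets (sigma_rv M X) \<subseteq> sets M"
    unfolding sigma_rv_def using assms by (subst sets_vimage_algebra2) (auto simp: measurable_sets)
  then show ?thesis by (simp add: subalgebra_def sigma_rv_def)
qed

lemma measurable_sigma_rv: "X \<in> borel_measurable (sigma_rv M X)"
  unfolding sigma_rv_def by (rule measurable_vimage_algebra1) auto

theorem theorem2:
  fixes P Q :: "'a measure"
    and Z :: "real \<Rightarrow> 'a \<Rightarrow> real"
    and T t :: real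
    and J :: "(real \<Rightarrow> real) \<Rightarrow> 'h::{real_inner, banach, second_countable_topology}"
    and W :: "'h \<Rightarrow> 'a \<Rightarrow> real"
    and g :: 'h
    and \<zeta> \<mu> :: "'a \<Rightarrow> real"
    and D\<zeta> :: "'a \<Rightarrow> 'h"
  assumes "prob_space P" and "prob_space Q"
    and "sets Q = sets P"
    and "absolutely_continuous P Q" and "absolutely_continuous Q P"
    and "\<forall>u\<in>{0..T}. Z u \<in> L2 P"
    and "centered_gaussian_process Q {0..T} Z"
    and "step_completion Q T Z J"
    and "isonormal_extension Q T Z J W"
    and "t \<in> {0<..<T}"
    and "inner (J (indicat_real {0..t})) g \<noteq> 0"
    and "AE \<omega> in P. RN_deriv P Q \<omega> = ennreal (exp (- \<zeta> \<omega>))"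
    and "has_malliavin_derivative Q W \<zeta> D\<zeta>"
    and "integrable P (\<lambda>\<omega>. inner (J (indicat_real {0..t})) (D\<zeta> \<omega>))"
        \<comment> \<open>needed for the conditional expectations in the conclusion to be defined\<close>
    and "L2_tendsto P (\<lambda>h \<omega>. inner (J (step_incr t h)) (D\<zeta> \<omega>) / h) \<mu> (at 0)"
  shows
    "(L2_differentiates P (sigma_rv P (W g)) Z t \<longleftrightarrow> L2_differentiates Q (sigma_rv Q (W g)) Z t) \<and>
     (L2_differentiates Q (sigma_rv Q (W g)) Z t \<longleftrightarrow>
        (\<exists>c. ((\<lambda>u. inner g (J (indicat_real {0..u}))) has_real_derivative c) (at t) \<and>
             ((\<lambda>u. covariance Q (W g) (Z u)) has_real_derivative c) (at t))) \<and>
     ((\<lambda>u. inner g (J (indicat_real {0..u}))) differentiable (at t) \<longleftrightarrow>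
        (\<lambda>u. covariance Q (W g) (Z u)) differentiable (at t)) \<and>
     (L2_differentiates Q (sigma_rv Q (W g)) Z t \<longrightarrow>
        (AE \<omega> in P. L2_derivative P (sigma_rv P (W g)) Z t \<omega> =
           (norm g)\<^sup>2 *
             real_cond_exp P (sigma_rv P (W g))
               (\<lambda>\<omega>. Z t \<omega> - inner (J (indicat_real {0..t})) (D\<zeta> \<omega>)) \<omega> /
             (W g \<omega> * inner g (J (indicat_real {0..t}))) *
             L2_derivative Q (sigma_rv Q (W g)) Z t \<omega> +
           real_cond_exp P (sigma_rv P (W g)) \<mu> \<omega>)) \<and>
     (\<not> L2_differentiates Q (sigma_rv Q (W g)) Z t \<longrightarrow>
        (\<forall>H. subalgebra (sigma_rv P (W g)) H \<longrightarrow>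
           (L2_differentiates P H Z t \<longleftrightarrow>
              (AE \<omega> in P. real_cond_exp P H
                 (\<lambda>\<omega>. Z t \<omega> - inner (J (indicat_real {0..t})) (D\<zeta> \<omega>)) \<omega> = 0)) \<and>
           (L2_differentiates P H Z t \<longrightarrow>
              (AE \<omega> in P. L2_derivative P H Z t \<omega> = real_cond_exp P H \<mu> \<omega>))))"
proof -
  interpret P: prob_space P by fact
  interpret Q: prob_space Q by fact
  have setsQ[measurable_cong]: "sets Q = sets P" and Q_P: "absolutely_continuous P Q" and P_Q: "absolutely_continuous Q P"
    by fact+
  have ZL2P: "u \<in> {0..T} \<Longrightarrow> Z u \<in> L2 P" for u using assms(6) by auto
  have J: "step_completion Q T Z J" and W: "isonormal_extension Q T Z J W" and mall: "has_malliavin_derivative Q W \<zeta> D\<zeta>"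
    by fact+
  have t: "0 < t" "t < T" and t': "t \<in> {0..T}" using assms(10) by auto
  have IG: "isonormal_gaussian Q W"
    by (rule isonormal_gaussianI[OF assms(2) assms(7) _ J W]) (use t in simp)
  interpret IG: isonormal_gaussian Q W by (rule IG)
  define e where "e = J (indicat_real {0..t})"
  have ge: "inner g e \<noteq> 0" using assms(11) by (simp add: e_def inner_commute)
  then have g0: "g \<noteq> 0" by auto
  \<comment> \<open>\<open>k h\<close> represents the increment of \<open>Z\<close>, and for small
    \<open>h\<close> the number \<open>q h\<close> is the difference quotient at \<open>t\<close> of
    the inner product of \<open>g\<close> with the indicator of [0,u]. All questions of
    differentiability reduce to the convergence of \<open>q\<close>.\<close>
  define k where "k = (\<lambda>h. J (step_incr t h))"
  define q where "q = (\<lambda>h. inner g (k h) / h)"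
  have AE_PQ: "(AE \<omega> in P. R \<omega>) \<longleftrightarrow> (AE \<omega> in Q. R \<omega>)" for R
    using absolutely_continuous_AE[OF setsQ Q_P] absolutely_continuous_AE[OF setsQ[symmetric] P_Q] by blast
  have meas_PQ: "borel_measurable P = borel_measurable Q"
    by (rule measurable_cong_sets) (simp_all add: setsQ)
  have WmP[measurable]: "W h \<in> borel_measurable P" for h using IG.W_meas meas_PQ by auto
  have spaceQ: "space Q = space P" by (rule sets_eq_imp_space_eq[OF setsQ])
  have ZmP: "u \<in> {0..T} \<Longrightarrow> Z u \<in> borel_measurable P" for u using ZL2P L2_measurable by blast
  have \<zeta>m[measurable]: "\<zeta> \<in> borel_measurable P" and D\<zeta>m[measurable]: "D\<zeta> \<in> borel_measurable P"
    using mall measurable_cong_sets[OF setsQ refl] by (auto simp: has_malliavin_derivative_def L2_tendsto_def L2_def)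

  \<comment> \<open>Change of measure between P and Q\<close>
  have "Q = density P (RN_deriv P Q)" by (rule P.density_RN_deriv[OF Q_P setsQ, symmetric])
  also have "\<dots> = density P (\<lambda>\<omega>. ennreal (exp (- \<zeta> \<omega>)))"
    by (rule density_cong) (use assms(12) in auto)
  finally have Q_eq: "Q = density P (\<lambda>\<omega>. ennreal (exp (- \<zeta> \<omega>)))" .
  have P_eq: "density Q (\<lambda>\<omega>. ennreal (exp (\<zeta> \<omega>))) = P"
  proof -
    have "density Q (\<lambda>\<omega>. ennreal (exp (\<zeta> \<omega>))) = density P (\<lambda>\<omega>. ennreal (exp (- \<zeta> \<omega>)) * ennreal (exp (\<zeta> \<omega>)))"
      unfolding Q_eq by (rule density_density_eq) auto
    also have "\<dots> = density P (\<lambda>_. 1)"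
      by (simp add: ennreal_mult[symmetric] exp_minus)
    finally show ?thesis by (simp add: density_1)
  qed
  \<comment> \<open>Integrals under P become integrals under Q with weight
    \<open>exp (\<zeta> \<omega>)\<close>, exactly the shape of
    \<open>integration_by_parts_exp\<close>.\<close>
  have int_PQ: "integrable P f \<longleftrightarrow> integrable Q (\<lambda>\<omega>. exp (\<zeta> \<omega>) * f \<omega>)"
    and integral_PQ: "(\<integral>\<omega>. f \<omega> \<partial>P) = (\<integral>\<omega>. exp (\<zeta> \<omega>) * f \<omega> \<partial>Q)"
    if "f \<in> borel_measurable P" for f :: "'a \<Rightarrow> real"
  proof -
    have [measurable]: "f \<in> borel_measurable Q" "\<zeta> \<in> borel_measurable Q" using that \<zeta>m meas_PQ by auto
    show "integrable P f \<longleftrightarrow> integrable Q (\<lambda>\<omega>. exp (\<zeta> \<omega>) * f \<omega>)"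
      unfolding P_eq[symmetric] by (subst integrable_density) auto
    show "(\<integral>\<omega>. f \<omega> \<partial>P) = (\<integral>\<omega>. exp (\<zeta> \<omega>) * f \<omega> \<partial>Q)"
      unfolding P_eq[symmetric] by (subst integral_density) auto
  qed

  \<comment> \<open>Integration by parts under P\<close>
  have ibp: "(\<integral>\<omega>. \<phi> (W g \<omega>) * (W l \<omega> - inner (D\<zeta> \<omega>) l) \<partial>P) = inner g l * (\<integral>\<omega>. \<phi>' (W g \<omega>) \<partial>P)"
    if l: "integrable P (W l)" "integrable P (\<lambda>\<omega>. inner (D\<zeta> \<omega>) l)"
      and \<phi>: "\<And>x. (\<phi> has_real_derivative \<phi>' x) (at x)" "continuous_on UNIV \<phi>'"
      and \<phi>b: "\<And>x. \<bar>\<phi> x\<bar> \<le> C" "\<And>x. \<bar>\<phi>' x\<bar> \<le> C" for l \<phi> \<phi>' C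
  proof -
    have "continuous_on UNIV \<phi>" using \<phi>(1) by (meson DERIV_isCont continuous_at_imp_continuous_on)
    then have [measurable]: "\<phi> \<in> borel_measurable borel" "\<phi>' \<in> borel_measurable borel"
      using \<phi>(2) by (auto intro: borel_measurable_continuous_onI)
    have "(\<integral>\<omega>. exp (\<zeta> \<omega>) * (\<phi> (W g \<omega>) * (W l \<omega> - inner (D\<zeta> \<omega>) l)) \<partial>Q) = inner g l * (\<integral>\<omega>. exp (\<zeta> \<omega>) * \<phi>' (W g \<omega>) \<partial>Q)"
    proof (rule IG.integration_by_parts_exp[OF mall _ _ _ \<phi> \<phi>b])
      show "integrable Q (\<lambda>\<omega>. exp (\<zeta> \<omega>))" using int_PQ[of "\<lambda>_. 1"] by simp
      show "integrable Q (\<lambda>\<omega>. exp (\<zeta> \<omega>) * W l \<omega>)" using int_PQ[of "W l"] l by simp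
      show "integrable Q (\<lambda>\<omega>. exp (\<zeta> \<omega>) * inner (D\<zeta> \<omega>) l)" using int_PQ[of "\<lambda>\<omega>. inner (D\<zeta> \<omega>) l"] l by simp
    qed
    then show ?thesis by (subst (1 2) integral_PQ) measurable
  qed

  \<comment> \<open>Increments of Z and their difference quotients\<close>
  have WZ: "AE \<omega> in P. W (J (indicat_real {0..u})) \<omega> = Z u \<omega>" if "u \<in> {0..T}" for u
    using W that by (simp add: isonormal_extension_def AE_PQ)
  have We: "AE \<omega> in P. W e \<omega> = Z t \<omega>" unfolding e_def by (rule WZ[OF t'])
  \<comment> \<open>\<open>Z\<close> and \<open>J\<close> are controlled only at times in [0,T]. As
    \<open>t\<close> is an interior point, \<open>t + h\<close> is such a time for all small
    \<open>h\<close>.\<close>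
  have ev: "\<forall>\<^sub>F h in at 0. h \<noteq> 0 \<and> t + h \<in> {0..T}"
  proof -
    have "\<forall>\<^sub>F h in at 0. h \<in> {- t<..<T - t} - {0}"
      using t by (intro eventually_at_in_open) auto
    then show ?thesis by eventually_elim auto
  qed
  have k_eq: "k h = J (indicat_real {0..t + h}) - e" if "t + h \<in> {0..T}" for h
    unfolding k_def e_def by (rule step_completion_incr[OF J t' that])
  have Wk: "AE \<omega> in P. W (k h) \<omega> = Z (t + h) \<omega> - Z t \<omega>" if "t + h \<in> {0..T}" for h
    using IG.W_lin[of 1 "J (indicat_real {0..t + h})" "-1" e, folded AE_PQ] WZ[OF that] We
    by eventually_elim (simp add: k_eq[OF that])
  define \<Delta> where "\<Delta> = (\<lambda>h \<omega>. (Z (t + h) \<omega> - Z t \<omega>) / h)"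
  have \<Delta>P: "\<forall>\<^sub>F h in at 0. \<Delta> h \<in> L2 P"
    using ev unfolding \<Delta>_def
  proof eventually_elim
    case (elim h)
    have "(\<lambda>\<omega>. Z (t + h) \<omega> - Z t \<omega>) \<in> L2 P" using elim t' by (intro L2_diff ZL2P) auto
    from L2_mult_left[OF this, of "1 / h"] show ?case by simp
  qed
  have \<Delta>Q: "\<forall>\<^sub>F h in at 0. \<Delta> h \<in> L2 Q"
    using ev
  proof eventually_elim
    case (elim h)
    show ?case
    proof (rule L2_cong_AE)
      show "(\<lambda>\<omega>. (1 / h) * W (k h) \<omega>) \<in> L2 Q" by (intro L2_mult_left IG.W_L2)
      show "\<Delta> h \<in> borel_measurable Q"
        using ZmP[of "t + h"] ZmP[OF t'] elim unfolding meas_PQ \<Delta>_def by auto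
      show "AE \<omega> in Q. (1 / h) * W (k h) \<omega> = \<Delta> h \<omega>"
        using Wk[of h, unfolded AE_PQ] elim by (auto simp: \<Delta>_def elim: eventually_mono)
    qed
  qed
  define N where "N = (\<lambda>h \<omega>. inner (k h) (D\<zeta> \<omega>) / h)"
  have Nlim: "L2_tendsto P N \<mu> (at 0)" using assms(15) by (simp add: N_def[abs_def] k_def)
  then have NP: "\<forall>\<^sub>F h in at 0. N h \<in> L2 P" by (simp add: L2_tendsto_def)
  define m where "m = (\<lambda>\<omega>. Z t \<omega> - inner e (D\<zeta> \<omega>))"
  have int_e: "integrable P (\<lambda>\<omega>. inner e (D\<zeta> \<omega>))" using assms(14) by (simp add: e_def)
  have int_Zt: "integrable P (Z t)" using ZL2P[OF t'] P.L2_integrable by blast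
  have int_We: "integrable P (W e)"
    by (rule Bochner_Integration.integrable_cong_AE_imp[OF int_Zt]) (use We in \<open>auto elim: eventually_mono\<close>)
  have int_m: "integrable P m" unfolding m_def using int_e int_Zt by simp
  have m_eq: "AE \<omega> in P. m \<omega> = W e \<omega> - inner (D\<zeta> \<omega>) e"
    using We by eventually_elim (simp add: m_def inner_commute)

  \<comment> \<open>The decomposition of the difference quotient on the field of Z(g)\<close>
  define G where "G = sigma_rv P (W g)"
  have G_Q: "sigma_rv Q (W g) = G" by (simp add: G_def sigma_rv_def spaceQ)
  have subG: "subalgebra P G" unfolding G_def by (rule subalgebra_sigma_rv) simp
  have subGQ: "subalgebra Q G" using subG setsQ spaceQ by (simp add: subalgebra_def)
  have WG: "W g \<in> borel_measurable G" unfolding G_def by (rule measurable_sigma_rv)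
  interpret FP: finite_measure_subalgebra P G by standard (rule subG)
  interpret FQ: finite_measure_subalgebra Q G by standard (rule subGQ)

  \<comment> \<open>Integration by parts for a direction \<open>l\<close> yields
    \<open>inner g l\<close> times the mean of \<open>\<phi>'\<close>. The reference variable under
    P is \<open>m\<close>, with \<open>l = e\<close>; under Q it is \<open>W g\<close>, with
    \<open>l = g\<close> and factor \<open>(norm g)\<^sup>2\<close>. Each coefficient is the factor
    of the increment divided by that of the reference variable.\<close>
  define aP where "aP = (\<lambda>h. q h / inner g e)"
  define aQ where "aQ = (\<lambda>h. q h / (norm g)\<^sup>2)"
  have eqP: "\<forall>\<^sub>F h in at 0. \<forall>A\<in>sets G. (\<integral>\<omega>\<in>A. \<Delta> h \<omega> - aP h * m \<omega> - N h \<omega> \<partial>P) = 0"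
    using ev NP \<Delta>P
  proof eventually_elim
    case (elim h)
    let ?Y = "\<lambda>\<omega>. \<Delta> h \<omega> - aP h * m \<omega> - N h \<omega>"
    have h: "h \<noteq> 0" using elim by simp
    have iN: "integrable P (N h)" using elim P.L2_integrable by blast
    have i\<Delta>: "integrable P (\<Delta> h)" using elim P.L2_integrable by blast
    have iY: "integrable P ?Y" using iN i\<Delta> int_m by simp
    \<comment> \<open>Integrability of the increment of the derivative term is read off from
      \<open>N h\<close>, which is square integrable under P for small \<open>h\<close>.\<close>
    have ik: "integrable P (\<lambda>\<omega>. inner (D\<zeta> \<omega>) (k h))"
      using integrable_mult_right[OF iN, of h] h by (simp add: N_def inner_commute)
    have iWk: "integrable P (W (k h))"
      using integrable_mult_right[OF i\<Delta>, of h]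
      by (rule Bochner_Integration.integrable_cong_AE_imp) (use Wk[of h] elim h in \<open>auto simp: \<Delta>_def elim: eventually_mono\<close>)
    have zero: "(\<integral>\<omega>. \<phi> (W g \<omega>) * ?Y \<omega> \<partial>P) = 0"
      if \<phi>: "\<And>x. (\<phi> has_real_derivative \<phi>' x) (at x)" "continuous_on UNIV \<phi>'"
        and \<phi>b: "\<And>x. \<bar>\<phi> x\<bar> \<le> C" "\<And>x. \<bar>\<phi>' x\<bar> \<le> C" for \<phi> \<phi>' C
    proof -
      have "continuous_on UNIV \<phi>" using \<phi>(1) by (meson DERIV_isCont continuous_at_imp_continuous_on)
      then have [measurable]: "\<phi> \<in> borel_measurable borel"
        by (auto intro: borel_measurable_continuous_onI)
      have b: "integrable P (\<lambda>\<omega>. \<phi> (W g \<omega>) * f \<omega>)" if "integrable P f" for f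
        by (rule integrable_bounded_mult[OF that _ \<phi>b(1)]) simp
      have "AE \<omega> in P. \<phi> (W g \<omega>) * ?Y \<omega> = (1 / h) * (\<phi> (W g \<omega>) * (W (k h) \<omega> - inner (D\<zeta> \<omega>) (k h)))
          - aP h * (\<phi> (W g \<omega>) * (W e \<omega> - inner (D\<zeta> \<omega>) e))"
        using Wk[OF elim(1)[THEN conjunct2]] m_eq
      proof eventually_elim
        case (elim \<omega>)
        show ?case
          unfolding \<Delta>_def N_def elim by (simp add: inner_commute diff_divide_distrib algebra_simps)
      qed
      then have "(\<integral>\<omega>. \<phi> (W g \<omega>) * ?Y \<omega> \<partial>P) = (\<integral>\<omega>. (1 / h) * (\<phi> (W g \<omega>) * (W (k h) \<omega> - inner (D\<zeta> \<omega>) (k h)))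
          - aP h * (\<phi> (W g \<omega>) * (W e \<omega> - inner (D\<zeta> \<omega>) e)) \<partial>P)"
        using iY by (intro integral_cong_AE) auto
      also have "\<dots> = (1 / h) * (\<integral>\<omega>. \<phi> (W g \<omega>) * (W (k h) \<omega> - inner (D\<zeta> \<omega>) (k h)) \<partial>P)
          - aP h * (\<integral>\<omega>. \<phi> (W g \<omega>) * (W e \<omega> - inner (D\<zeta> \<omega>) e) \<partial>P)"
        using b[of "\<lambda>\<omega>. W (k h) \<omega> - inner (D\<zeta> \<omega>) (k h)"] b[of "\<lambda>\<omega>. W e \<omega> - inner (D\<zeta> \<omega>) e"] iWk ik int_We int_e
        by (subst Bochner_Integration.integral_diff) (auto simp: inner_commute)
      \<comment> \<open>Both expectations are multiples of the same mean of \<open>\<phi>'\<close>,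
        which is now eliminated: \<open>aP h\<close> is the ratio for which the two terms
        cancel.\<close>
      also have "\<dots> = (1 / h) * (inner g (k h) * (\<integral>\<omega>. \<phi>' (W g \<omega>) \<partial>P)) - aP h * (inner g e * (\<integral>\<omega>. \<phi>' (W g \<omega>) \<partial>P))"
        using ibp[OF iWk ik \<phi> \<phi>b] ibp[OF int_We _ \<phi> \<phi>b] int_e by (simp add: inner_commute)
      also have "\<dots> = 0" using ge by (simp add: aP_def q_def)
      finally show ?thesis .
    qed
    show ?case
    proof
      fix A assume "A \<in> sets G"
      then have A: "A \<in> sets (sigma_rv P (W g))" by (simp add: G_def)
      show "(\<integral>\<omega>\<in>A. ?Y \<omega> \<partial>P) = 0"
        by (rule test_moments_eq_0_imp_set_integral_eq_0[OF WmP iY zero A])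
    qed
  qed
  \<comment> \<open>Under Q no correction by the derivative of \<open>\<zeta>\<close> occurs; the
    trailing 0 stands for the term \<open>N h\<close> of the general decomposition.\<close>
  have eqQ: "\<forall>\<^sub>F h in at 0. \<forall>A\<in>sets G. (\<integral>\<omega>\<in>A. \<Delta> h \<omega> - aQ h * W g \<omega> - 0 \<partial>Q) = 0"
    using ev \<Delta>Q
  proof eventually_elim
    case (elim h)
    let ?Y = "\<lambda>\<omega>. \<Delta> h \<omega> - aQ h * W g \<omega> - 0"
    have h: "h \<noteq> 0" using elim by simp
    have i\<Delta>: "integrable Q (\<Delta> h)" using elim Q.L2_integrable by blast
    have iW: "integrable Q (W l)" for l using IG.W_L2 Q.L2_integrable by blast
    have iY: "integrable Q ?Y" using i\<Delta> iW by simp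
    have zero: "(\<integral>\<omega>. \<phi> (W g \<omega>) * ?Y \<omega> \<partial>Q) = 0"
      if \<phi>: "\<And>x. (\<phi> has_real_derivative \<phi>' x) (at x)" "continuous_on UNIV \<phi>'"
        and \<phi>b: "\<And>x. \<bar>\<phi> x\<bar> \<le> C" "\<And>x. \<bar>\<phi>' x\<bar> \<le> C" for \<phi> \<phi>' C
    proof -
      have "continuous_on UNIV \<phi>" using \<phi>(1) by (meson DERIV_isCont continuous_at_imp_continuous_on)
      then have [measurable]: "\<phi> \<in> borel_measurable borel"
        by (auto intro: borel_measurable_continuous_onI)
      have b: "integrable Q (\<lambda>\<omega>. \<phi> (W g \<omega>) * f \<omega>)" if "integrable Q f" for f
        by (rule integrable_bounded_mult[OF that _ \<phi>b(1)]) simp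
      have "AE \<omega> in Q. \<phi> (W g \<omega>) * ?Y \<omega> = (1 / h) * (\<phi> (W g \<omega>) * W (k h) \<omega>) - aQ h * (\<phi> (W g \<omega>) * W g \<omega>)"
        using Wk[OF elim(1)[THEN conjunct2], unfolded AE_PQ]
      proof eventually_elim
        case (elim \<omega>)
        show ?case
          unfolding \<Delta>_def elim by (simp add: diff_divide_distrib algebra_simps)
      qed
      then have "(\<integral>\<omega>. \<phi> (W g \<omega>) * ?Y \<omega> \<partial>Q) = (\<integral>\<omega>. (1 / h) * (\<phi> (W g \<omega>) * W (k h) \<omega>) - aQ h * (\<phi> (W g \<omega>) * W g \<omega>) \<partial>Q)"
        using iY by (intro integral_cong_AE) auto
      also have "\<dots> = (1 / h) * (\<integral>\<omega>. \<phi> (W g \<omega>) * W (k h) \<omega> \<partial>Q) - aQ h * (\<integral>\<omega>. \<phi> (W g \<omega>) * W g \<omega> \<partial>Q)"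
        using b[OF iW] by (subst Bochner_Integration.integral_diff) auto
      also have "\<dots> = 0"
        using g0 by (simp add: IG.integration_by_parts_W[OF \<phi> \<phi>b] aQ_def q_def power2_norm_eq_inner)
      finally show ?thesis .
    qed
    show ?case
    proof
      fix A assume "A \<in> sets G"
      then have A: "A \<in> sets (sigma_rv Q (W g))" by (simp add: G_Q)
      show "(\<integral>\<omega>\<in>A. ?Y \<omega> \<partial>Q) = 0"
        by (rule test_moments_eq_0_imp_set_integral_eq_0[OF IG.W_meas iY zero A])
    qed
  qed

  \<comment> \<open>Testing with \<open>arctan\<close>, whose derivative is positive, would otherwise give \<open>E[arctan' (W g)] = 0\<close>.\<close>
  have m_nz: "\<not> (AE \<omega> in P. real_cond_exp P G m \<omega> = 0)"
  proof
    assume z: "AE \<omega> in P. real_cond_exp P G m \<omega> = 0"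
    have am: "(\<lambda>\<omega>. arctan (W g \<omega>)) \<in> borel_measurable G"
      by (rule measurable_compose[OF WG]) (intro borel_measurable_continuous_onI continuous_intros)
    have arctan2: "\<bar>arctan x\<bar> \<le> 2" for x using arctan_bounded[of x] pi_less_4 by (simp add: abs_le_iff)
    have i: "integrable P (\<lambda>\<omega>. arctan (W g \<omega>) * m \<omega>)"
    proof (rule integrable_bounded_mult[OF int_m _ arctan2])
      show "(\<lambda>\<omega>. arctan (W g \<omega>)) \<in> borel_measurable P"
        by (rule measurable_compose[OF WmP]) (intro borel_measurable_continuous_onI continuous_intros)
    qed
    have pos: "integrable P (\<lambda>\<omega>. inverse (1 + (W g \<omega>)\<^sup>2))"
      by (rule P.integrable_const_bound[of _ 1]) (auto simp: inverse_le_1_iff abs_inverse add_nonneg_nonneg)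
    have "inner g e * (\<integral>\<omega>. inverse (1 + (W g \<omega>)\<^sup>2) \<partial>P) = (\<integral>\<omega>. arctan (W g \<omega>) * (W e \<omega> - inner (D\<zeta> \<omega>) e) \<partial>P)"
    proof (rule ibp[symmetric, OF int_We, where C=2])
      show "integrable P (\<lambda>\<omega>. inner (D\<zeta> \<omega>) e)" using int_e by (simp add: inner_commute)
      show "continuous_on UNIV (\<lambda>x::real. inverse (1 + x\<^sup>2))"
        by (intro continuous_intros) (simp add: add_nonneg_eq_0_iff)
      show "\<bar>arctan x\<bar> \<le> 2" for x by (rule arctan2)
      show "\<bar>inverse (1 + x\<^sup>2)\<bar> \<le> 2" for x :: real
        using inverse_le_1_iff[of "1 + x\<^sup>2"] by (simp add: abs_of_nonneg)
      show "(arctan has_real_derivative inverse (1 + x\<^sup>2)) (at x)" for x by (rule DERIV_arctan)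
    qed
    also have "\<dots> = (\<integral>\<omega>. arctan (W g \<omega>) * m \<omega> \<partial>P)"
      by (rule integral_cong_AE) (use m_eq int_m in \<open>auto elim: eventually_mono\<close>)
    also have "\<dots> = (\<integral>\<omega>. arctan (W g \<omega>) * real_cond_exp P G m \<omega> \<partial>P)"
      using FP.real_cond_exp_intg(2)[OF i am] int_m by simp
    also have "\<dots> = 0" by (rule integral_eq_zero_AE) (use z in \<open>auto elim: eventually_mono\<close>)
    finally have "(\<integral>\<omega>. inverse (1 + (W g \<omega>)\<^sup>2) \<partial>P) = 0" using ge by simp
    then have "AE \<omega> in P. inverse (1 + (W g \<omega>)\<^sup>2) = 0"
      using integral_nonneg_eq_0_iff_AE[OF pos] by (simp add: add_nonneg_nonneg)
    then have "AE \<omega> in P. False" by eventually_elim (simp add: add_nonneg_eq_0_iff)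
    then show False by simp
  qed
  have Wg_nz: "AE \<omega> in Q. W g \<omega> \<noteq> 0" by (rule IG.W_neq_0_AE[OF g0])
  \<comment> \<open>The reference variable under Q is measurable for the conditioning field, hence
    equal to its own conditional expectation, and it is nonzero almost everywhere.\<close>
  have cW: "AE \<omega> in Q. real_cond_exp Q G (W g) \<omega> = W g \<omega>"
    by (rule FQ.real_cond_exp_F_meas) (use IG.W_L2 Q.L2_integrable WG in auto)
  have W_nz: "\<not> (AE \<omega> in Q. real_cond_exp Q G (W g) \<omega> = 0)"
  proof
    assume "AE \<omega> in Q. real_cond_exp Q G (W g) \<omega> = 0"
    with cW Wg_nz have "AE \<omega> in Q. False" by eventually_elim simp
    then show False by simp
  qed

  \<comment> \<open>The decomposition criterion applied under Q and under P\<close>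
  have N0: "L2_tendsto Q (\<lambda>h \<omega>. 0::real) (\<lambda>\<omega>. 0) (at (0::real))"
    by (simp add: L2_tendsto_def L2_def)
  have c0: "AE \<omega> in Q. real_cond_exp Q G (\<lambda>\<omega>. 0) \<omega> = 0"
    by (rule FQ.real_cond_exp_F_meas) auto
  note decQ = Q.has_L2_derivative_decomposition[OF subGQ \<Delta>Q[unfolded \<Delta>_def] N0 Q.L2_integrable[OF IG.W_L2] eqQ[unfolded \<Delta>_def]]
  \<comment> \<open>Vanishing of the integrals over all sets of \<open>G\<close> includes the sets
    of any smaller field \<open>H\<close>, so the same coefficient \<open>aP\<close> and the same
    variables serve every \<open>H\<close>.\<close>
  have decP: "(aP \<longlongrightarrow> c) (at 0) \<Longrightarrow> has_L2_derivative P H Z t (\<lambda>\<omega>. c * real_cond_exp P H m \<omega> + real_cond_exp P H \<mu> \<omega>)"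
    "AE \<omega> in P. real_cond_exp P H m \<omega> = 0 \<Longrightarrow> has_L2_derivative P H Z t (real_cond_exp P H \<mu>)"
    "L2_differentiates P H Z t \<Longrightarrow> \<not> (AE \<omega> in P. real_cond_exp P H m \<omega> = 0) \<Longrightarrow> \<exists>c. (aP \<longlongrightarrow> c) (at 0)"
    if H: "subalgebra G H" for H c
  proof -
    have sub: "subalgebra P H" using H subG by (auto simp: subalgebra_def)
    have "\<forall>\<^sub>F h in at 0. \<forall>A\<in>sets H. (\<integral>\<omega>\<in>A. \<Delta> h \<omega> - aP h * m \<omega> - N h \<omega> \<partial>P) = 0"
      using eqP by eventually_elim (use H in \<open>auto simp: subalgebra_def\<close>)
    note d = P.has_L2_derivative_decomposition[OF sub \<Delta>P[unfolded \<Delta>_def] Nlim int_m this[unfolded \<Delta>_def]]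
    show "(aP \<longlongrightarrow> c) (at 0) \<Longrightarrow> has_L2_derivative P H Z t (\<lambda>\<omega>. c * real_cond_exp P H m \<omega> + real_cond_exp P H \<mu> \<omega>)"
      "AE \<omega> in P. real_cond_exp P H m \<omega> = 0 \<Longrightarrow> has_L2_derivative P H Z t (real_cond_exp P H \<mu>)"
      "L2_differentiates P H Z t \<Longrightarrow> \<not> (AE \<omega> in P. real_cond_exp P H m \<omega> = 0) \<Longrightarrow> \<exists>c. (aP \<longlongrightarrow> c) (at 0)"
      by (fact d)+
  qed

  \<comment> \<open>Differentiability as convergence of the scalar quotient\<close>
  have qP: "(aP \<longlongrightarrow> c / inner g e) (at 0) \<longleftrightarrow> (q \<longlongrightarrow> c) (at 0)" for c
  proof
    assume "(aP \<longlongrightarrow> c / inner g e) (at 0)"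
    from tendsto_mult_right[OF this, of "inner g e"] show "(q \<longlongrightarrow> c) (at 0)" using ge by (simp add: aP_def[abs_def])
  qed (use ge in \<open>auto simp: aP_def[abs_def] intro!: tendsto_divide\<close>)
  have qQ: "(aQ \<longlongrightarrow> c / (norm g)\<^sup>2) (at 0) \<longleftrightarrow> (q \<longlongrightarrow> c) (at 0)" for c
  proof
    assume "(aQ \<longlongrightarrow> c / (norm g)\<^sup>2) (at 0)"
    from tendsto_mult_right[OF this, of "(norm g)\<^sup>2"] show "(q \<longlongrightarrow> c) (at 0)" using g0 by (simp add: aQ_def[abs_def])
  qed (use g0 in \<open>auto simp: aQ_def[abs_def] intro!: tendsto_divide\<close>)
  have Qdiff: "L2_differentiates Q G Z t \<longleftrightarrow> (\<exists>c. (q \<longlongrightarrow> c) (at 0))"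
  proof
    assume "L2_differentiates Q G Z t"
    from decQ(3)[OF this W_nz] obtain c where "(aQ \<longlongrightarrow> c) (at 0)" by blast
    then have "(q \<longlongrightarrow> c * (norm g)\<^sup>2) (at 0)" using qQ[of "c * (norm g)\<^sup>2"] g0 by simp
    then show "\<exists>c. (q \<longlongrightarrow> c) (at 0)" by blast
  next
    assume "\<exists>c. (q \<longlongrightarrow> c) (at 0)"
    then show "L2_differentiates Q G Z t" using decQ(1) qQ unfolding L2_differentiates_def by blast
  qed
  have aP_conv: "(\<exists>c. (aP \<longlongrightarrow> c) (at 0)) \<longleftrightarrow> (\<exists>c. (q \<longlongrightarrow> c) (at 0))"
  proof
    assume "\<exists>c. (aP \<longlongrightarrow> c) (at 0)"
    then obtain c where "(aP \<longlongrightarrow> c) (at 0)" by blast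
    then have "(q \<longlongrightarrow> c * inner g e) (at 0)" using qP[of "c * inner g e"] ge by simp
    then show "\<exists>c. (q \<longlongrightarrow> c) (at 0)" by blast
  qed (use qP in blast)
  have GG: "subalgebra G G" by (simp add: subalgebra_def)
  \<comment> \<open>By \<open>m_nz\<close> the conditional expectation of \<open>m\<close> does not
    vanish on the full field of Z(g), so there differentiability forces \<open>aP\<close> to
    converge.\<close>
  have Pdiff: "L2_differentiates P G Z t \<longleftrightarrow> (\<exists>c. (q \<longlongrightarrow> c) (at 0))"
    using decP(3)[OF GG _ m_nz] decP(1)[OF GG] aP_conv unfolding L2_differentiates_def by blast

  \<comment> \<open>Identification with the derivative of the covariance\<close>
  have der_inner: "((\<lambda>u. inner g (J (indicat_real {0..u}))) has_real_derivative c) (at t) \<longleftrightarrow> (q \<longlongrightarrow> c) (at 0)" for c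
    unfolding DERIV_def
  proof (rule tendsto_cong)
    show "\<forall>\<^sub>F h in at 0. (inner g (J (indicat_real {0..t + h})) - inner g (J (indicat_real {0..t}))) / h = q h"
      using ev by eventually_elim (simp add: q_def k_eq inner_diff_right e_def)
  qed
  \<comment> \<open>The constant test function 1, with derivative 0, shows that every
    \<open>W l\<close> is centred, so the covariance is the plain inner product in mean
    square.\<close>
  have EW: "(\<integral>\<omega>. W l \<omega> \<partial>Q) = 0" for l
    using IG.integration_by_parts_W[of "\<lambda>_. 1" "\<lambda>_. 0" 1 g l] by simp
  have cov: "covariance Q (W g) (Z u) = inner g (J (indicat_real {0..u}))" if u: "u \<in> {0..T}" for u
  proof -
    have ZQ: "AE \<omega> in Q. W (J (indicat_real {0..u})) \<omega> = Z u \<omega>" using WZ[OF u] AE_PQ by simp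
    have ZmQ[measurable]: "Z u \<in> borel_measurable Q" using ZmP[OF u] meas_PQ by simp
    have "(\<integral>\<omega>. Z u \<omega> \<partial>Q) = (\<integral>\<omega>. W (J (indicat_real {0..u})) \<omega> \<partial>Q)"
      by (rule integral_cong_AE) (use ZQ in \<open>auto elim: eventually_mono\<close>)
    then have "covariance Q (W g) (Z u) = (\<integral>\<omega>. W g \<omega> * Z u \<omega> \<partial>Q)" by (simp add: covariance_def EW)
    also have "\<dots> = (\<integral>\<omega>. W g \<omega> * W (J (indicat_real {0..u})) \<omega> \<partial>Q)"
      by (rule integral_cong_AE) (use ZQ in \<open>auto elim: eventually_mono\<close>)
    finally show ?thesis by (simp add: IG.W_inner)
  qed
  \<comment> \<open>The two functions of \<open>u\<close> are known to agree for times in [0,T],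
    which contains a neighbourhood of \<open>t\<close>; this suffices for the derivative.\<close>
  have der_cov: "((\<lambda>u. covariance Q (W g) (Z u)) has_real_derivative c) (at t) \<longleftrightarrow> (q \<longlongrightarrow> c) (at 0)" for c
  proof -
    have "\<forall>\<^sub>F u in nhds t. u \<in> {0<..<T}" using t by (intro eventually_nhds_in_open) auto
    then have "\<forall>\<^sub>F u in nhds t. covariance Q (W g) (Z u) = inner g (J (indicat_real {0..u}))"
      by eventually_elim (simp add: cov)
    from DERIV_cong_ev[OF refl this refl] show ?thesis using der_inner[of c] by simp
  qed

  \<comment> \<open>The formula for the derivative and the non-differentiable case\<close>
  have formula: "AE \<omega> in P. L2_derivative P G Z t \<omega> =
      (norm g)\<^sup>2 * real_cond_exp P G m \<omega> / (W g \<omega> * inner g e) * L2_derivative Q G Z t \<omega> + real_cond_exp P G \<mu> \<omega>"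
    if diffQ: "L2_differentiates Q G Z t"
  proof -
    obtain c where c: "(q \<longlongrightarrow> c) (at 0)" using diffQ Qdiff by blast
    have 1: "AE \<omega> in P. L2_derivative P G Z t \<omega> = c / inner g e * real_cond_exp P G m \<omega> + real_cond_exp P G \<mu> \<omega>"
      by (rule P.L2_derivative_eq[OF decP(1)[OF GG]]) (use c qP in blast)
    have "AE \<omega> in Q. L2_derivative Q G Z t \<omega> = c / (norm g)\<^sup>2 * real_cond_exp Q G (W g) \<omega> + real_cond_exp Q G (\<lambda>\<omega>. 0) \<omega>"
      by (rule Q.L2_derivative_eq[OF decQ(1)]) (use c qQ in blast)
    with cW c0 have "AE \<omega> in Q. L2_derivative Q G Z t \<omega> = c / (norm g)\<^sup>2 * W g \<omega>" by eventually_elim simp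
    then have 2: "AE \<omega> in P. L2_derivative Q G Z t \<omega> = c / (norm g)\<^sup>2 * W g \<omega>" by (simp add: AE_PQ)
    have 3: "AE \<omega> in P. W g \<omega> \<noteq> 0" using Wg_nz by (simp add: AE_PQ)
    \<comment> \<open>The derivative under Q is \<open>c / (norm g)\<^sup>2 * W g \<omega>\<close>.
      Dividing by \<open>W g \<omega>\<close>, nonzero almost everywhere under both measures,
      recovers \<open>c\<close> and hence the coefficient \<open>c / inner g e\<close> under
      P.\<close>
    show ?thesis using 1 2 3 by eventually_elim (use ge g0 in \<open>simp add: field_simps\<close>)
  qed
  have nondiff: "(L2_differentiates P H Z t \<longleftrightarrow> (AE \<omega> in P. real_cond_exp P H m \<omega> = 0)) \<and>
      (L2_differentiates P H Z t \<longrightarrow> (AE \<omega> in P. L2_derivative P H Z t \<omega> = real_cond_exp P H \<mu> \<omega>))"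
    if "\<not> L2_differentiates Q G Z t" and H: "subalgebra G H" for H
  proof -
    \<comment> \<open>Without differentiability under Q the quotient \<open>q\<close> diverges, and
      \<open>aP\<close> with it. So on any smaller field the only way to a limit is that the
      conditional expectation of \<open>m\<close> vanishes.\<close>
    have n: "\<not> (\<exists>c. (aP \<longlongrightarrow> c) (at 0))" using that(1) Qdiff aP_conv by blast
    have 1: "AE \<omega> in P. real_cond_exp P H m \<omega> = 0" if "L2_differentiates P H Z t"
      using decP(3)[OF H that] n by blast
    have 2: "has_L2_derivative P H Z t (real_cond_exp P H \<mu>)" if "AE \<omega> in P. real_cond_exp P H m \<omega> = 0"
      by (rule decP(2)[OF H that])
    show ?thesis using 1 2 P.L2_derivative_eq unfolding L2_differentiates_def by blast
  qed
  show ?thesis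
    unfolding G_Q G_def[symmetric] e_def[symmetric] m_def[symmetric]
    using Pdiff Qdiff der_inner der_cov formula nondiff
    by (auto simp: real_differentiable_def)
qed

end
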